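(* Let $\mathcal Y\subseteq\mathcal X$ be a $k$-hierarchically quasiconvex subset of the hierarchically hyperbolic space $(\mathcal X,\mathfrak S)$. Then $(\mathcal Y,d)$ is a hierarchically hyperbolic space, where $d$ is the metric inherited from $\mathcal X$.
   Context: Hierarchically hyperbolic spaces (HHS). A $q$-quasigeodesic space is a metric space in which any two points are joined by a $(q,q)$-quasigeodesic. A $q$-quasigeodesic space $(\mathcal X,d_{\mathcal X})$ is an HHS (with structure $\mathfrak S$; one writes $(\mathcal X,\mathfrak S)$) if there are $\delta\ge0$, an index set $\mathfrak S$ and $\delta$-hyperbolic geodesic spaces $(\mathcal CW,d_W)$, $W\in\mathfrak S$, such that (1)–(9) below hold. Conventions: the distance between two sets is the infimum of distances between their points; for $x,y\in\mathcal X$ and $p\subseteq\mathcal CW$, $d_W(x,y)=d_W(\pi_W(x),\pi_W(y))$ and $d_W(x,p)=d_W(\pi_W(x),p)$; $\pi_W(A)=\bigcup_{a\in A}\pi_W(a)$; $V\sqsubset W$ means $V\sqsubseteq W$ and $V\ne W$. (1) Projections: there are $\xi,K\ge 0$ and maps $\pi_W:\mathcal X\to2^{\mathcal CW}$ ($W\in\mathfrak S$) sending points to nonempty sets of diameter $\le\xi$; each $\pi_W$ is $(K,K)$-coarsely Lipschitz and $\pi_W(\mathcal X)$ is $K$-quasiconvex in $\mathcal CW$. (2) Nesting: $\mathfrak S$ has a partial order $\sqsubseteq$, and either $\mathfrak S=\emptyset$ or there is a unique $\sqsubseteq$-maximal element. Put $\mathfrak S_W=\{V:V\sqsubseteq W\}$.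 If $V\sqsubset W$ there is a specified subset $\rho^V_W\subset\mathcal CW$ of diameter $\le\xi$ and a map $\rho^W_V:\mathcal CW\to2^{\mathcal CV}$. (3) Orthogonality: $\mathfrak S$ has a symmetric anti-reflexive relation $\perp$. If $V\sqsubseteq W$ and $W\perp U$ then $V\perp U$. For each $T\in\mathfrak S$ and $U\in\mathfrak S_T$ with $\{V\in\mathfrak S_T:V\perp U\}\ne\emptyset$ there is $W\in\mathfrak S_T-\{T\}$ such that $V\sqsubseteq W$ whenever $V\perp U$ and $V\sqsubseteq T$. If $V\perp W$ then $V,W$ are not $\sqsubseteq$-comparable. (4) Transversality and consistency: if $V,W$ are not orthogonal and neither is nested in the other they are transverse, $V\pitchfork W$. There is $\kappa_0\ge0$ such that: if $V\pitchfork W$ there are sets $\rho^V_W\subseteq\mathcal CW$, $\rho^W_V\subseteq\mathcal CV$ of diameter $\le\xi$ with $\min\{d_W(\pi_W(x),\rho^V_W),d_V(\pi_V(x),\rho^W_V)\}\le\kappa_0$ for all $x\in\mathcal X$; if $V\sqsubset W$ then $\min\{d_W(\pi_W(x),\rho^V_W),\mathrm{diam}_{\mathcal CV}(\pi_V(x)\cup\rho^W_V(\pi_W(x)))\}\le\kappa_0$ for all $x$; and if $U\sqsubseteq V$ then $d_W(\rho^U_W,\rho^V_W)\le\kappa_0$ whenever $V\sqsubset W$, or $V\pitchfork W$ and $W\not\perp U$. (5) Finite complexity: there is $n\ge0$ (the complexity) such that any set of pairwise $\sqsubseteq$-comparable elements has at most $n$ elements. (6) Large links: there are $\lambda\ge1$,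 $E\ge\max\{\xi,\kappa_0\}$ such that for $W\in\mathfrak S$, $x,x'\in\mathcal X$ and $N=\lambda d_W(x,x')+\lambda$ there is a collection $\{T_i\}\subseteq\mathfrak S_W-\{W\}$ of at most $\lfloor N\rfloor$ elements such that every $T\in\mathfrak S_W-\{W\}$ either lies in some $\mathfrak S_{T_i}$ or satisfies $d_T(x,x')<E$; moreover $d_W(x,\rho^{T_i}_W)\le N$ for all $i$. (7) Bounded geodesic image: there is $E>0$ such that for all $V\sqsubset W$ and all geodesics $\gamma$ of $\mathcal CW$, either $\mathrm{diam}_{\mathcal CV}(\rho^W_V(\gamma))\le E$ or $\gamma$ meets the $E$-neighborhood of $\rho^V_W$. (8) Partial realization: there is $\alpha$ such that for every family $\{V_j\}$ of pairwise orthogonal elements and $p_j\in\pi_{V_j}(\mathcal X)$ there is $x\in\mathcal X$ with $d_{V_j}(x,p_j)\le\alpha$ for all $j$, and $d_V(x,\rho^{V_j}_V)\le\alpha$ whenever $V_j\sqsubset V$ or $V\pitchfork V_j$ for some $j$. (9) Uniqueness: for each $\kappa\ge0$ there is $\theta_u(\kappa)$ such that $d_{\mathcal X}(x,y)\ge\theta_u(\kappa)$ implies $d_V(x,y)\ge\kappa$ for some $V\in\mathfrak S$. Hierarchical quasiconvexity. For $k:[0,\infty)\to[0,\infty)$, a subset $\mathcal Y\subseteq\mathcal X$ is $k$-hierarchically quasiconvex if $\pi_U(\mathcal Y)$ is $k(0)$-quasiconvex in $\mathcal CU$ for all $U\in\mathfrak S$, and for every $\kappa>0$, every $x\in\mathcal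 X$ with $d_U(\pi_U(x),\pi_U(\mathcal Y))\le\kappa$ for all $U\in\mathfrak S$ satisfies $d_{\mathcal X}(x,\mathcal Y)\le k(\kappa)$. *)

theory Defs
  imports "HOL-Analysis.Analysis"
begin

section \<open>Coarse metric notions\<close>

text \<open>Distances between sets and diameters are extended nonnegative reals, so that the distance
  to the empty set is \<open>\<infinity>\<close> and the diameter of an unbounded set is \<open>\<infinity>\<close>.\<close>

definition set_mdist :: "'a metric \<Rightarrow> 'a set \<Rightarrow> 'a set \<Rightarrow> ennreal" where
  "set_mdist m A B = (INF a\<in>A. INF b\<in>B. ennreal (mdist m a b))"

definition mdiam :: "'a metric \<Rightarrow> 'a set \<Rightarrow> ennreal" where
  "mdiam m A = (SUP a\<in>A. SUP b\<in>A. ennreal (mdist m a b))"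

definition mnbhd :: "'a metric \<Rightarrow> real \<Rightarrow> 'a set \<Rightarrow> 'a set" where
  "mnbhd m r A = {x \<in> mspace m. set_mdist m {x} A \<le> ennreal r}"

definition mgeodesic :: "'a metric \<Rightarrow> real set \<Rightarrow> (real \<Rightarrow> 'a) \<Rightarrow> bool" where
  "mgeodesic m I \<gamma> \<longleftrightarrow> is_interval I \<and> \<gamma> ` I \<subseteq> mspace m \<and>
     (\<forall>s\<in>I. \<forall>t\<in>I. mdist m (\<gamma> s) (\<gamma> t) = \<bar>s - t\<bar>)"

definition mgeodesic_segment :: "'a metric \<Rightarrow> 'a \<Rightarrow> 'a \<Rightarrow> 'a set \<Rightarrow> bool" where
  "mgeodesic_segment m x y P \<longleftrightarrow>
     (\<exists>l\<ge>0. \<exists>\<gamma>. mgeodesic m {0..l} \<gamma> \<and> \<gamma> 0 = x \<and> \<gamma> l = y \<and> P = \<gamma> ` {0..l})"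

definition geodesic_mspace :: "'a metric \<Rightarrow> bool" where
  "geodesic_mspace m \<longleftrightarrow> (\<forall>x\<in>mspace m. \<forall>y\<in>mspace m. \<exists>P. mgeodesic_segment m x y P)"

text \<open>Hyperbolicity is meant in the sense of \<open>\<delta>\<close>-slim geodesic triangles.\<close>

definition hyperbolic_geodesic_mspace :: "real \<Rightarrow> 'a metric \<Rightarrow> bool" where
  "hyperbolic_geodesic_mspace \<delta> m \<longleftrightarrow> geodesic_mspace m \<and>
     (\<forall>x y z P Q R. mgeodesic_segment m x y P \<and> mgeodesic_segment m y z Q \<and>
        mgeodesic_segment m x z R \<longrightarrow> P \<subseteq> mnbhd m \<delta> (Q \<union> R))"

definition mquasiconvex :: "'a metric \<Rightarrow> real \<Rightarrow> 'a set \<Rightarrow> bool" where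
  "mquasiconvex m K A \<longleftrightarrow>
     (\<forall>x\<in>A. \<forall>y\<in>A. \<forall>P. mgeodesic_segment m x y P \<longrightarrow> P \<subseteq> mnbhd m K A)"

definition quasigeodesic_mspace :: "real \<Rightarrow> 'a metric \<Rightarrow> bool" where
  "quasigeodesic_mspace q m \<longleftrightarrow>
     (\<forall>x\<in>mspace m. \<forall>y\<in>mspace m. \<exists>l\<ge>0. \<exists>\<gamma>.
        \<gamma> ` {0..l} \<subseteq> mspace m \<and> \<gamma> 0 = x \<and> \<gamma> l = y \<and>
        (\<forall>s\<in>{0..l}. \<forall>t\<in>{0..l}.
           \<bar>s - t\<bar> / q - q \<le> mdist m (\<gamma> s) (\<gamma> t) \<and>
           mdist m (\<gamma> s) (\<gamma> t) \<le> q * \<bar>s - t\<bar> + q))"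


section \<open>Hierarchically hyperbolic structures\<close>

text \<open>The data of a hierarchically hyperbolic structure on a space with points in \<open>'a\<close>.
  For transverse \<open>V\<close>, \<open>W\<close> or properly nested \<open>V \<sqsubset> W\<close>, the set
  \<open>\<rho>\<^sup>V\<^sub>W\<close>, a subset of \<open>CW\<close>, is \<open>rho_set H V W\<close>. For \<open>V \<sqsubset> W\<close>, the map
  \<open>\<rho>\<^sup>W\<^sub>V\<close> from \<open>CW\<close> to subsets of \<open>CV\<close> is \<open>rho_map H W V\<close>. The values of these
  functions for other pairs of indices are irrelevant.\<close>

record ('a, 'i, 'c) hh_structure =
  Idx :: "'i set"
  CSpace :: "'i \<Rightarrow> 'c metric"
  proj :: "'i \<Rightarrow> 'a \<Rightarrow> 'c set"
  nest :: "'i \<Rightarrow> 'i \<Rightarrow> bool"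
  orth :: "'i \<Rightarrow> 'i \<Rightarrow> bool"
  rho_set :: "'i \<Rightarrow> 'i \<Rightarrow> 'c set"
  rho_map :: "'i \<Rightarrow> 'i \<Rightarrow> 'c \<Rightarrow> 'c set"

definition proj_image :: "('a, 'i, 'c) hh_structure \<Rightarrow> 'i \<Rightarrow> 'a set \<Rightarrow> 'c set" where
  "proj_image H W A = (\<Union>a\<in>A. proj H W a)"

definition rho_image :: "('a, 'i, 'c) hh_structure \<Rightarrow> 'i \<Rightarrow> 'i \<Rightarrow> 'c set \<Rightarrow> 'c set" where
  "rho_image H W V A = (\<Union>p\<in>A. rho_map H W V p)"

definition idx_dist :: "('a, 'i, 'c) hh_structure \<Rightarrow> 'i \<Rightarrow> 'a \<Rightarrow> 'a \<Rightarrow> ennreal" where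
  "idx_dist H W x y = set_mdist (CSpace H W) (proj H W x) (proj H W y)"

definition idx_dist_set :: "('a, 'i, 'c) hh_structure \<Rightarrow> 'i \<Rightarrow> 'a \<Rightarrow> 'c set \<Rightarrow> ennreal" where
  "idx_dist_set H W x P = set_mdist (CSpace H W) (proj H W x) P"

definition pnest :: "('a, 'i, 'c) hh_structure \<Rightarrow> 'i \<Rightarrow> 'i \<Rightarrow> bool" where
  "pnest H V W \<longleftrightarrow> nest H V W \<and> V \<noteq> W"

definition transv :: "('a, 'i, 'c) hh_structure \<Rightarrow> 'i \<Rightarrow> 'i \<Rightarrow> bool" where
  "transv H V W \<longleftrightarrow> \<not> orth H V W \<and> \<not> nest H V W \<and> \<not> nest H W V"

definition below :: "('a, 'i, 'c) hh_structure \<Rightarrow> 'i \<Rightarrow> 'i set" where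
  "below H W = {V \<in> Idx H. nest H V W}"

definition hh_projections ::
  "'a metric \<Rightarrow> ('a, 'i, 'c) hh_structure \<Rightarrow> real \<Rightarrow> real \<Rightarrow> bool" where
  "hh_projections X H \<xi> K \<longleftrightarrow>
     (\<forall>W\<in>Idx H.
        (\<forall>x\<in>mspace X. proj H W x \<noteq> {} \<and> proj H W x \<subseteq> mspace (CSpace H W) \<and>
           mdiam (CSpace H W) (proj H W x) \<le> ennreal \<xi>) \<and>
        (\<forall>x\<in>mspace X. \<forall>y\<in>mspace X. idx_dist H W x y \<le> ennreal (K * mdist X x y + K)) \<and>
        mquasiconvex (CSpace H W) K (proj_image H W (mspace X)))"

text \<open>The sets \<open>\<rho>\<^sup>V\<^sub>W\<close> and the values of the coarse maps \<open>\<rho>\<^sup>W\<^sub>V\<close> are nonempty, as for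
  \<open>\<pi>\<^sub>W\<close>.\<close>

definition hh_nesting :: "('a, 'i, 'c) hh_structure \<Rightarrow> real \<Rightarrow> bool" where
  "hh_nesting H \<xi> \<longleftrightarrow>
     reflp_on (Idx H) (nest H) \<and> antisymp_on (Idx H) (nest H) \<and> transp_on (Idx H) (nest H) \<and>
     (Idx H = {} \<or> (\<exists>!W. W \<in> Idx H \<and> (\<forall>V\<in>Idx H. nest H W V \<longrightarrow> V = W))) \<and>
     (\<forall>V\<in>Idx H. \<forall>W\<in>Idx H. pnest H V W \<longrightarrow>
        rho_set H V W \<noteq> {} \<and> rho_set H V W \<subseteq> mspace (CSpace H W) \<and>
        mdiam (CSpace H W) (rho_set H V W) \<le> ennreal \<xi> \<and>
        (\<forall>p\<in>mspace (CSpace H W).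
           rho_map H W V p \<noteq> {} \<and> rho_map H W V p \<subseteq> mspace (CSpace H V)))"

definition hh_orthogonality :: "('a, 'i, 'c) hh_structure \<Rightarrow> bool" where
  "hh_orthogonality H \<longleftrightarrow>
     symp_on (Idx H) (orth H) \<and> irreflp_on (Idx H) (orth H) \<and>
     (\<forall>V\<in>Idx H. \<forall>W\<in>Idx H. \<forall>U\<in>Idx H. nest H V W \<and> orth H W U \<longrightarrow> orth H V U) \<and>
     (\<forall>T\<in>Idx H. \<forall>U\<in>below H T. {V \<in> below H T. orth H V U} \<noteq> {} \<longrightarrow>
        (\<exists>W\<in>below H T - {T}. \<forall>V\<in>below H T. orth H V U \<longrightarrow> nest H V W)) \<and>
     (\<forall>V\<in>Idx H. \<forall>W\<in>Idx H. orth H V W \<longrightarrow> \<not> nest H V W \<and> \<not> nest H W V)"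

definition hh_consistency ::
  "'a metric \<Rightarrow> ('a, 'i, 'c) hh_structure \<Rightarrow> real \<Rightarrow> real \<Rightarrow> bool" where
  "hh_consistency X H \<xi> \<kappa>0 \<longleftrightarrow>
     (\<forall>V\<in>Idx H. \<forall>W\<in>Idx H. transv H V W \<longrightarrow>
        rho_set H V W \<noteq> {} \<and> rho_set H V W \<subseteq> mspace (CSpace H W) \<and>
        mdiam (CSpace H W) (rho_set H V W) \<le> ennreal \<xi> \<and>
        rho_set H W V \<noteq> {} \<and> rho_set H W V \<subseteq> mspace (CSpace H V) \<and>
        mdiam (CSpace H V) (rho_set H W V) \<le> ennreal \<xi> \<and>
        (\<forall>x\<in>mspace X.
           min (idx_dist_set H W x (rho_set H V W)) (idx_dist_set H V x (rho_set H W V))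
             \<le> ennreal \<kappa>0)) \<and>
     (\<forall>V\<in>Idx H. \<forall>W\<in>Idx H. pnest H V W \<longrightarrow>
        (\<forall>x\<in>mspace X.
           min (idx_dist_set H W x (rho_set H V W))
               (mdiam (CSpace H V) (proj H V x \<union> rho_image H W V (proj H W x)))
             \<le> ennreal \<kappa>0)) \<and>
     (\<forall>U\<in>Idx H. \<forall>V\<in>Idx H. \<forall>W\<in>Idx H.
        nest H U V \<and> (pnest H V W \<or> transv H V W \<and> \<not> orth H W U) \<longrightarrow>
        set_mdist (CSpace H W) (rho_set H U W) (rho_set H V W) \<le> ennreal \<kappa>0)"

definition hh_finite_complexity :: "('a, 'i, 'c) hh_structure \<Rightarrow> nat \<Rightarrow> bool" where
  "hh_finite_complexity H n \<longleftrightarrow>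
     (\<forall>A\<subseteq>Idx H. (\<forall>V\<in>A. \<forall>W\<in>A. nest H V W \<or> nest H W V) \<longrightarrow> finite A \<and> card A \<le> n)"

text \<open>The projections of points are nonempty, so \<open>d\<^sub>W(x, x')\<close> is finite and \<open>enn2real\<close> loses
  nothing.\<close>

definition hh_large_links ::
  "'a metric \<Rightarrow> ('a, 'i, 'c) hh_structure \<Rightarrow> real \<Rightarrow> real \<Rightarrow> bool" where
  "hh_large_links X H L E \<longleftrightarrow>
     (\<forall>W\<in>Idx H. \<forall>x\<in>mspace X. \<forall>x'\<in>mspace X.
        let N = L * enn2real (idx_dist H W x x') + L in
        \<exists>\<T>\<subseteq>below H W - {W}. finite \<T> \<and> int (card \<T>) \<le> \<lfloor>N\<rfloor> \<and>
          (\<forall>T\<in>below H W - {W}. (\<exists>T'\<in>\<T>. T \<in> below H T') \<or> idx_dist H T x x' < ennreal E) \<and>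
          (\<forall>T'\<in>\<T>. idx_dist_set H W x (rho_set H T' W) \<le> ennreal N))"

definition hh_bounded_geodesic_image :: "('a, 'i, 'c) hh_structure \<Rightarrow> real \<Rightarrow> bool" where
  "hh_bounded_geodesic_image H E \<longleftrightarrow>
     (\<forall>V\<in>Idx H. \<forall>W\<in>Idx H. pnest H V W \<longrightarrow>
        (\<forall>I \<gamma>. mgeodesic (CSpace H W) I \<gamma> \<longrightarrow>
           mdiam (CSpace H V) (rho_image H W V (\<gamma> ` I)) \<le> ennreal E \<or>
           \<gamma> ` I \<inter> mnbhd (CSpace H W) E (rho_set H V W) \<noteq> {}))"

text \<open>Pairwise orthogonal elements are distinct, so a family of them is a set \<open>\<V>\<close> of indices.
  The family is nonempty: for the empty family the condition would only say that the space is
  nonempty.\<close>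

definition hh_partial_realization ::
  "'a metric \<Rightarrow> ('a, 'i, 'c) hh_structure \<Rightarrow> real \<Rightarrow> bool" where
  "hh_partial_realization X H \<alpha> \<longleftrightarrow>
     (\<forall>\<V>\<subseteq>Idx H. \<forall>p. \<V> \<noteq> {} \<and> (\<forall>V\<in>\<V>. \<forall>W\<in>\<V>. V \<noteq> W \<longrightarrow> orth H V W) \<and>
        (\<forall>V\<in>\<V>. p V \<in> proj_image H V (mspace X)) \<longrightarrow>
        (\<exists>x\<in>mspace X.
           (\<forall>V\<in>\<V>. idx_dist_set H V x {p V} \<le> ennreal \<alpha>) \<and>
           (\<forall>V\<in>\<V>. \<forall>W\<in>Idx H. pnest H V W \<or> transv H W V \<longrightarrow>
              idx_dist_set H W x (rho_set H V W) \<le> ennreal \<alpha>)))"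

definition hh_uniqueness :: "'a metric \<Rightarrow> ('a, 'i, 'c) hh_structure \<Rightarrow> bool" where
  "hh_uniqueness X H \<longleftrightarrow>
     (\<forall>\<kappa>\<ge>0. \<exists>\<theta>::real. \<forall>x\<in>mspace X. \<forall>y\<in>mspace X.
        mdist X x y \<ge> \<theta> \<longrightarrow> (\<exists>V\<in>Idx H. idx_dist H V x y \<ge> ennreal \<kappa>))"

definition hierarchically_hyperbolic ::
  "'a metric \<Rightarrow> ('a, 'i, 'c) hh_structure \<Rightarrow> bool" where
  "hierarchically_hyperbolic X H \<longleftrightarrow>
     (\<exists>q\<ge>1. quasigeodesic_mspace q X) \<and>
     (\<exists>\<delta>\<ge>0. \<forall>W\<in>Idx H. hyperbolic_geodesic_mspace \<delta> (CSpace H W)) \<and>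
     (\<exists>\<xi>\<ge>0. \<exists>K\<ge>0. \<exists>\<kappa>0\<ge>0.
        hh_projections X H \<xi> K \<and> hh_nesting H \<xi> \<and> hh_orthogonality H \<and>
        hh_consistency X H \<xi> \<kappa>0 \<and>
        (\<exists>L\<ge>1. \<exists>E\<ge>max \<xi> \<kappa>0. hh_large_links X H L E)) \<and>
     (\<exists>n. hh_finite_complexity H n) \<and>
     (\<exists>E>0. hh_bounded_geodesic_image H E) \<and>
     (\<exists>\<alpha>\<ge>0. hh_partial_realization X H \<alpha>) \<and>
     hh_uniqueness X H"

definition hierarchically_quasiconvex ::
  "'a metric \<Rightarrow> ('a, 'i, 'c) hh_structure \<Rightarrow> (real \<Rightarrow> real) \<Rightarrow> 'a set \<Rightarrow> bool" where
  "hierarchically_quasiconvex X H k Y \<longleftrightarrow>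
     Y \<subseteq> mspace X \<and>
     (\<forall>U\<in>Idx H. mquasiconvex (CSpace H U) (k 0) (proj_image H U Y)) \<and>
     (\<forall>\<kappa>>0. \<forall>x\<in>mspace X.
        (\<forall>U\<in>Idx H. idx_dist_set H U x (proj_image H U Y) \<le> ennreal \<kappa>) \<longrightarrow>
        set_mdist X {x} Y \<le> ennreal (k \<kappa>))"

end

theory Submission
  imports Defs
begin

text \<open>The subspace \<open>Y\<close> keeps the index set, the hyperbolic spaces and the projections of \<open>X\<close>; only
  the \<open>\<rho>\<close> data are changed, by composing them with a coarse closest point projection to
  \<open>\<pi>\<^sub>W(Y)\<close>. If \<open>\<rho>\<^sup>V\<^sub>W\<close> is far from \<open>\<pi>\<^sub>W(Y)\<close>, then \<open>\<pi>\<^sub>V(Y)\<close> is bounded, which saves the bounded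
  geodesic image axiom. The two axioms that do not simply restrict to \<open>Y\<close> are that \<open>Y\<close> is
  quasigeodesic and partial realization. Both follow from a gate map \<open>X \<rightarrow> Y\<close>, obtained by
  realizing the consistent tuple of closest points of \<open>\<pi>\<^sub>W(x)\<close> in \<open>\<pi>\<^sub>W(Y)\<close> by a point of \<open>X\<close>, which
  hierarchical quasiconvexity places near \<open>Y\<close>. Gates of a quasigeodesic of \<open>X\<close> form a chain in \<open>Y\<close>
  of linearly bounded length, and a shortest such chain is a quasigeodesic.

  A consistent tuple \<open>b\<close> is realized by induction on the level of a domain \<open>V\<close>: if a partial
  realization point has the right coordinate in \<open>V\<close> but a wrong one in some domain properly nested in
  \<open>V\<close>, there is a wrong domain \<open>U\<close> that is last in the order from the point to \<open>b\<close>. Realizing \<open>b\<close>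
  below \<open>U\<close> corrects all domains that are not orthogonal to the new family; the pairwise orthogonal
  family so produced grows, and its size is bounded by the complexity.\<close>

section \<open>Set distances, diameters and geodesics\<close>

text \<open>The spaces \<open>CSpace H W\<close> stay whole because the projection axiom asks only
  for a quasiconvex image, which hierarchical quasiconvexity of \<open>Y\<close> provides. The
  \<rho> data must change because of partial realization: it demands a point of \<open>Y\<close>
  near \<rho> sets, and these may be arbitrarily far from the projections of \<open>Y\<close>. After
  the change a geodesic may pass near an old set and miss the new one; bounded geodesic image then
  has to hold through its other alternative, which is why the values of \<open>rho_map\<close> are
  moved into the projections of \<open>Y\<close> as well. No bound may depend on the tuple or on the
  domain, so the inductions of the realization argument put the existence of the bound in front of
  these quantifiers. Partial realization can prescribe only points in the projections of
  \<open>X\<close>, so tuples are required to consist of such points. The last wrong domain is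
  chosen because the tuple is then near its \<rho> set in the domains that contain it or are
  transverse to it, just as a point realized below it is.\<close>

lemma mdiam_le_iff:
  "0 \<le> r \<Longrightarrow> mdiam m A \<le> ennreal r \<longleftrightarrow> (\<forall>a\<in>A. \<forall>b\<in>A. mdist m a b \<le> r)"
  by (auto simp: mdiam_def SUP_le_iff)

lemma set_mdist_le_dist: "a \<in> A \<Longrightarrow> b \<in> B \<Longrightarrow> set_mdist m A B \<le> ennreal (mdist m a b)"
  unfolding set_mdist_def by (meson INF_lower2 order_refl)

lemma set_mdist_leI: "a \<in> A \<Longrightarrow> b \<in> B \<Longrightarrow> mdist m a b \<le> r \<Longrightarrow> set_mdist m A B \<le> ennreal r"
  by (meson set_mdist_le_dist ennreal_leI order_trans)

lemma set_mdist_lessE: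
  assumes "set_mdist m A B < ennreal r"
  obtains a b where "a \<in> A" "b \<in> B" "mdist m a b < r"
  using assms by (auto simp: set_mdist_def INF_less_iff ennreal_less_iff)

lemma set_mdist_leE:
  assumes "set_mdist m A B \<le> ennreal r" "r < s" "0 \<le> r"
  obtains a b where "a \<in> A" "b \<in> B" "mdist m a b < s"
proof -
  have "ennreal r < ennreal s"
    using assms by (simp add: ennreal_less_iff)
  then have "set_mdist m A B < ennreal s"
    using assms by (simp add: order.strict_trans1)
  then show thesis
    using that by (rule set_mdist_lessE)
qed

lemma set_mdist_ge_iff: "ennreal r \<le> set_mdist m A B \<longleftrightarrow> (\<forall>a\<in>A. \<forall>b\<in>B. r \<le> mdist m a b)"
  by (auto simp: set_mdist_def le_INF_iff)

lemma mem_mnbhdI: "x \<in> mspace m \<Longrightarrow> a \<in> A \<Longrightarrow> mdist m x a \<le> r \<Longrightarrow> x \<in> mnbhd m r A"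
  unfolding mnbhd_def using set_mdist_leI[of x "{x}"] by blast

lemma mem_mnbhdE:
  assumes "x \<in> mnbhd m r A" "0 \<le> r" "r < s"
  obtains a where "a \<in> A" "mdist m x a < s"
proof -
  from assms(1) have "set_mdist m {x} A \<le> ennreal r"
    by (simp add: mnbhd_def)
  from set_mdist_leE[OF this assms(3,2)] that show thesis
    by (metis singletonD)
qed

lemma mnbhd_mono: "r \<le> s \<Longrightarrow> mnbhd m r A \<subseteq> mnbhd m s A"
  by (auto simp: mnbhd_def intro: order_trans[OF _ ennreal_leI])

lemma hyperbolic_geodesic_mspace_mono:
  assumes "hyperbolic_geodesic_mspace \<delta> m" "\<delta> \<le> \<delta>'"
  shows "hyperbolic_geodesic_mspace \<delta>' m"
  unfolding hyperbolic_geodesic_mspace_def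
proof (intro conjI allI impI)
  show "geodesic_mspace m"
    using assms(1) by (simp add: hyperbolic_geodesic_mspace_def)
  fix x y z P Q R
  assume "mgeodesic_segment m x y P \<and> mgeodesic_segment m y z Q \<and> mgeodesic_segment m x z R"
  then have "P \<subseteq> mnbhd m \<delta> (Q \<union> R)"
    using assms(1) unfolding hyperbolic_geodesic_mspace_def by blast
  then show "P \<subseteq> mnbhd m \<delta>' (Q \<union> R)"
    using mnbhd_mono[OF assms(2), of m "Q \<union> R"] by order
qed

lemma mquasiconvex_mono: "mquasiconvex m K A \<Longrightarrow> K \<le> K' \<Longrightarrow> mquasiconvex m K' A"
  unfolding mquasiconvex_def using mnbhd_mono[of K K' m A] by (meson subset_trans)

lemma mgeodesic_segmentD:
  assumes "mgeodesic_segment m x y P"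
  shows "x \<in> P" "y \<in> P" "P \<subseteq> mspace m"
    and "p \<in> P \<Longrightarrow> mdist m x p + mdist m p y = mdist m x y"
    and "0 \<le> t \<Longrightarrow> t \<le> mdist m x y \<Longrightarrow> \<exists>p\<in>P. mdist m x p = t"
proof -
  obtain l \<gamma> where l: "0 \<le> l" and g: "mgeodesic m {0..l} \<gamma>" "\<gamma> 0 = x" "\<gamma> l = y" "P = \<gamma> ` {0..l}"
    using assms by (auto simp: mgeodesic_segment_def)
  show "x \<in> P" "y \<in> P" "P \<subseteq> mspace m"
    using g l by (auto simp: mgeodesic_def)
  have d: "mdist m (\<gamma> s) (\<gamma> t) = \<bar>s - t\<bar>" if "s \<in> {0..l}" "t \<in> {0..l}" for s t
    using g that by (auto simp: mgeodesic_def)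
  show "mdist m x p + mdist m p y = mdist m x y" if "p \<in> P"
    using that g l d[of 0] d[of _ l] d[of 0 l] by auto
  show "\<exists>p\<in>P. mdist m x p = t" if "0 \<le> t" "t \<le> mdist m x y"
    using that g l d[of 0 l] d[of 0 t] by (auto intro!: bexI[of _ t])
qed

text \<open>All constants of the axioms are merged into \<open>E\<close>, and distance bounds hold for all points of the
  bounded sets involved instead of for the infimum.\<close>

locale hhs =
  fixes X :: "'a metric" and H :: "('a, 'i, 'c) hh_structure" and E :: real and n :: nat
  assumes E_ge_1: "1 \<le> E"
    and hyp: "W \<in> Idx H \<Longrightarrow> hyperbolic_geodesic_mspace E (CSpace H W)"
    and proj_ne: "W \<in> Idx H \<Longrightarrow> x \<in> mspace X \<Longrightarrow> proj H W x \<noteq> {}"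
    and proj_sub: "W \<in> Idx H \<Longrightarrow> x \<in> mspace X \<Longrightarrow> proj H W x \<subseteq> mspace (CSpace H W)"
    and proj_diam: "W \<in> Idx H \<Longrightarrow> x \<in> mspace X \<Longrightarrow> p \<in> proj H W x \<Longrightarrow> q \<in> proj H W x \<Longrightarrow>
      mdist (CSpace H W) p q \<le> E"
    and proj_lip: "W \<in> Idx H \<Longrightarrow> x \<in> mspace X \<Longrightarrow> y \<in> mspace X \<Longrightarrow> p \<in> proj H W x \<Longrightarrow>
      q \<in> proj H W y \<Longrightarrow> mdist (CSpace H W) p q \<le> E * mdist X x y + E"
    and nest_refl: "reflp_on (Idx H) (nest H)"
    and nest_antisym: "antisymp_on (Idx H) (nest H)"
    and nest_trans: "transp_on (Idx H) (nest H)"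
    and nest_max: "Idx H = {} \<or> (\<exists>!W. W \<in> Idx H \<and> (\<forall>V\<in>Idx H. nest H W V \<longrightarrow> V = W))"
    and rho_ne: "V \<in> Idx H \<Longrightarrow> W \<in> Idx H \<Longrightarrow> pnest H V W \<or> transv H V W \<Longrightarrow> rho_set H V W \<noteq> {}"
    and rho_sub: "V \<in> Idx H \<Longrightarrow> W \<in> Idx H \<Longrightarrow> pnest H V W \<or> transv H V W \<Longrightarrow>
      rho_set H V W \<subseteq> mspace (CSpace H W)"
    and rho_diam: "V \<in> Idx H \<Longrightarrow> W \<in> Idx H \<Longrightarrow> pnest H V W \<or> transv H V W \<Longrightarrow>
      r \<in> rho_set H V W \<Longrightarrow> s \<in> rho_set H V W \<Longrightarrow> mdist (CSpace H W) r s \<le> E"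
    and rho_map_ne: "V \<in> Idx H \<Longrightarrow> W \<in> Idx H \<Longrightarrow> pnest H V W \<Longrightarrow> p \<in> mspace (CSpace H W) \<Longrightarrow>
      rho_map H W V p \<noteq> {}"
    and rho_map_sub: "V \<in> Idx H \<Longrightarrow> W \<in> Idx H \<Longrightarrow> pnest H V W \<Longrightarrow> p \<in> mspace (CSpace H W) \<Longrightarrow>
      rho_map H W V p \<subseteq> mspace (CSpace H V)"
    and orthogonality: "hh_orthogonality H"
    and consist_transv: "V \<in> Idx H \<Longrightarrow> W \<in> Idx H \<Longrightarrow> transv H V W \<Longrightarrow> x \<in> mspace X \<Longrightarrow>
      p \<in> proj H W x \<Longrightarrow> q \<in> proj H V x \<Longrightarrow> r \<in> rho_set H V W \<Longrightarrow> s \<in> rho_set H W V \<Longrightarrow>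
      mdist (CSpace H W) p r \<le> E \<or> mdist (CSpace H V) q s \<le> E"
    and consist_nest: "V \<in> Idx H \<Longrightarrow> W \<in> Idx H \<Longrightarrow> pnest H V W \<Longrightarrow> x \<in> mspace X \<Longrightarrow>
      p \<in> proj H W x \<Longrightarrow> p' \<in> proj H W x \<Longrightarrow> q \<in> proj H V x \<Longrightarrow> r \<in> rho_set H V W \<Longrightarrow>
      s \<in> rho_map H W V p' \<Longrightarrow> t \<in> rho_map H W V p \<Longrightarrow>
      mdist (CSpace H W) p r \<le> E \<or> mdist (CSpace H V) q s \<le> E \<and> mdist (CSpace H V) s t \<le> E"
    and consist_rho: "U \<in> Idx H \<Longrightarrow> V \<in> Idx H \<Longrightarrow> W \<in> Idx H \<Longrightarrow> nest H U V \<Longrightarrow>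
      pnest H V W \<or> transv H V W \<and> \<not> orth H W U \<Longrightarrow> r \<in> rho_set H U W \<Longrightarrow> s \<in> rho_set H V W \<Longrightarrow>
      mdist (CSpace H W) r s \<le> E"
    and finite_complexity: "hh_finite_complexity H n"
    and large_links: "W \<in> Idx H \<Longrightarrow> x \<in> mspace X \<Longrightarrow> x' \<in> mspace X \<Longrightarrow> p \<in> proj H W x \<Longrightarrow>
      p' \<in> proj H W x' \<Longrightarrow>
      \<exists>\<T>\<subseteq>below H W - {W}. finite \<T> \<and> real (card \<T>) \<le> E * mdist (CSpace H W) p p' + E \<and>
        (\<forall>T\<in>below H W - {W}. (\<exists>T'\<in>\<T>. T \<in> below H T') \<or>
          (\<forall>q\<in>proj H T x. \<forall>q'\<in>proj H T x'. mdist (CSpace H T) q q' \<le> E)) \<and>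
        (\<forall>T'\<in>\<T>. \<forall>r\<in>rho_set H T' W. mdist (CSpace H W) p r \<le> E * mdist (CSpace H W) p p' + E)"
    and bounded_image: "V \<in> Idx H \<Longrightarrow> W \<in> Idx H \<Longrightarrow> pnest H V W \<Longrightarrow> mgeodesic (CSpace H W) I \<gamma> \<Longrightarrow>
      (\<forall>u\<in>rho_image H W V (\<gamma> ` I). \<forall>v\<in>rho_image H W V (\<gamma> ` I). mdist (CSpace H V) u v \<le> E) \<or>
      (\<exists>t\<in>I. \<exists>r\<in>rho_set H V W. mdist (CSpace H W) (\<gamma> t) r \<le> E)"
    and partial_realization: "\<V> \<subseteq> Idx H \<Longrightarrow> \<V> \<noteq> {} \<Longrightarrow>
      (\<And>V W. V \<in> \<V> \<Longrightarrow> W \<in> \<V> \<Longrightarrow> V \<noteq> W \<Longrightarrow> orth H V W) \<Longrightarrow>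
      (\<And>V. V \<in> \<V> \<Longrightarrow> b V \<in> proj_image H V (mspace X)) \<Longrightarrow>
      \<exists>x\<in>mspace X. (\<forall>V\<in>\<V>. \<forall>p\<in>proj H V x. mdist (CSpace H V) p (b V) \<le> E) \<and>
        (\<forall>V\<in>\<V>. \<forall>W\<in>Idx H. pnest H V W \<or> transv H W V \<longrightarrow>
          (\<forall>p\<in>proj H W x. \<forall>r\<in>rho_set H V W. mdist (CSpace H W) p r \<le> E))"
begin

abbreviation "C W \<equiv> mspace (CSpace H W)"
abbreviation "D W \<equiv> mdist (CSpace H W)"

lemma nest_self: "W \<in> Idx H \<Longrightarrow> nest H W W"
  using nest_refl by (rule reflp_onD)

lemma nestT: "U \<in> Idx H \<Longrightarrow> V \<in> Idx H \<Longrightarrow> W \<in> Idx H \<Longrightarrow> nest H U V \<Longrightarrow> nest H V W \<Longrightarrow> nest H U W"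
  using nest_trans by (rule transp_onD)

lemma nestA: "U \<in> Idx H \<Longrightarrow> V \<in> Idx H \<Longrightarrow> nest H U V \<Longrightarrow> nest H V U \<Longrightarrow> U = V"
  using nest_antisym by (rule antisymp_onD)

end

section \<open>Consistent tuples and partial realization points\<close>

text \<open>Applied both to chains under nesting and to chains in the passing order of
  domains.\<close>

lemma finite_total_has_last:
  assumes "finite A" "A \<noteq> {}"
    and "\<And>U W. U \<in> A \<Longrightarrow> W \<in> A \<Longrightarrow> U \<noteq> W \<Longrightarrow> R U W \<or> R W U"
    and "\<And>U V W. U \<in> A \<Longrightarrow> V \<in> A \<Longrightarrow> W \<in> A \<Longrightarrow> R U V \<Longrightarrow> R V W \<Longrightarrow> R U W"
  shows "\<exists>L\<in>A. \<forall>U\<in>A. U \<noteq> L \<longrightarrow> R U L"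
  using assms
proof (induction A rule: finite_ne_induct)
  case (singleton U)
  show ?case by simp
next
  case (insert U A)
  have "\<exists>L\<in>A. \<forall>W\<in>A. W \<noteq> L \<longrightarrow> R W L"
  proof (rule insert.IH)
    show "R V W \<or> R W V" if "V \<in> A" "W \<in> A" "V \<noteq> W" for V W
      using insert.prems(1)[of V W] that by simp
    show "R U' W" if "U' \<in> A" "V \<in> A" "W \<in> A" "R U' V" "R V W" for U' V W
      using insert.prems(2)[OF _ _ _ that(4,5)] that(1-3) by simp
  qed
  then obtain L where L: "L \<in> A" "\<forall>W\<in>A. W \<noteq> L \<longrightarrow> R W L"
    by blast
  have "U \<noteq> L" using insert.hyps L by blast
  then have "R U L \<or> R L U"
    using insert.prems(1)[of U L] L(1) by simp
  then show ?case
  proof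
    assume "R U L"
    then show ?thesis using L by blast
  next
    assume LU: "R L U"
    have "R W U" if "W \<in> A" for W
      using insert.prems(2)[of W L U] L that LU by (cases "W = L") auto
    then show ?thesis by blast
  qed
qed

lemma exists_max_card:
  assumes "P A0" "\<And>A. P A \<Longrightarrow> card A \<le> M"
  obtains A where "P A" "\<And>B. P B \<Longrightarrow> card B \<le> card A"
proof -
  have "\<exists>A. P A \<and> (\<forall>B. P B \<longrightarrow> card B \<le> card A)"
    by (rule ex_has_greatest_nat[of P A0 card "Suc M"]) (use assms in \<open>simp_all add: less_Suc_eq_le\<close>)
  then show thesis using that by auto
qed

context hhs
begin

lemma orth_sym: "V \<in> Idx H \<Longrightarrow> W \<in> Idx H \<Longrightarrow> orth H V W \<Longrightarrow> orth H W V"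
  using orthogonality unfolding hh_orthogonality_def symp_on_def by blast

lemma orth_irrefl: "V \<in> Idx H \<Longrightarrow> \<not> orth H V V"
  using orthogonality unfolding hh_orthogonality_def irreflp_on_def by blast

lemma orth_nest:
  "V \<in> Idx H \<Longrightarrow> W \<in> Idx H \<Longrightarrow> U \<in> Idx H \<Longrightarrow> nest H V W \<Longrightarrow> orth H W U \<Longrightarrow> orth H V U"
  using orthogonality unfolding hh_orthogonality_def by blast

lemma orth_incomparable: "V \<in> Idx H \<Longrightarrow> W \<in> Idx H \<Longrightarrow> orth H V W \<Longrightarrow> \<not> nest H V W \<and> \<not> nest H W V"
  using orthogonality unfolding hh_orthogonality_def by blast

lemma orth_container:
  assumes "T \<in> Idx H" "U \<in> below H T" "V \<in> below H T" "orth H V U"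
  shows "\<exists>W\<in>below H T - {T}. \<forall>V\<in>below H T. orth H V U \<longrightarrow> nest H V W"
proof -
  have "{V \<in> below H T. orth H V U} \<noteq> {}"
    using assms by blast
  then show ?thesis
    using orthogonality assms(1,2) unfolding hh_orthogonality_def by blast
qed

lemma transv_sym: "V \<in> Idx H \<Longrightarrow> W \<in> Idx H \<Longrightarrow> transv H V W \<Longrightarrow> transv H W V"
  using orth_sym unfolding transv_def by blast

lemma D_chain:
  assumes "D W p q \<le> r" "D W q t \<le> s" "p \<in> C W" "q \<in> C W" "t \<in> C W"
  shows "D W p t \<le> r + s"
  using mdist_triangle[of p "CSpace H W" q t] assms by linarith

lemma geodesic_exists:
  assumes "W \<in> Idx H" "p \<in> C W" "q \<in> C W"
  obtains P where "mgeodesic_segment (CSpace H W) p q P"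
  using hyp[OF assms(1)] assms(2,3)
  unfolding hyperbolic_geodesic_mspace_def geodesic_mspace_def by blast

text \<open>The form in which bounded geodesic image is used: \<open>rho_map\<close> is compared at
  the two end points only, and otherwise a point of a geodesic near the \<rho> set is at hand for
  distance estimates.\<close>

lemma bounded_image_segment:
  assumes "V \<in> Idx H" "W \<in> Idx H" "pnest H V W" "p \<in> C W" "q \<in> C W"
  shows "(\<forall>u\<in>rho_map H W V p. \<forall>v\<in>rho_map H W V q. D V u v \<le> E) \<or>
    (\<exists>P m r. mgeodesic_segment (CSpace H W) p q P \<and> m \<in> P \<and> r \<in> rho_set H V W \<and> D W m r \<le> E)"
proof -
  obtain P where P: "mgeodesic_segment (CSpace H W) p q P"
    using geodesic_exists assms by blast
  then obtain l \<gamma> where l: "0 \<le> l" and g: "mgeodesic (CSpace H W) {0..l} \<gamma>"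
      and e: "\<gamma> 0 = p" "\<gamma> l = q" "P = \<gamma> ` {0..l}"
    unfolding mgeodesic_segment_def by blast
  from bounded_image[OF assms(1-3) g] show ?thesis
  proof
    assume *: "\<forall>u\<in>rho_image H W V (\<gamma> ` {0..l}). \<forall>v\<in>rho_image H W V (\<gamma> ` {0..l}). D V u v \<le> E"
    have "rho_map H W V p \<subseteq> rho_image H W V (\<gamma> ` {0..l})"
      "rho_map H W V q \<subseteq> rho_image H W V (\<gamma> ` {0..l})"
      using l e by (auto simp: rho_image_def)
    with * show ?thesis by blast
  next
    assume "\<exists>t\<in>{0..l}. \<exists>r\<in>rho_set H V W. D W (\<gamma> t) r \<le> E"
    with P e show ?thesis by blast
  qed
qed

definition pt :: "'a \<Rightarrow> 'i \<Rightarrow> 'c" where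
  "pt x W = (SOME p. p \<in> proj H W x)"

lemma pt_in: "W \<in> Idx H \<Longrightarrow> x \<in> mspace X \<Longrightarrow> pt x W \<in> proj H W x"
  unfolding pt_def using proj_ne by (simp add: some_in_eq)

lemma pt_C: "W \<in> Idx H \<Longrightarrow> x \<in> mspace X \<Longrightarrow> pt x W \<in> C W"
  using pt_in proj_sub by blast

lemma pt_image: "W \<in> Idx H \<Longrightarrow> x \<in> mspace X \<Longrightarrow> pt x W \<in> proj_image H W (mspace X)"
  using pt_in unfolding proj_image_def by blast

definition consistent :: "real \<Rightarrow> ('i \<Rightarrow> 'c) \<Rightarrow> bool" where
  "consistent \<kappa> c \<longleftrightarrow> (\<forall>W\<in>Idx H. c W \<in> C W) \<and>
     (\<forall>V\<in>Idx H. \<forall>W\<in>Idx H. transv H V W \<longrightarrow> (\<forall>r\<in>rho_set H V W. \<forall>s\<in>rho_set H W V.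
        D W (c W) r \<le> \<kappa> \<or> D V (c V) s \<le> \<kappa>)) \<and>
     (\<forall>V\<in>Idx H. \<forall>W\<in>Idx H. pnest H V W \<longrightarrow> (\<forall>r\<in>rho_set H V W. \<forall>s\<in>rho_map H W V (c W).
        D W (c W) r \<le> \<kappa> \<or> D V (c V) s \<le> \<kappa>))"

lemma consistentC: "consistent \<kappa> c \<Longrightarrow> W \<in> Idx H \<Longrightarrow> c W \<in> C W"
  unfolding consistent_def by blast

lemma consistent_transv:
  "consistent \<kappa> c \<Longrightarrow> V \<in> Idx H \<Longrightarrow> W \<in> Idx H \<Longrightarrow> transv H V W \<Longrightarrow> r \<in> rho_set H V W \<Longrightarrow>
   s \<in> rho_set H W V \<Longrightarrow> D W (c W) r \<le> \<kappa> \<or> D V (c V) s \<le> \<kappa>"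
  unfolding consistent_def by blast

lemma consistent_pnest:
  "consistent \<kappa> c \<Longrightarrow> V \<in> Idx H \<Longrightarrow> W \<in> Idx H \<Longrightarrow> pnest H V W \<Longrightarrow> r \<in> rho_set H V W \<Longrightarrow>
   s \<in> rho_map H W V (c W) \<Longrightarrow> D W (c W) r \<le> \<kappa> \<or> D V (c V) s \<le> \<kappa>"
  unfolding consistent_def by blast

lemma consistent_mono:
  assumes "consistent \<kappa> c" "\<kappa> \<le> \<kappa>'"
  shows "consistent \<kappa>' c"
  unfolding consistent_def
  using consistentC[OF assms(1)] consistent_transv[OF assms(1)] consistent_pnest[OF assms(1)] assms(2)
  by (meson order_trans)

lemma consistent_pt:
  assumes x: "x \<in> mspace X"
  shows "consistent E (pt x)"
  unfolding consistent_def
proof (intro conjI ballI impI)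
  show "pt x W \<in> C W" if "W \<in> Idx H" for W
    using pt_C[OF that x] .
  show "D W (pt x W) r \<le> E \<or> D V (pt x V) s \<le> E"
    if "V \<in> Idx H" "W \<in> Idx H" "transv H V W" "r \<in> rho_set H V W" "s \<in> rho_set H W V" for V W r s
    using consist_transv[OF that(1-3) x pt_in[OF that(2) x] pt_in[OF that(1) x] that(4,5)] .
  show "D W (pt x W) r \<le> E \<or> D V (pt x V) s \<le> E"
    if "V \<in> Idx H" "W \<in> Idx H" "pnest H V W" "r \<in> rho_set H V W" "s \<in> rho_map H W V (pt x W)"
    for V W r s
    using consist_nest[OF that(1-3) x pt_in[OF that(2) x] pt_in[OF that(2) x] pt_in[OF that(1) x]
        that(4,5,5)] by blast
qed

definition realizes :: "('i \<Rightarrow> 'c) \<Rightarrow> 'i set \<Rightarrow> 'a \<Rightarrow> bool" where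
  "realizes c \<V> z \<longleftrightarrow> z \<in> mspace X \<and> (\<forall>V\<in>\<V>. D V (pt z V) (c V) \<le> E) \<and>
     (\<forall>V\<in>\<V>. \<forall>W\<in>Idx H. pnest H V W \<or> transv H V W \<longrightarrow>
        (\<forall>r\<in>rho_set H V W. D W (pt z W) r \<le> E))"

lemma realizes_rho:
  "realizes c \<V> z \<Longrightarrow> V \<in> \<V> \<Longrightarrow> W \<in> Idx H \<Longrightarrow> pnest H V W \<or> transv H V W \<Longrightarrow> r \<in> rho_set H V W \<Longrightarrow>
   D W (pt z W) r \<le> E"
  unfolding realizes_def by blast

lemma realizes_coord: "realizes c \<V> z \<Longrightarrow> V \<in> \<V> \<Longrightarrow> D V (pt z V) (c V) \<le> E"
  unfolding realizes_def by blast

lemma realizes_point: "realizes c \<V> z \<Longrightarrow> z \<in> mspace X"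
  unfolding realizes_def by blast

definition orthogonal_family :: "'i set \<Rightarrow> bool" where
  "orthogonal_family \<V> \<longleftrightarrow> \<V> \<subseteq> Idx H \<and> (\<forall>V\<in>\<V>. \<forall>W\<in>\<V>. V \<noteq> W \<longrightarrow> orth H V W)"

lemma realizes_exists:
  assumes "orthogonal_family \<V>" "\<V> \<noteq> {}" "\<And>V. V \<in> \<V> \<Longrightarrow> c V \<in> proj_image H V (mspace X)"
  obtains z where "realizes c \<V> z"
proof -
  have sub: "\<V> \<subseteq> Idx H" and o: "\<And>V W. V \<in> \<V> \<Longrightarrow> W \<in> \<V> \<Longrightarrow> V \<noteq> W \<Longrightarrow> orth H V W"
    using assms(1) unfolding orthogonal_family_def by auto
  from partial_realization[OF sub assms(2) o assms(3)]
  obtain z where z: "z \<in> mspace X" "\<forall>V\<in>\<V>. \<forall>p\<in>proj H V z. D V p (c V) \<le> E"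
     "\<forall>V\<in>\<V>. \<forall>W\<in>Idx H. pnest H V W \<or> transv H W V \<longrightarrow>
        (\<forall>p\<in>proj H W z. \<forall>r\<in>rho_set H V W. D W p r \<le> E)"
    by blast
  have "realizes c \<V> z"
    unfolding realizes_def
  proof (intro conjI ballI impI)
    show "z \<in> mspace X" by (rule z(1))
    show "D V (pt z V) (c V) \<le> E" if "V \<in> \<V>" for V
      using that z(1,2) pt_in sub by blast
    show "D W (pt z W) r \<le> E"
      if "V \<in> \<V>" "W \<in> Idx H" "pnest H V W \<or> transv H V W" "r \<in> rho_set H V W" for V W r
    proof -
      have "pnest H V W \<or> transv H W V"
        using that transv_sym sub by blast
      then show ?thesis
        using that z(3) pt_in[OF that(2) z(1)] by blast
    qed
  qed
  then show thesis by (rule that)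
qed

text \<open>Suppose \<open>b W\<close> is further from \<open>r\<close> than claimed. Then
  \<open>a W\<close> and \<open>b W\<close> are both further than \<kappa> from \<open>r\<close>, so
  consistency puts \<open>a V\<close> and \<open>b V\<close> within \<kappa> of the values of
  \<open>rho_map\<close> there. What remains of their distance exceeds \<open>E\<close>, so a
  geodesic from \<open>a W\<close> to \<open>b W\<close> comes near the \<rho> set, and no point of
  it is further from \<open>b W\<close> than \<open>a W\<close> is.\<close>

lemma rho_close_if_coords_far:
  assumes a: "consistent \<kappa> a" and b: "consistent \<kappa> b" and "E \<le> \<kappa>"
    and V: "V \<in> Idx H" and W: "W \<in> Idx H" and VW: "pnest H V W"
    and far: "2 * \<kappa> + E < D V (a V) (b V)" and r: "r \<in> rho_set H V W"
  shows "D W (b W) r \<le> D W (a W) (b W) + 2 * \<kappa>"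
proof (rule ccontr)
  assume contra: "\<not> ?thesis"
  have C: "a W \<in> C W" "b W \<in> C W" "r \<in> C W" "a V \<in> C V" "b V \<in> C V"
    using a b V W consistentC rho_sub[OF V W] VW r by blast+
  have E0: "0 \<le> E" using E_ge_1 by simp
  have nb: "\<not> D W (b W) r \<le> \<kappa>"
    using contra E0 \<open>E \<le> \<kappa>\<close> mdist_nonneg[of "CSpace H W" "a W" "b W"] by linarith
  have na: "\<not> D W (a W) r \<le> \<kappa>"
    using contra E0 \<open>E \<le> \<kappa>\<close> mdist_triangle[OF C(2,1,3)] mdist_commute[of "CSpace H W" "a W" "b W"]
    by linarith
  obtain s t where s: "s \<in> rho_map H W V (a W)" and t: "t \<in> rho_map H W V (b W)"
    using rho_map_ne[OF V W VW C(1)] rho_map_ne[OF V W VW C(2)] by blast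
  have sC: "s \<in> C V" "t \<in> C V"
    using rho_map_sub[OF V W VW C(1)] rho_map_sub[OF V W VW C(2)] s t by auto
  have "D V (a V) s \<le> \<kappa>" "D V (b V) t \<le> \<kappa>"
    using consistent_pnest[OF a V W VW r s] consistent_pnest[OF b V W VW r t] na nb by auto
  then have st: "\<not> D V s t \<le> E"
    using far mdist_triangle[OF C(4) sC(1) C(5)] mdist_triangle[OF sC C(5)]
      mdist_commute[of "CSpace H V" "b V" t] by linarith
  with s t bounded_image_segment[OF V W VW C(1,2)] obtain P m r' where
    P: "mgeodesic_segment (CSpace H W) (a W) (b W) P" "m \<in> P" "r' \<in> rho_set H V W" "D W m r' \<le> E"
    by blast
  have mC: "m \<in> C W" "r' \<in> C W"
    using mgeodesic_segmentD(3)[OF P(1)] P(2,3) rho_sub[OF V W] VW by auto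
  have "D W r' r \<le> E"
    using rho_diam[OF V W _ P(3) r] VW by blast
  moreover have "D W m (b W) \<le> D W (a W) (b W)"
    using mgeodesic_segmentD(4)[OF P(1,2)] mdist_nonneg[of "CSpace H W" "a W" m] by linarith
  ultimately have "D W (b W) r \<le> D W (a W) (b W) + E + E"
    using mdist_triangle[OF C(2) mC(1) C(3)] mdist_triangle[OF mC C(3)] P(4)
      mdist_commute[of "CSpace H W" "b W" m] by linarith
  with contra \<open>E \<le> \<kappa>\<close> show False by linarith
qed

text \<open>Otherwise consistency of both tuples puts \<open>a V\<close> and \<open>b V\<close>
  within \<kappa> of the same point of \<open>rho_set H W V\<close>.\<close>

lemma rho_close_if_coords_far_transv:
  assumes a: "consistent \<kappa> a" and b: "consistent \<kappa> b"
    and V: "V \<in> Idx H" and W: "W \<in> Idx H" and VW: "transv H V W"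
    and far: "2 * \<kappa> < D V (a V) (b V)" and r: "r \<in> rho_set H V W"
  shows "D W (a W) r \<le> \<kappa> \<or> D W (b W) r \<le> \<kappa>"
proof (rule ccontr)
  assume contra: "\<not> ?thesis"
  have WV: "transv H W V" using VW transv_sym V W by blast
  obtain s where s: "s \<in> rho_set H W V"
    using rho_ne[OF W V] WV by blast
  have C: "a V \<in> C V" "b V \<in> C V" "s \<in> C V"
    using a b V consistentC rho_sub[OF W V] WV s by blast+
  have "D V (a V) s \<le> \<kappa>" "D V (b V) s \<le> \<kappa>"
    using consistent_transv[OF a V W VW r s] consistent_transv[OF b V W VW r s] contra by auto
  then show False
    using far mdist_triangle[OF C(1,3,2)] mdist_commute[of "CSpace H V" "b V" s] by linarith
qed

section \<open>Levels of domains, maximal domains and sizes of orthogonal families\<close>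

definition chain_bounded :: "nat \<Rightarrow> 'i \<Rightarrow> bool" where
  "chain_bounded j V \<longleftrightarrow>
     (\<forall>A\<subseteq>below H V. (\<forall>U\<in>A. \<forall>W\<in>A. nest H U W \<or> nest H W U) \<longrightarrow> finite A \<and> card A \<le> j)"

lemma chain_boundedD:
  "chain_bounded j V \<Longrightarrow> A \<subseteq> below H V \<Longrightarrow> \<forall>U\<in>A. \<forall>W\<in>A. nest H U W \<or> nest H W U \<Longrightarrow>
   finite A \<and> card A \<le> j"
  unfolding chain_bounded_def by simp

lemma complexityD:
  "A \<subseteq> Idx H \<Longrightarrow> \<forall>U\<in>A. \<forall>W\<in>A. nest H U W \<or> nest H W U \<Longrightarrow> finite A \<and> card A \<le> n"
  using finite_complexity unfolding hh_finite_complexity_def by simp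

lemma chain_bounded_complexity: "chain_bounded n V"
  unfolding chain_bounded_def
proof (intro allI impI)
  fix A assume "A \<subseteq> below H V" "\<forall>U\<in>A. \<forall>W\<in>A. nest H U W \<or> nest H W U"
  moreover from this have "A \<subseteq> Idx H" unfolding below_def by blast
  ultimately show "finite A \<and> card A \<le> n"
    by (simp add: complexityD)
qed

text \<open>The domain \<open>V\<close> alone is a chain, so no domain has level 0 and the bases of
  the inductions on the level are vacuous.\<close>

lemma not_chain_bounded_0: "V \<in> Idx H \<Longrightarrow> \<not> chain_bounded 0 V"
  unfolding chain_bounded_def below_def
  using nest_self by (auto intro!: exI[of _ "{V}"])

lemma chain_bounded_pnest:
  assumes "chain_bounded (Suc j) V" "U \<in> Idx H" "V \<in> Idx H" "pnest H U V"
  shows "chain_bounded j U"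
  unfolding chain_bounded_def
proof (intro allI impI)
  fix A assume A: "A \<subseteq> below H U" "\<forall>W\<in>A. \<forall>W'\<in>A. nest H W W' \<or> nest H W' W"
  have sub: "W \<in> Idx H \<and> nest H W U \<and> nest H W V" if "W \<in> A" for W
    using A(1) that assms nestT[of W U V] unfolding below_def pnest_def by blast
  have "insert V A \<subseteq> below H V"
    using sub assms(3) nest_self unfolding below_def by blast
  moreover have "\<forall>W\<in>insert V A. \<forall>W'\<in>insert V A. nest H W W' \<or> nest H W' W"
    using sub A(2) nest_self[OF assms(3)] by blast
  ultimately have *: "finite (insert V A) \<and> card (insert V A) \<le> Suc j"
    by (rule chain_boundedD[OF assms(1)])
  have "V \<notin> A"
    using sub[of V] assms nestA[of U V] unfolding pnest_def by blast
  with * show "finite A \<and> card A \<le> j" by auto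
qed

text \<open>Finite complexity gives a longest chain of domains with \<open>Q\<close> above
  \<open>W\<close>; a domain with \<open>Q\<close> properly containing its top would lengthen
  it.\<close>

lemma exists_nest_maximal:
  assumes WI: "W \<in> Idx H" and QW: "Q W"
  obtains U where "U \<in> Idx H" "Q U" "nest H W U" "\<And>U'. U' \<in> Idx H \<Longrightarrow> Q U' \<Longrightarrow> \<not> pnest H U U'"
proof -
  define P where "P = (\<lambda>A. W \<in> A \<and> (\<forall>U\<in>A. U \<in> Idx H \<and> Q U \<and> nest H W U) \<and>
    (\<forall>U\<in>A. \<forall>U'\<in>A. nest H U U' \<or> nest H U' U))"
  have sub: "A \<subseteq> Idx H" if "P A" for A
    using that unfolding P_def by blast
  have bound: "finite A \<and> card A \<le> n" if "P A" for A
    by (rule complexityD[OF sub[OF that]]) (use that in \<open>simp add: P_def\<close>)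
  have "P {W}" using WI QW nest_self unfolding P_def by blast
  then obtain A where A: "P A" "\<And>B. P B \<Longrightarrow> card B \<le> card A"
    using exists_max_card[of P "{W}" n] bound by metis
  have "\<exists>L\<in>A. \<forall>U\<in>A. U \<noteq> L \<longrightarrow> nest H U L"
  proof (rule finite_total_has_last)
    show "finite A" "A \<noteq> {}" using bound A(1) unfolding P_def by auto
    show "nest H U U' \<or> nest H U' U" if "U \<in> A" "U' \<in> A" for U U'
      using A(1) that unfolding P_def by blast
    show "nest H U1 U3" if "U1 \<in> A" "U2 \<in> A" "U3 \<in> A" "nest H U1 U2" "nest H U2 U3" for U1 U2 U3
      using nestT that sub[OF A(1)] by blast
  qed
  then obtain L where L: "L \<in> A" "\<And>U. U \<in> A \<Longrightarrow> U \<noteq> L \<Longrightarrow> nest H U L" by blast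
  have LI: "L \<in> Idx H" and WL: "nest H W L" and QL: "Q L" using A(1) L(1) unfolding P_def by auto
  have "\<not> pnest H L U" if UI: "U \<in> Idx H" and QU: "Q U" for U
  proof
    assume LU: "pnest H L U"
    have top: "nest H U' U" if "U' \<in> A" for U'
      using nestT[of U' L U] L LU LI UI that sub[OF A(1)] unfolding pnest_def by blast
    have WU: "nest H W U" using top A(1) unfolding P_def by blast
    have "P (insert U A)"
      using A(1) UI QU WU top nest_self[OF UI] unfolding P_def by blast
    moreover have "U \<notin> A"
      using L(2)[of U] LU LI UI nestA unfolding pnest_def by blast
    ultimately show False
      using A(2)[of "insert U A"] bound[OF A(1)] by simp
  qed
  then show thesis using that LI QL WL by blast
qed

text \<open>The axiom provides a unique maximal element, not a largest one. Every domain lies below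
  some maximal element by finite complexity, and uniqueness makes these coincide.\<close>

lemma exists_top:
  assumes "Idx H \<noteq> {}"
  obtains S where "S \<in> Idx H" "\<And>W. W \<in> Idx H \<Longrightarrow> nest H W S"
proof -
  obtain S where S: "S \<in> Idx H"
      "\<And>W. W \<in> Idx H \<Longrightarrow> \<forall>V\<in>Idx H. nest H W V \<longrightarrow> V = W \<Longrightarrow> W = S"
  proof -
    have "\<exists>!W. W \<in> Idx H \<and> (\<forall>V\<in>Idx H. nest H W V \<longrightarrow> V = W)"
      using nest_max assms by (elim disjE) simp_all
    then obtain S where "S \<in> Idx H"
        "\<forall>W. W \<in> Idx H \<and> (\<forall>V\<in>Idx H. nest H W V \<longrightarrow> V = W) \<longrightarrow> W = S"
      unfolding Ex1_def by (elim exE conjE)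
    then show thesis using that by metis
  qed
  have "nest H W S" if W: "W \<in> Idx H" for W
  proof -
    obtain U where U: "U \<in> Idx H" "nest H W U" "\<And>U'. U' \<in> Idx H \<Longrightarrow> \<not> pnest H U U'"
      by (rule exists_nest_maximal[OF W, of "\<lambda>_. True"]) auto
    then have "\<forall>V\<in>Idx H. nest H U V \<longrightarrow> V = U" unfolding pnest_def by auto
    then have "U = S" by (rule S(2)[OF U(1)])
    then show ?thesis using U(2) by simp
  qed
  then show thesis using that S(1) by blast
qed

text \<open>Every member other than a chosen \<open>U\<close> is orthogonal to \<open>U\<close> and
  so lies below a container properly nested in \<open>T\<close>: removing one member lowers the
  level by one.\<close>

lemma finite_orthogonal_family_card:
  assumes "finite \<V>" "orthogonal_family \<V>" "\<V> \<subseteq> below H T" "T \<in> Idx H" "chain_bounded j T"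
  shows "card \<V> \<le> j"
  using assms
proof (induction j arbitrary: \<V> T)
  case 0
  then show ?case using not_chain_bounded_0 by blast
next
  case (Suc j)
  show ?case
  proof (cases "\<exists>U\<in>\<V>. \<exists>V\<in>\<V>. V \<noteq> U")
    case False
    then have "card \<V> \<le> 1"
      using Suc.prems(1) by (simp add: card_le_Suc0_iff_eq)
    then show ?thesis by simp
  next
    case True
    then obtain U V where UV: "U \<in> \<V>" "V \<in> \<V>" "V \<noteq> U" by blast
    have o: "orth H V' U" if "V' \<in> \<V>" "V' \<noteq> U" for V'
      using that UV(1) Suc.prems(2) unfolding orthogonal_family_def by blast
    obtain W where W: "W \<in> below H T - {T}" "\<And>V'. V' \<in> below H T \<Longrightarrow> orth H V' U \<Longrightarrow> nest H V' W"
      using orth_container[of T U V] o UV Suc.prems(3,4) by blast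
    have WI: "W \<in> Idx H" "pnest H W T" using W(1) unfolding below_def pnest_def by auto
    have "\<V> - {U} \<subseteq> below H W"
      using W(2) o Suc.prems(3) unfolding below_def by blast
    moreover have "orthogonal_family (\<V> - {U})"
      using Suc.prems(2) unfolding orthogonal_family_def by blast
    ultimately have "card (\<V> - {U}) \<le> j"
      using Suc.IH[of "\<V> - {U}" W] Suc.prems(1) WI chain_bounded_pnest[OF Suc.prems(5) WI(1) Suc.prems(4) WI(2)]
      by simp
    then show ?thesis using UV(1) Suc.prems(1) by (simp add: card_Diff_singleton_if)
  qed
qed

lemma orthogonal_family_card:
  assumes "orthogonal_family \<V>" "\<V> \<subseteq> below H T" "T \<in> Idx H"
  shows "finite \<V>" "card \<V> \<le> n"
proof -
  show fin: "finite \<V>"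
  proof (rule ccontr)
    assume "infinite \<V>"
    then obtain B where B: "finite B" "card B = Suc n" "B \<subseteq> \<V>"
      using infinite_arbitrarily_large by blast
    have "B \<subseteq> Idx H" "orth H V W" if "V \<in> B" "W \<in> B" "V \<noteq> W" for V W
      using assms(1) B(3) that unfolding orthogonal_family_def by blast+
    then have "orthogonal_family B" "B \<subseteq> below H T"
      using assms B(3) unfolding orthogonal_family_def by auto
    then show False
      using finite_orthogonal_family_card[OF B(1) _ _ assms(3) chain_bounded_complexity] B(2) by simp
  qed
  show "card \<V> \<le> n"
    using finite_orthogonal_family_card[OF fin assms chain_bounded_complexity] .
qed

end

section \<open>Far domains\<close>

text \<open>Here \<open>x\<close> is to be thought of as a partial realization point of the tuple
  \<open>b\<close> that is correct at \<open>V\<close>. The threshold \<open>T\<close> is at least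
  ten times \<kappa> so that the several losses of \<kappa> in one triangle estimate never use up a
  distance above \<open>T\<close>. Closeness at \<open>V\<close> makes all far domains properly
  nested in \<open>V\<close>.\<close>

locale hhs_far_tuples = hhs X H E n
  for X :: "'a metric" and H :: "('a, 'i, 'c) hh_structure" and E :: real and n :: nat +
  fixes x :: 'a and b :: "'i \<Rightarrow> 'c" and \<kappa> T :: real and V :: 'i
  assumes x: "x \<in> mspace X"
    and cons_b: "consistent \<kappa> b" and b_image: "W \<in> Idx H \<Longrightarrow> b W \<in> proj_image H W (mspace X)"
    and E_le_\<kappa>: "E \<le> \<kappa>" and \<kappa>_le_T: "10 * \<kappa> \<le> T"
    and V: "V \<in> Idx H" and V_close: "D V (pt x V) (b V) \<le> T"
begin

abbreviation "a \<equiv> pt x"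

lemma cons_a: "consistent \<kappa> a"
  using consistent_mono[OF consistent_pt[OF x] E_le_\<kappa>] .

lemma aC: "W \<in> Idx H \<Longrightarrow> a W \<in> C W" and bC: "W \<in> Idx H \<Longrightarrow> b W \<in> C W"
  using consistentC cons_a cons_b by auto

lemma constants: "1 \<le> E" "1 \<le> \<kappa>" "E \<le> \<kappa>" "10 * \<kappa> \<le> T"
  using E_ge_1 E_le_\<kappa> \<kappa>_le_T by auto

definition far :: "'i \<Rightarrow> bool" where
  "far W \<longleftrightarrow> W \<in> Idx H \<and> nest H W V \<and> T < D W (a W) (b W)"

text \<open>Distinct maximal far domains are never nested, hence orthogonal or transverse, and
  consistency can order the transverse pairs.\<close>

definition max_far :: "'i \<Rightarrow> bool" where
  "max_far U \<longleftrightarrow> far U \<and> (\<forall>W. far W \<longrightarrow> \<not> pnest H U W)"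

text \<open>On the way from \<open>x\<close> to \<open>b\<close>, the domain \<open>U\<close> is passed before \<open>W\<close>.\<close>

definition prec :: "'i \<Rightarrow> 'i \<Rightarrow> bool" where
  "prec U W \<longleftrightarrow> transv H U W \<and> (\<exists>r\<in>rho_set H U W. D W (a W) r \<le> \<kappa>)"

lemma farD: "far W \<Longrightarrow> W \<in> Idx H" "far W \<Longrightarrow> nest H W V" "far W \<Longrightarrow> T < D W (a W) (b W)" "far W \<Longrightarrow> pnest H W V"
  using V_close unfolding far_def pnest_def by auto

lemma max_farD: "max_far W \<Longrightarrow> far W" "max_far W \<Longrightarrow> W \<in> Idx H" "max_far W \<Longrightarrow> T < D W (a W) (b W)"
  using farD unfolding max_far_def by auto

lemma max_far_nest_far:
  assumes "max_far U" "far W" "nest H U W"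
  shows "W = U"
  using assms unfolding max_far_def pnest_def by blast

lemma max_far_incomparable:
  assumes "max_far U" "max_far W" "U \<noteq> W"
  shows "orth H U W \<or> transv H U W"
  using assms max_far_nest_far max_farD(1) unfolding transv_def by metis

section \<open>The passing order on maximal far domains\<close>

lemma prec_a:
  assumes "U \<in> Idx H" "W \<in> Idx H" "prec U W" "r \<in> rho_set H U W"
  shows "D W (a W) r \<le> 2 * \<kappa>"
proof -
  from assms(3) obtain r' where t: "transv H U W" and r': "r' \<in> rho_set H U W" "D W (a W) r' \<le> \<kappa>"
    unfolding prec_def by blast
  have "D W r' r \<le> E" using rho_diam[OF assms(1,2) _ r'(1) assms(4)] t by blast
  then have "D W (a W) r \<le> \<kappa> + E"
    using D_chain r' aC[OF assms(2)] rho_sub[OF assms(1,2)] t assms(4) by blast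
  then show ?thesis using constants by linarith
qed

text \<open>The coordinate \<open>b W\<close> is far from \<open>a W\<close>, hence from the \<rho>
  set near \<open>a W\<close>; consistency of \<open>b\<close> can then only hold on the side of
  \<open>U\<close>.\<close>

lemma prec_b:
  assumes "U \<in> Idx H" "far W" "prec U W" "s \<in> rho_set H W U"
  shows "D U (b U) s \<le> \<kappa>"
proof -
  note W = farD(1)[OF assms(2)]
  have t: "transv H U W" using assms(3) unfolding prec_def by blast
  obtain r where r: "r \<in> rho_set H U W" "D W (a W) r \<le> \<kappa>"
    using assms(3) unfolding prec_def by blast
  have rC: "r \<in> C W" using rho_sub[OF assms(1) W] t r by blast
  have "\<not> D W (b W) r \<le> \<kappa>"
    using mdist_triangle[OF aC[OF W] rC bC[OF W]] r(2) farD(3)[OF assms(2)] constants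
      mdist_commute[of "CSpace H W" "b W" r] by linarith
  then show ?thesis
    using consistent_transv[OF cons_b assms(1) W t r(1) assms(4)] by blast
qed

text \<open>A converse of \<open>prec_b\<close>: here \<open>a U\<close> is the coordinate far from
  the \<rho> set. The bound 2\<kappa> leaves room to replace a domain by one containing it.\<close>

lemma precI:
  assumes U: "far U" and W: "W \<in> Idx H" and t: "transv H U W"
    and s: "s \<in> rho_set H W U" "D U (b U) s \<le> 2 * \<kappa>"
  shows "prec U W"
proof -
  note UI = farD(1)[OF U]
  obtain r where r: "r \<in> rho_set H U W" using rho_ne[OF UI W] t by blast
  have sC: "s \<in> C U" using rho_sub[OF W UI] transv_sym[OF UI W t] s by blast
  have "\<not> D U (a U) s \<le> \<kappa>"
    using mdist_triangle[OF aC[OF UI] sC bC[OF UI]] s(2) farD(3)[OF U] constants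
      mdist_commute[of "CSpace H U" "b U" s] by linarith
  then show ?thesis
    using consistent_transv[OF cons_a UI W t r s(1)] r t unfolding prec_def by blast
qed

lemma prec_total:
  assumes "far U" "far W" "transv H U W"
  shows "prec U W \<or> prec W U"
proof (rule disjCI)
  assume n: "\<not> prec W U"
  note UI = farD(1)[OF assms(1)] and WI = farD(1)[OF assms(2)]
  have WU: "transv H W U" using transv_sym[OF UI WI assms(3)] .
  obtain r s where r: "r \<in> rho_set H U W" and s: "s \<in> rho_set H W U"
    using rho_ne[OF UI WI] rho_ne[OF WI UI] assms(3) WU by blast
  have "\<not> D U (a U) s \<le> \<kappa>" using n s WU unfolding prec_def by blast
  then show "prec U W"
    using consistent_transv[OF cons_a UI WI assms(3) r s] r assms(3) unfolding prec_def by blast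
qed

lemma prec_asym:
  assumes "far U" "far W" "prec U W"
  shows "\<not> prec W U"
proof
  assume WU: "prec W U"
  note UI = farD(1)[OF assms(1)] and WI = farD(1)[OF assms(2)]
  obtain s where s: "s \<in> rho_set H W U" "D U (a U) s \<le> \<kappa>"
    using WU unfolding prec_def by blast
  have sC: "s \<in> C U" using rho_sub[OF WI UI] WU s unfolding prec_def by blast
  have "D U (b U) s \<le> \<kappa>" using prec_b[OF UI assms(2,3) s(1)] .
  then show False
    using mdist_triangle[OF aC[OF UI] sC bC[OF UI]] s(2) farD(3)[OF assms(1)] constants
      mdist_commute[of "CSpace H U" "b U" s] by linarith
qed

lemma realizes_pt:
  assumes "U \<in> Idx H" "c U \<in> proj_image H U (mspace X)"
  obtains z where "realizes c {U} z"
  using realizes_exists[of "{U}" c] assms unfolding orthogonal_family_def by auto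

text \<open>If they were orthogonal, a point \<open>z\<close> could agree with \<open>a\<close> at
  \<open>U1\<close> and with \<open>b\<close> at \<open>U3\<close>. Not having passed
  \<open>U1\<close>, it is near \<open>a\<close> at \<open>U2\<close>; having passed
  \<open>U3\<close>, it is near \<open>b\<close> there. But \<open>a\<close> and \<open>b\<close>
  are far apart at \<open>U2\<close>.\<close>

lemma prec_not_orth:
  assumes 1: "max_far U1" and 2: "max_far U2" and 3: "max_far U3" and p12: "prec U1 U2" and p23: "prec U2 U3"
  shows "\<not> orth H U1 U3"
proof
  assume o: "orth H U1 U3"
  note I1 = max_farD(2)[OF 1] and I2 = max_farD(2)[OF 2] and I3 = max_farD(2)[OF 3]
  have ne: "U1 \<noteq> U3" using o orth_irrefl I1 by blast
  have "orth H U3 U1" using o orth_sym I1 I3 by blast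
  then have fam: "orthogonal_family {U1, U3}"
    using o I1 I3 unfolding orthogonal_family_def by blast
  define c where "c = (\<lambda>W. if W = U1 then a U1 else b U3)"
  have c: "c U1 = a U1" "c U3 = b U3" using ne by (auto simp: c_def)
  have "c W \<in> proj_image H W (mspace X)" if "W \<in> {U1, U3}" for W
    using that pt_image[OF I1 x] b_image[OF I3] c by auto
  then obtain z where z: "realizes c {U1, U3} z"
    using realizes_exists[OF fam] by blast
  have zX: "z \<in> mspace X" using realizes_point[OF z] .
  note zC = pt_C[OF _ zX] and cz = consistent_pt[OF zX]
  have t12: "transv H U1 U2" and t23: "transv H U2 U3"
    using p12 p23 unfolding prec_def by auto
  have t21: "transv H U2 U1" and t32: "transv H U3 U2"
    using t12 t23 transv_sym I1 I2 I3 by blast+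
  obtain r12 r21 r23 r32 where r: "r12 \<in> rho_set H U1 U2" "r21 \<in> rho_set H U2 U1"
      "r23 \<in> rho_set H U2 U3" "r32 \<in> rho_set H U3 U2"
    using rho_ne[OF I1 I2] rho_ne[OF I2 I1] rho_ne[OF I2 I3] rho_ne[OF I3 I2] t12 t21 t23 t32 by blast
  have rC: "r12 \<in> C U2" "r21 \<in> C U1" "r23 \<in> C U3" "r32 \<in> C U2"
    using rho_sub[OF I1 I2] rho_sub[OF I2 I1] rho_sub[OF I2 I3] rho_sub[OF I3 I2] t12 t21 t23 t32 r
    by blast+
  have "D U1 (pt z U1) (a U1) \<le> E" "D U3 (pt z U3) (b U3) \<le> E"
    using realizes_coord[OF z, of U1] realizes_coord[OF z, of U3] c by auto
  note zc = this
  have b1: "D U1 (b U1) r21 \<le> \<kappa>" using prec_b[OF I1 max_farD(1)[OF 2] p12 r(2)] .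
  have "\<not> D U1 (pt z U1) r21 \<le> E"
    using mdist_triangle[OF aC[OF I1] zC[OF I1] rC(2)] mdist_triangle[OF aC[OF I1] rC(2) bC[OF I1]]
      b1 zc(1) max_farD(3)[OF 1] constants
      mdist_commute[of "CSpace H U1" "b U1" r21] mdist_commute[of "CSpace H U1" "pt z U1" "a U1"]
    by linarith
  then have z12: "D U2 (pt z U2) r12 \<le> E"
    using consistent_transv[OF cz I1 I2 t12 r(1,2)] by blast
  have "D U3 (a U3) r23 \<le> 2 * \<kappa>" using prec_a[OF I2 I3 p23 r(3)] .
  then have "\<not> D U3 (pt z U3) r23 \<le> E"
    using mdist_triangle[OF aC[OF I3] rC(3) bC[OF I3]] mdist_triangle[OF rC(3) zC[OF I3] bC[OF I3]]
      zc(2) max_farD(3)[OF 3] constants mdist_commute[of "CSpace H U3" "pt z U3" r23]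
    by linarith
  then have z32: "D U2 (pt z U2) r32 \<le> E"
    using consistent_transv[OF cz I3 I2 t32 r(4,3)] by blast
  have a2: "D U2 (a U2) r12 \<le> 2 * \<kappa>" using prec_a[OF I1 I2 p12 r(1)] .
  have b2: "D U2 (b U2) r32 \<le> \<kappa>" using prec_b[OF I2 max_farD(1)[OF 3] p23 r(4)] .
  show False
    using mdist_triangle[OF aC[OF I2] rC(1) bC[OF I2]] mdist_triangle[OF rC(1) zC[OF I2] bC[OF I2]]
      mdist_triangle[OF zC[OF I2] rC(4) bC[OF I2]] z12 z32 a2 b2 max_farD(3)[OF 2] constants
      mdist_commute[of "CSpace H U2" "pt z U2" r12] mdist_commute[of "CSpace H U2" "b U2" r32]
    by linarith
qed

text \<open>By \<open>prec_not_orth\<close> the domains \<open>U1\<close> and \<open>U3\<close> are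
  transverse, so only a cycle must be excluded. A point that realizes \<open>b\<close> at
  \<open>U2\<close> is near \<open>b\<close> at \<open>U1\<close> and near \<open>a\<close> at
  \<open>U3\<close>; if \<open>U3\<close> came before \<open>U1\<close>, consistency between
  \<open>U1\<close> and \<open>U3\<close> would put it near \<open>b\<close> at
  \<open>U3\<close>.\<close>

lemma prec_trans:
  assumes 1: "max_far U1" and 2: "max_far U2" and 3: "max_far U3" and p12: "prec U1 U2" and p23: "prec U2 U3"
  shows "prec U1 U3"
proof (rule ccontr)
  assume n: "\<not> prec U1 U3"
  note I1 = max_farD(2)[OF 1] and I2 = max_farD(2)[OF 2] and I3 = max_farD(2)[OF 3]
  have "U1 \<noteq> U3"
    using prec_asym[OF max_farD(1)[OF 1] max_farD(1)[OF 2] p12] p23 by blast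
  then have t13: "transv H U1 U3"
    using max_far_incomparable[OF 1 3] prec_not_orth[OF 1 2 3 p12 p23] by blast
  then have p31: "prec U3 U1"
    using prec_total max_farD(1) 1 3 n by blast
  have t12: "transv H U1 U2" and t23: "transv H U2 U3"
    using p12 p23 unfolding prec_def by auto
  have t21: "transv H U2 U1" and t32: "transv H U3 U2" and t31: "transv H U3 U1"
    using t12 t23 t13 transv_sym I1 I2 I3 by blast+
  obtain z where z: "realizes b {U2} z"
    using realizes_pt[where U = U2 and c = b] b_image I2 by blast
  have zX: "z \<in> mspace X" using realizes_point[OF z] .
  note zC = pt_C[OF _ zX] and cz = consistent_pt[OF zX]
  obtain s where s: "s \<in> rho_set H U2 U1" using rho_ne[OF I2 I1] t21 by blast
  obtain t where t: "t \<in> rho_set H U3 U1" using rho_ne[OF I3 I1] t31 by blast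
  obtain t' where t': "t' \<in> rho_set H U1 U3" using rho_ne[OF I1 I3] t13 by blast
  obtain r where r: "r \<in> rho_set H U2 U3" using rho_ne[OF I2 I3] t23 by blast
  have C: "s \<in> C U1" "t \<in> C U1" "t' \<in> C U3" "r \<in> C U3"
    using rho_sub[OF I2 I1] rho_sub[OF I3 I1] rho_sub[OF I1 I3] rho_sub[OF I2 I3]
      t21 t31 t13 t23 s t t' r by blast+
  have 1: "D U1 (pt z U1) s \<le> E" using realizes_rho[OF z _ I1 _ s] t21 by blast
  have 2: "D U1 (b U1) s \<le> \<kappa>" using prec_b[OF I1 max_farD(1)[OF 2] p12 s] .
  have 3: "D U1 (a U1) t \<le> 2 * \<kappa>" using prec_a[OF I3 I1 p31 t] .
  have "\<not> D U1 (pt z U1) t \<le> E"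
    using mdist_triangle[OF aC[OF I1] C(2) bC[OF I1]] mdist_triangle[OF C(2) zC[OF I1] bC[OF I1]]
      mdist_triangle[OF zC[OF I1] C(1) bC[OF I1]] 1 2 3 max_farD(3)[OF \<open>max_far U1\<close>] constants
      mdist_commute[of "CSpace H U1" "pt z U1" t] mdist_commute[of "CSpace H U1" "b U1" s]
    by linarith
  then have 4: "D U3 (pt z U3) t' \<le> E"
    using consistent_transv[OF cz I1 I3 t13 t' t] by blast
  have 5: "D U3 (pt z U3) r \<le> E" using realizes_rho[OF z _ I3 _ r] t23 by blast
  have 6: "D U3 (a U3) r \<le> 2 * \<kappa>" using prec_a[OF I2 I3 p23 r] .
  have 7: "D U3 (b U3) t' \<le> \<kappa>" using prec_b[OF I3 max_farD(1)[OF \<open>max_far U1\<close>] p31 t'] .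
  show False
    using mdist_triangle[OF aC[OF I3] C(4) bC[OF I3]] mdist_triangle[OF C(4) zC[OF I3] bC[OF I3]]
      mdist_triangle[OF zC[OF I3] C(3) bC[OF I3]] 4 5 6 7 max_farD(3)[OF \<open>max_far U3\<close>] constants
      mdist_commute[of "CSpace H U3" "pt z U3" r] mdist_commute[of "CSpace H U3" "b U3" t']
    by linarith
qed

section \<open>Chains in the passing order have bounded size\<close>

definition prec_chain :: "'i set \<Rightarrow> bool" where
  "prec_chain A \<longleftrightarrow> finite A \<and> (\<forall>U\<in>A. max_far U) \<and>
     (\<forall>U\<in>A. \<forall>W\<in>A. U \<noteq> W \<longrightarrow> prec U W \<or> prec W U)"

lemma prec_chain_subset: "prec_chain A \<Longrightarrow> B \<subseteq> A \<Longrightarrow> prec_chain B"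
  unfolding prec_chain_def by (meson finite_subset subsetD)

lemma prec_chain_last:
  assumes "A \<noteq> {}" "prec_chain A"
  shows "\<exists>L\<in>A. \<forall>U\<in>A. U \<noteq> L \<longrightarrow> prec U L"
proof (rule finite_total_has_last)
  show "finite A" "A \<noteq> {}" using assms unfolding prec_chain_def by auto
  show "prec U W \<or> prec W U" if "U \<in> A" "W \<in> A" "U \<noteq> W" for U W
    using assms(2) that unfolding prec_chain_def by blast
  show "prec U1 U3" if "U1 \<in> A" "U2 \<in> A" "U3 \<in> A" "prec U1 U2" "prec U2 U3" for U1 U2 U3
    using assms(2) prec_trans[of U1 U2 U3] that unfolding prec_chain_def by blast
qed

text \<open>All members of a chain below \<open>W\<close> are seen by the pair of points formed by \<open>x\<close> and a
  realization point of the last member, whose projections to \<open>W\<close> are close; so large links places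
  them below boundedly many domains properly nested in \<open>W\<close>.\<close>
lemma prec_chain_bounded:
  "\<exists>M. \<forall>W A. chain_bounded j W \<longrightarrow> W \<in> Idx H \<longrightarrow> nest H W V \<longrightarrow> D W (a W) (b W) \<le> T \<longrightarrow>
     prec_chain A \<longrightarrow> (\<forall>U\<in>A. pnest H U W) \<longrightarrow> card A \<le> M"
proof (induction j)
  case 0
  then show ?case using not_chain_bounded_0 by blast
next
  case (Suc j)
  then obtain M where M: "\<And>W A. chain_bounded j W \<Longrightarrow> W \<in> Idx H \<Longrightarrow> nest H W V \<Longrightarrow>
      D W (a W) (b W) \<le> T \<Longrightarrow> prec_chain A \<Longrightarrow> \<forall>U\<in>A. pnest H U W \<Longrightarrow> card A \<le> M"
    by blast
  \<comment> \<open>The large links bound at distance 2T + 3\<kappa>, which will be shown to bound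
    the distance from \<open>a W\<close> to the projection of \<open>z\<close>.\<close>
  define N where "N = nat \<lceil>E * (2 * T + 3 * \<kappa>) + E\<rceil>"
  have "card A \<le> N * (M + 1)"
    if cb: "chain_bounded (Suc j) W" and W: "W \<in> Idx H" and WV: "nest H W V"
      and WT: "D W (a W) (b W) \<le> T" and ch: "prec_chain A" and sub: "\<forall>U\<in>A. pnest H U W" for W A
  proof (cases "A = {}")
    case False
    have fin: "finite A" and m: "\<And>U. U \<in> A \<Longrightarrow> max_far U"
      using ch unfolding prec_chain_def by auto
    then obtain L where L: "L \<in> A" "\<And>U. U \<in> A \<Longrightarrow> U \<noteq> L \<Longrightarrow> prec U L"
      using prec_chain_last[OF False ch] by blast
    note LI = max_farD(2)[OF m[OF L(1)]]
    have LW: "pnest H L W" using sub L by blast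
    obtain z where z: "realizes b {L} z"
      using realizes_pt[where U = L and c = b] b_image LI by blast
    have zX: "z \<in> mspace X" using realizes_point[OF z] .
    note zC = pt_C[OF _ zX]
    \<comment> \<open>Every other member of the chain precedes \<open>L\<close>, so
      \<open>z\<close>, realized at \<open>L\<close>, agrees there with \<open>b\<close> up to
      2\<kappa> and is far from \<open>x\<close>.\<close>
    have far_z: "\<not> D U (a U) (pt z U) \<le> E" if U: "U \<in> A" for U
    proof -
      note UI = max_farD(2)[OF m[OF U]]
      have "D U (pt z U) (b U) \<le> 2 * \<kappa>"
      proof (cases "U = L")
        case True
        then show ?thesis using realizes_coord[OF z, of L] constants by simp
      next
        case False
        then have p: "prec U L" using L U by blast
        then have t: "transv H L U" using transv_sym UI LI unfolding prec_def by blast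
        obtain s where s: "s \<in> rho_set H L U" using rho_ne[OF LI UI] t by blast
        have sC: "s \<in> C U" using rho_sub[OF LI UI] t s by blast
        have "D U (pt z U) s \<le> E" using realizes_rho[OF z _ UI _ s] t by blast
        moreover have "D U (b U) s \<le> \<kappa>" using prec_b[OF UI max_farD(1)[OF m[OF L(1)]] p s] .
        ultimately show ?thesis
          using mdist_triangle[OF zC[OF UI] sC bC[OF UI]] mdist_commute[of "CSpace H U" "b U" s]
            constants by linarith
      qed
      then show ?thesis
        using mdist_triangle[OF aC[OF UI] zC[OF UI] bC[OF UI]] max_farD(3)[OF m[OF U]] constants
        by linarith
    qed
    obtain r where r: "r \<in> rho_set H L W" using rho_ne[OF LI W] LW by blast
    have rC: "r \<in> C W" using rho_sub[OF LI W] LW r by blast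
    have "D W (pt z W) r \<le> E" using realizes_rho[OF z _ W _ r] LW by blast
    moreover have "D W (b W) r \<le> D W (a W) (b W) + 2 * \<kappa>"
      using rho_close_if_coords_far[OF cons_a cons_b E_le_\<kappa> LI W LW _ r] max_farD(3)[OF m[OF L(1)]]
        constants by linarith
    ultimately have az: "D W (a W) (pt z W) \<le> 2 * T + 3 * \<kappa>"
      using mdist_triangle[OF aC[OF W] bC[OF W] zC[OF W]] mdist_triangle[OF bC[OF W] rC zC[OF W]]
        mdist_commute[of "CSpace H W" "pt z W" r] WT constants by linarith
    from large_links[OF W x zX pt_in[OF W x] pt_in[OF W zX]] obtain \<T> where
      \<T>: "\<T> \<subseteq> below H W - {W}" "finite \<T>" "real (card \<T>) \<le> E * D W (a W) (pt z W) + E"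
        "\<And>U. U \<in> below H W - {W} \<Longrightarrow> (\<exists>T'\<in>\<T>. U \<in> below H T') \<or>
          (\<forall>q\<in>proj H U x. \<forall>q'\<in>proj H U z. D U q q' \<le> E)"
      by blast
    have "E * D W (a W) (pt z W) + E \<le> E * (2 * T + 3 * \<kappa>) + E"
      using az constants by simp
    then have cardT: "card \<T> \<le> N" using \<T>(3) unfolding N_def by linarith
    define B where "B = (\<lambda>T'. {U \<in> A. nest H U T'})"
    have "A \<subseteq> (\<Union>T'\<in>\<T>. B T')"
    proof
      fix U assume U: "U \<in> A"
      note UI = max_farD(2)[OF m[OF U]]
      have "U \<in> below H W - {W}"
        using sub U UI unfolding below_def pnest_def by blast
      moreover have "\<not> (\<forall>q\<in>proj H U x. \<forall>q'\<in>proj H U z. D U q q' \<le> E)"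
        using far_z[OF U] pt_in[OF UI x] pt_in[OF UI zX] by blast
      ultimately obtain T' where "T' \<in> \<T>" "U \<in> below H T'" using \<T>(4) by blast
      then show "U \<in> (\<Union>T'\<in>\<T>. B T')" using U unfolding B_def below_def by blast
    qed
    moreover have "card (B T') \<le> M + 1" if T': "T' \<in> \<T>" for T'
    proof -
      have T'I: "T' \<in> Idx H" and T'W: "pnest H T' W"
        using \<T>(1) T' unfolding below_def pnest_def by auto
      have T'V: "nest H T' V"
        using nestT[OF T'I W V] T'W WV unfolding pnest_def by blast
      \<comment> \<open>A maximal far domain properly nested in \<open>T'\<close> shows that
        \<open>T'\<close> is not far, so the induction hypothesis applies to \<open>T'\<close>. The
        domain \<open>T'\<close> may itself be a member and is counted separately.\<close>
      have "card (B T' - {T'}) \<le> M"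
      proof (cases "B T' - {T'} = {}")
        case True
        then show ?thesis by (metis card.empty le0)
      next
        case False
        then obtain U where U: "U \<in> A" "pnest H U T'" unfolding B_def pnest_def by blast
        then have "\<not> far T'" using m[OF U(1)] unfolding max_far_def by blast
        then have "D T' (a T') (b T') \<le> T" using T'I T'V unfolding far_def by auto
        moreover have "prec_chain (B T' - {T'})"
          by (rule prec_chain_subset[OF ch]) (auto simp: B_def)
        moreover have "\<forall>U\<in>B T' - {T'}. pnest H U T'"
          unfolding B_def pnest_def by blast
        ultimately show ?thesis
          using M[OF chain_bounded_pnest[OF cb T'I W T'W] T'I T'V] by blast
      qed
      moreover have "finite (B T')" using fin unfolding B_def by simp
      ultimately show ?thesis
        by (cases "T' \<in> B T'") (auto simp: card_Diff_singleton_if)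
    qed
    moreover have "finite (\<Union>T'\<in>\<T>. B T')" using fin \<T>(2) unfolding B_def by simp
    ultimately have "card A \<le> card (\<Union>T'\<in>\<T>. B T')" "(\<Sum>T'\<in>\<T>. card (B T')) \<le> card \<T> * (M + 1)"
      using sum_bounded_above[of \<T> "\<lambda>T'. card (B T')" "M + 1"] by (simp_all add: card_mono)
    moreover have "card (\<Union>T'\<in>\<T>. B T') \<le> (\<Sum>T'\<in>\<T>. card (B T'))"
      by (rule card_UN_le[OF \<T>(2)])
    ultimately have "card A \<le> card \<T> * (M + 1)" by linarith
    then show ?thesis
      by (rule order.trans) (rule mult_le_mono1[OF cardT])
  qed simp
  then show ?case by blast
qed

lemma exists_max_far:
  assumes "far W"
  obtains U where "max_far U" "nest H W U"
proof -
  obtain U where "U \<in> Idx H" "far U" "nest H W U" "\<And>U'. U' \<in> Idx H \<Longrightarrow> far U' \<Longrightarrow> \<not> pnest H U U'"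
    using exists_nest_maximal[of W far] assms farD(1) by blast
  then show thesis using that farD(1) unfolding max_far_def by blast
qed

text \<open>The last member of a longest chain is maximal: a maximal far domain after it would come
  after all members by transitivity and could be added.\<close>

lemma exists_prec_maximal:
  assumes "far W0"
  obtains U where "max_far U" "\<And>W. max_far W \<Longrightarrow> \<not> prec U W"
proof -
  obtain U0 where U0: "max_far U0" using exists_max_far[OF assms] by blast
  obtain M where M: "\<And>A. prec_chain A \<Longrightarrow> card A \<le> M"
  proof -
    obtain M where "\<forall>W A. chain_bounded n W \<longrightarrow> W \<in> Idx H \<longrightarrow> nest H W V \<longrightarrow> D W (a W) (b W) \<le> T \<longrightarrow>
     prec_chain A \<longrightarrow> (\<forall>U\<in>A. pnest H U W) \<longrightarrow> card A \<le> M"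
      using prec_chain_bounded[of n] by (elim exE)
    moreover have "\<forall>U\<in>A. pnest H U V" if "prec_chain A" for A
      using that farD(4) max_farD(1) unfolding prec_chain_def by blast
    ultimately have "card A \<le> M" if "prec_chain A" for A
      using that chain_bounded_complexity V nest_self[OF V] V_close by simp
    then show thesis by (rule that)
  qed
  have "prec_chain {U0}" using U0 unfolding prec_chain_def by blast
  then obtain A where A: "prec_chain A" "\<And>B. prec_chain B \<Longrightarrow> card B \<le> card A"
    using exists_max_card[of prec_chain "{U0}" M] M by metis
  have "A \<noteq> {}" using A(2)[OF \<open>prec_chain {U0}\<close>] by auto
  obtain L where L: "L \<in> A" "\<And>U. U \<in> A \<Longrightarrow> U \<noteq> L \<Longrightarrow> prec U L"
    using prec_chain_last[OF \<open>A \<noteq> {}\<close> A(1)] by blast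
  have m: "\<And>U. U \<in> A \<Longrightarrow> max_far U" and fin: "finite A" using A(1) unfolding prec_chain_def by auto
  have "\<not> prec L W" if W: "max_far W" for W
  proof
    assume LW: "prec L W"
    have "prec U W" if "U \<in> A" for U
      using prec_trans[OF m[OF that] m[OF L(1)] W _ LW] L(2)[OF that] LW by blast
    then have "prec_chain (insert W A)"
      using A(1) W unfolding prec_chain_def by blast
    moreover have "W \<notin> A"
      using L(2)[of W] LW prec_asym[OF max_farD(1)[OF m[OF L(1)]] max_farD(1)[OF W]] by blast
    ultimately show False
      using A(2)[of "insert W A"] fin by simp
  qed
  then show thesis using that m L(1) by blast
qed

text \<open>Take \<open>U\<close> maximal for nesting and for the passing order. A domain
  \<open>W\<close> properly containing \<open>U\<close> is not far, so
  \<open>rho_close_if_coords_far\<close> applies. If \<open>W\<close> is transverse to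
  \<open>U\<close>, the claim is immediate unless \<open>U\<close> precedes \<open>W\<close>; then a
  far \<open>W\<close> would lie in a maximal far domain \<open>W1\<close>, also preceded by
  \<open>U\<close>, which is impossible.\<close>

lemma far_dominating:
  assumes "far W0"
  obtains U where "far U"
    "\<And>W r. W \<in> Idx H \<Longrightarrow> nest H W V \<Longrightarrow> pnest H U W \<or> transv H U W \<Longrightarrow> r \<in> rho_set H U W \<Longrightarrow>
      D W (b W) r \<le> T + 2 * \<kappa>"
proof -
  obtain U where mU: "max_far U" and pU: "\<And>W. max_far W \<Longrightarrow> \<not> prec U W"
    using exists_prec_maximal[OF assms] by blast
  note UI = max_farD(2)[OF mU] and fU = max_farD(1)[OF mU] and TU = max_farD(3)[OF mU]
  have "D W (b W) r \<le> T + 2 * \<kappa>"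
    if W: "W \<in> Idx H" and WV: "nest H W V" and r: "r \<in> rho_set H U W" and UW: "pnest H U W" for W r
  proof -
    have "\<not> far W" using mU UW unfolding max_far_def by blast
    then have "D W (a W) (b W) \<le> T" using W WV unfolding far_def by auto
    moreover have "D W (b W) r \<le> D W (a W) (b W) + 2 * \<kappa>"
      using rho_close_if_coords_far[OF cons_a cons_b E_le_\<kappa> UI W UW _ r] TU constants by linarith
    ultimately show ?thesis by linarith
  qed
  moreover have "D W (b W) r \<le> T + 2 * \<kappa>"
    if W: "W \<in> Idx H" and WV: "nest H W V" and r: "r \<in> rho_set H U W" and UW: "transv H U W" for W r
  proof -
    have rC: "r \<in> C W" using rho_sub[OF UI W] UW r by blast
    consider "D W (b W) r \<le> \<kappa>" | "D W (a W) r \<le> \<kappa>"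
      using rho_close_if_coords_far_transv[OF cons_a cons_b UI W UW _ r] TU constants by linarith
    then show ?thesis
    proof cases
      case 1
      then show ?thesis using constants by linarith
    next
      case 2
      then have p: "prec U W" using r UW unfolding prec_def by blast
      have "\<not> far W"
      proof
        assume fW: "far W"
        then obtain W1 where W1: "max_far W1" "nest H W W1" using exists_max_far by blast
        note W1I = max_farD(2)[OF W1(1)]
        have "\<not> orth H W1 U"
          using orth_nest[OF W W1I UI W1(2)] UW orth_sym[OF W UI] unfolding transv_def by blast
        moreover have "W1 \<noteq> U" using W1(2) UW unfolding transv_def by blast
        ultimately have t: "transv H W1 U"
          using max_far_incomparable[OF W1(1) mU] by blast
        have WU: "transv H W U" and UW1: "transv H U W1"
          using transv_sym UI W W1I UW t by blast+
        obtain s s1 where s: "s \<in> rho_set H W U" "s1 \<in> rho_set H W1 U"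
          using rho_ne[OF W UI] rho_ne[OF W1I UI] WU t by blast
        have sC: "s \<in> C U" "s1 \<in> C U"
          using rho_sub[OF W UI] rho_sub[OF W1I UI] WU t s by blast+
        have "\<not> orth H U W" using UW unfolding transv_def by blast
        then have "D U s s1 \<le> E" using consist_rho[OF W W1I UI W1(2) _ s] t by blast
        moreover have "D U (b U) s \<le> \<kappa>" using prec_b[OF UI fW p s(1)] .
        ultimately have "D U (b U) s1 \<le> 2 * \<kappa>"
          using mdist_triangle[OF bC[OF UI] sC] constants by linarith
        then have "prec U W1" using precI[OF fU W1I UW1 s(2)] by blast
        then show False using pU W1(1) by blast
      qed
      then have "D W (a W) (b W) \<le> T" using W WV unfolding far_def by auto
      then show ?thesis
        using 2 mdist_triangle[OF bC[OF W] aC[OF W] rC] mdist_commute[of "CSpace H W" "a W" "b W"]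
          constants by linarith
    qed
  qed
  ultimately show thesis using that fU by blast
qed

end

section \<open>Realization of consistent tuples\<close>

context hhs
begin

lemma exists_far_dominating:
  assumes "x \<in> mspace X" "consistent \<kappa> b" "\<And>W. W \<in> Idx H \<Longrightarrow> b W \<in> proj_image H W (mspace X)"
    and "E \<le> \<kappa>" "10 * \<kappa> \<le> T" "V \<in> Idx H" "D V (pt x V) (b V) \<le> T"
    and "W0 \<in> below H V" "T < D W0 (pt x W0) (b W0)"
  obtains U where "U \<in> Idx H" "pnest H U V" "T < D U (pt x U) (b U)"
    "\<And>W r. W \<in> below H V \<Longrightarrow> pnest H U W \<or> transv H U W \<Longrightarrow> r \<in> rho_set H U W \<Longrightarrow>
      D W (b W) r \<le> T + 2 * \<kappa>"
proof -
  interpret hhs_far_tuples X H E n x b \<kappa> T V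
    by unfold_locales (fact assms)+
  have "far W0" using assms(8,9) unfolding far_def below_def by blast
  then obtain U where "far U"
    "\<And>W r. W \<in> Idx H \<Longrightarrow> nest H W V \<Longrightarrow> pnest H U W \<or> transv H U W \<Longrightarrow> r \<in> rho_set H U W \<Longrightarrow>
      D W (b W) r \<le> T + 2 * \<kappa>"
    using far_dominating by blast
  then show thesis using that[of U] farD unfolding below_def by blast
qed

section \<open>Families that control all coordinates below a domain\<close>

definition realizable_tuple :: "real \<Rightarrow> ('i \<Rightarrow> 'c) \<Rightarrow> bool" where
  "realizable_tuple \<kappa> b \<longleftrightarrow> consistent \<kappa> b \<and> (\<forall>W\<in>Idx H. b W \<in> proj_image H W (mspace X))"

text \<open>All points that realize the family are quantified, not one: a point realizing a larger
  family realizes this one too, and so control below a domain survives when its family is merged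
  with others.\<close>

definition controls :: "('i \<Rightarrow> 'c) \<Rightarrow> 'i \<Rightarrow> 'i set \<Rightarrow> real \<Rightarrow> bool" where
  "controls b V \<R> \<theta> \<longleftrightarrow> orthogonal_family \<R> \<and> \<R> \<noteq> {} \<and> \<R> \<subseteq> below H V \<and>
     (\<forall>z. realizes b \<R> z \<longrightarrow> (\<forall>W\<in>below H V. D W (pt z W) (b W) \<le> \<theta>))"

text \<open>The empty family stands for the stage at which only the coordinate in \<open>V\<close> has been
  prescribed.\<close>

definition partly_controls :: "('i \<Rightarrow> 'c) \<Rightarrow> 'i \<Rightarrow> 'i set \<Rightarrow> real \<Rightarrow> bool" where
  "partly_controls b V \<R> \<theta> \<longleftrightarrow> orthogonal_family \<R> \<and> \<R> \<subseteq> below H V \<and>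
     (\<forall>z. realizes b (if \<R> = {} then {V} else \<R>) z \<longrightarrow> D V (pt z V) (b V) \<le> \<theta> \<and>
        (\<forall>W\<in>below H V. (\<exists>R\<in>\<R>. \<not> orth H W R) \<longrightarrow> D W (pt z W) (b W) \<le> \<theta>))"

lemma controls_mono:
  assumes "controls b V \<R> \<theta>" "\<theta> \<le> \<theta>'"
  shows "controls b V \<R> \<theta>'"
  using assms unfolding controls_def by (meson order_trans)

lemma realizes_subset: "realizes b \<R> z \<Longrightarrow> \<S> \<subseteq> \<R> \<Longrightarrow> realizes b \<S> z"
  unfolding realizes_def by blast

text \<open>A bad realization point gives a far domain \<open>U\<close>. It is orthogonal to every
  member of \<R>, since otherwise it would be controlled, so a family controlling \<open>U\<close>
  can be added. A domain \<open>W\<close> not orthogonal to a new member \<open>S\<close> is either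
  nested in \<open>U\<close> and controlled there, or contains \<open>S\<close> or is transverse to
  it. In the latter cases a realization point is near \<open>rho_set H S W\<close>, which is near
  \<open>rho_set H U W\<close>, which by the choice of \<open>U\<close> is near
  \<open>b W\<close>.\<close>

lemma partly_controls_extend:
  assumes b: "realizable_tuple \<kappa> b" and \<kappa>: "E \<le> \<kappa>" and V: "V \<in> Idx H" and cb: "chain_bounded (Suc j) V"
    and pc: "partly_controls b V \<R> \<theta>" and T: "\<theta> \<le> T" "10 * \<kappa> \<le> T"
    and IH: "\<And>U. U \<in> Idx H \<Longrightarrow> chain_bounded j U \<Longrightarrow> \<exists>\<U>. controls b U \<U> \<theta>j"
    and nc: "\<not> controls b V (if \<R> = {} then {V} else \<R>) T"
  shows "\<exists>\<R>'. partly_controls b V \<R>' (max \<theta>j (T + 4 * \<kappa>)) \<and> card \<R> < card \<R>'"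
proof -
  have cb': "consistent \<kappa> b" and bi: "\<And>W. W \<in> Idx H \<Longrightarrow> b W \<in> proj_image H W (mspace X)"
    using b unfolding realizable_tuple_def by auto
  have oR: "orthogonal_family \<R>" and RV: "\<R> \<subseteq> below H V" and RI: "\<R> \<subseteq> Idx H"
    using pc unfolding partly_controls_def orthogonal_family_def by auto
  have VV: "V \<in> below H V" using V nest_self unfolding below_def by blast
  have "orthogonal_family (if \<R> = {} then {V} else \<R>)" "(if \<R> = {} then {V} else \<R>) \<noteq> {}"
    "(if \<R> = {} then {V} else \<R>) \<subseteq> below H V"
    using oR RV V VV unfolding orthogonal_family_def by auto
  then obtain z W0 where z: "realizes b (if \<R> = {} then {V} else \<R>) z"
      and W0: "W0 \<in> below H V" "T < D W0 (pt z W0) (b W0)"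
    using nc unfolding controls_def not_le[symmetric] by blast
  have zX: "z \<in> mspace X" using realizes_point[OF z] .
  have zV: "D V (pt z V) (b V) \<le> T" using pc z T(1) unfolding partly_controls_def by auto
  obtain U where U: "U \<in> Idx H" "pnest H U V" "T < D U (pt z U) (b U)"
    and dom: "\<And>W r. W \<in> below H V \<Longrightarrow> pnest H U W \<or> transv H U W \<Longrightarrow> r \<in> rho_set H U W \<Longrightarrow>
      D W (b W) r \<le> T + 2 * \<kappa>"
    using exists_far_dominating[OF zX cb' bi \<kappa> T(2) V zV W0] by blast
  have UV: "U \<in> below H V" using U unfolding below_def pnest_def by blast
  have UR: "orth H U R" if "R \<in> \<R>" for R
    using pc z UV that U(3) T(1) unfolding partly_controls_def by force
  obtain \<U> where \<U>: "controls b U \<U> \<theta>j"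
    using IH[OF U(1) chain_bounded_pnest[OF cb U(1) V U(2)]] by blast
  have o\<U>: "orthogonal_family \<U>" and ne: "\<U> \<noteq> {}" and \<U>U: "\<And>S. S \<in> \<U> \<Longrightarrow> S \<in> Idx H \<and> nest H S U"
    using \<U> unfolding controls_def below_def by auto
  have SV: "nest H S V" if "S \<in> \<U>" for S
    using nestT[of S U V] \<U>U[OF that] U(1,2) V unfolding pnest_def by blast
  have oo: "orth H S R \<and> orth H R S" if "S \<in> \<U>" "R \<in> \<R>" for S R
    using orth_nest[of S U R] orth_sym[of S R] \<U>U[OF that(1)] U(1) UR[OF that(2)] that(2) RI by blast
  have "orthogonal_family (\<R> \<union> \<U>)"
    unfolding orthogonal_family_def
  proof (intro conjI ballI impI)
    show "\<R> \<union> \<U> \<subseteq> Idx H" using RI \<U>U by blast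
    show "orth H S R" if "S \<in> \<R> \<union> \<U>" "R \<in> \<R> \<union> \<U>" "S \<noteq> R" for S R
      using that oo[of S R] oo[of R S] oR o\<U> unfolding orthogonal_family_def by auto
  qed
  moreover have "\<R> \<union> \<U> \<subseteq> below H V"
    using RV \<U>U SV unfolding below_def by blast
  ultimately have fam: "orthogonal_family (\<R> \<union> \<U>)" "\<R> \<union> \<U> \<subseteq> below H V" by auto
  have disj: "\<R> \<inter> \<U> = {}"
    using oo orth_irrefl RI by blast
  have fin: "finite (\<R> \<union> \<U>)" using orthogonal_family_card(1)[OF fam V] .
  have "card \<R> < card (\<R> \<union> \<U>)"
    by (rule psubset_card_mono[OF fin]) (use disj ne in blast)
  moreover have "partly_controls b V (\<R> \<union> \<U>) (max \<theta>j (T + 4 * \<kappa>))"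
    unfolding partly_controls_def
  proof (intro conjI allI impI fam)
    fix y assume "realizes b (if \<R> \<union> \<U> = {} then {V} else \<R> \<union> \<U>) y"
    then have y: "realizes b (\<R> \<union> \<U>) y" using ne by simp
    have yU: "realizes b \<U> y" using realizes_subset[OF y] by blast
    have yX: "y \<in> mspace X" using realizes_point[OF y] .
    have main: "D W (pt y W) (b W) \<le> max \<theta>j (T + 4 * \<kappa>)"
      if W: "W \<in> below H V" and S: "S \<in> \<U>" and WS: "\<not> orth H W S" for W S
    proof (cases "nest H W U")
      case True
      then have "W \<in> below H U" using W unfolding below_def by blast
      then have "D W (pt y W) (b W) \<le> \<theta>j" using \<U> yU unfolding controls_def by blast
      then show ?thesis by simp
    next
      case False
      have WI: "W \<in> Idx H" using W unfolding below_def by blast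
      note SI = conjunct1[OF \<U>U[OF S]] and SU = conjunct2[OF \<U>U[OF S]]
      have nWS: "\<not> nest H W S" using nestT[OF WI SI U(1) _ SU] False by blast
      have SW: "pnest H S W \<or> transv H S W"
        using nWS WS orth_sym[OF SI WI] nest_self[OF WI] unfolding pnest_def transv_def by blast
      have "\<not> orth H U W"
        using orth_nest[OF SI U(1) WI SU] orth_sym[OF SI WI] WS by blast
      then have UW: "pnest H U W \<or> transv H U W"
        using False nest_self[OF WI] unfolding pnest_def transv_def by blast
      obtain r s where r: "r \<in> rho_set H S W" and s: "s \<in> rho_set H U W"
        using rho_ne[OF SI WI SW] rho_ne[OF U(1) WI UW] by blast
      have C: "r \<in> C W" "s \<in> C W" "pt y W \<in> C W" "b W \<in> C W"
        using rho_sub[OF SI WI SW] rho_sub[OF U(1) WI UW] r s pt_C[OF WI yX] consistentC[OF cb' WI]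
        by auto
      have "D W (pt y W) r \<le> E" using realizes_rho[OF yU S WI SW r] .
      moreover have "D W r s \<le> E" using consist_rho[OF SI U(1) WI SU _ r s] UW WS by blast
      moreover have "D W (b W) s \<le> T + 2 * \<kappa>" using dom[OF W UW s] .
      ultimately have "D W (pt y W) (b W) \<le> T + 4 * \<kappa>"
        using mdist_triangle[OF C(3,1,4)] mdist_triangle[OF C(1,2,4)]
          mdist_commute[of "CSpace H W" "b W" s] \<kappa> by linarith
      then show ?thesis by simp
    qed
    obtain S where S: "S \<in> \<U>" using ne by blast
    have "\<not> orth H V S" using orth_incomparable[OF V conjunct1[OF \<U>U[OF S]]] SV[OF S] by blast
    then show "D V (pt y V) (b V) \<le> max \<theta>j (T + 4 * \<kappa>)" using main VV S by blast
    show "\<forall>W\<in>below H V. (\<exists>R\<in>\<R> \<union> \<U>. \<not> orth H W R) \<longrightarrow> D W (pt y W) (b W) \<le> max \<theta>j (T + 4 * \<kappa>)"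
    proof (intro ballI impI)
      fix W assume W: "W \<in> below H V" and "\<exists>R\<in>\<R> \<union> \<U>. \<not> orth H W R"
      then consider S where "S \<in> \<U>" "\<not> orth H W S" | R where "R \<in> \<R>" "\<not> orth H W R" by blast
      then show "D W (pt y W) (b W) \<le> max \<theta>j (T + 4 * \<kappa>)"
      proof cases
        case 1
        then show ?thesis using main W by blast
      next
        case 2
        then have "realizes b (if \<R> = {} then {V} else \<R>) y"
          using realizes_subset[OF y, of \<R>] by auto
        then have "D W (pt y W) (b W) \<le> \<theta>" using pc W 2 unfolding partly_controls_def by blast
        then show ?thesis using T \<kappa> E_ge_1 by linarith
      qed
    qed
  qed
  ultimately show ?thesis by blast
qed

text \<open>The number \<open>m\<close> bounds how many domains may still join the family. Each step
  either ends with control or enlarges the family, at the price of a bound that depends only on the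
  old one, \<open>\<theta>j\<close> and \<kappa>; a family with \<open>n\<close> members cannot be
  enlarged.\<close>

lemma controls_from_partly:
  assumes \<kappa>: "E \<le> \<kappa>"
  shows "\<exists>\<theta>'. \<forall>b V \<R>. realizable_tuple \<kappa> b \<longrightarrow> V \<in> Idx H \<longrightarrow> chain_bounded (Suc j) V \<longrightarrow>
    (\<forall>U\<in>Idx H. chain_bounded j U \<longrightarrow> (\<exists>\<U>. controls b U \<U> \<theta>j)) \<longrightarrow>
    partly_controls b V \<R> \<theta> \<longrightarrow> n \<le> card \<R> + m \<longrightarrow> (\<exists>\<S>. controls b V \<S> \<theta>')"
proof (induction m arbitrary: \<theta>)
  case 0
  define T where "T = max \<theta> (10 * \<kappa>)"
  have "\<exists>\<S>. controls b V \<S> T"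
    if b: "realizable_tuple \<kappa> b" and V: "V \<in> Idx H" and cb: "chain_bounded (Suc j) V"
      and IH: "\<forall>U\<in>Idx H. chain_bounded j U \<longrightarrow> (\<exists>\<U>. controls b U \<U> \<theta>j)"
      and pc: "partly_controls b V \<R> \<theta>" and nR: "n \<le> card \<R>" for b V \<R>
  proof (rule ccontr)
    assume "\<nexists>\<S>. controls b V \<S> T"
    then have "\<not> controls b V (if \<R> = {} then {V} else \<R>) T" by blast
    then obtain \<R>' where R': "partly_controls b V \<R>' (max \<theta>j (T + 4 * \<kappa>))" "card \<R> < card \<R>'"
      using partly_controls_extend[OF b \<kappa> V cb pc] IH unfolding T_def by (metis max.cobounded1 max.cobounded2)
    then have "card \<R>' \<le> n"
      using orthogonal_family_card(2)[of \<R>' V] V unfolding partly_controls_def by blast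
    then show False using R'(2) nR by simp
  qed
  then show ?case by (intro exI[of _ T]) simp
next
  case (Suc m)
  define T where "T = max \<theta> (10 * \<kappa>)"
  obtain \<theta>' where \<theta>': "\<And>b V \<R>. realizable_tuple \<kappa> b \<Longrightarrow> V \<in> Idx H \<Longrightarrow> chain_bounded (Suc j) V \<Longrightarrow>
    \<forall>U\<in>Idx H. chain_bounded j U \<longrightarrow> (\<exists>\<U>. controls b U \<U> \<theta>j) \<Longrightarrow>
    partly_controls b V \<R> (max \<theta>j (T + 4 * \<kappa>)) \<Longrightarrow> n \<le> card \<R> + m \<Longrightarrow> \<exists>\<S>. controls b V \<S> \<theta>'"
    using Suc.IH[of "max \<theta>j (T + 4 * \<kappa>)"] by blast
  have "\<exists>\<S>. controls b V \<S> (max T \<theta>')"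
    if b: "realizable_tuple \<kappa> b" and V: "V \<in> Idx H" and cb: "chain_bounded (Suc j) V"
      and IH: "\<forall>U\<in>Idx H. chain_bounded j U \<longrightarrow> (\<exists>\<U>. controls b U \<U> \<theta>j)"
      and pc: "partly_controls b V \<R> \<theta>" and nR: "n \<le> card \<R> + Suc m" for b V \<R>
  proof (cases "controls b V (if \<R> = {} then {V} else \<R>) T")
    case True
    then show ?thesis using controls_mono by (meson max.cobounded1)
  next
    case False
    then obtain \<R>' where R': "partly_controls b V \<R>' (max \<theta>j (T + 4 * \<kappa>))" "card \<R> < card \<R>'"
      using partly_controls_extend[OF b \<kappa> V cb pc] IH unfolding T_def by (metis max.cobounded1 max.cobounded2)
    then have "n \<le> card \<R>' + m" using nR by simp
    then show ?thesis using \<theta>'[OF b V cb IH R'(1)] controls_mono by (meson max.cobounded2)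
  qed
  then show ?case by blast
qed

lemma exists_controls:
  assumes \<kappa>: "E \<le> \<kappa>"
  shows "\<exists>\<theta>. \<forall>b V. realizable_tuple \<kappa> b \<longrightarrow> V \<in> Idx H \<longrightarrow> chain_bounded j V \<longrightarrow>
    (\<exists>\<R>. controls b V \<R> \<theta>)"
proof (induction j)
  case 0
  then show ?case using not_chain_bounded_0 by blast
next
  case (Suc j)
  then obtain \<theta>j where \<theta>j: "\<And>b V. realizable_tuple \<kappa> b \<Longrightarrow> V \<in> Idx H \<Longrightarrow> chain_bounded j V \<Longrightarrow>
    \<exists>\<R>. controls b V \<R> \<theta>j" by blast
  obtain \<theta> where \<theta>: "\<And>b V \<R>. realizable_tuple \<kappa> b \<Longrightarrow> V \<in> Idx H \<Longrightarrow> chain_bounded (Suc j) V \<Longrightarrow>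
    \<forall>U\<in>Idx H. chain_bounded j U \<longrightarrow> (\<exists>\<U>. controls b U \<U> \<theta>j) \<Longrightarrow>
    partly_controls b V \<R> E \<Longrightarrow> n \<le> card \<R> + n \<Longrightarrow> \<exists>\<S>. controls b V \<S> \<theta>"
    using controls_from_partly[OF \<kappa>, of j \<theta>j E n] by blast
  have "\<exists>\<S>. controls b V \<S> \<theta>"
    if b: "realizable_tuple \<kappa> b" and V: "V \<in> Idx H" and cb: "chain_bounded (Suc j) V" for b V
  proof -
    have "partly_controls b V {} E"
      unfolding partly_controls_def orthogonal_family_def by (auto dest: realizes_coord)
    then show ?thesis using \<theta>[OF b V cb] \<theta>j[OF b] by auto
  qed
  then show ?case by blast
qed

text \<open>All domains lie below the largest one, whose level is at most \<open>n\<close>, so any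
  point realizing a family that controls it will do.\<close>

theorem realization:
  "\<exists>\<theta>. \<forall>b. consistent \<kappa> b \<longrightarrow> (\<forall>W\<in>Idx H. b W \<in> proj_image H W (mspace X)) \<longrightarrow> Idx H \<noteq> {} \<longrightarrow>
    (\<exists>z\<in>mspace X. \<forall>W\<in>Idx H. D W (pt z W) (b W) \<le> \<theta>)"
proof -
  obtain \<theta> where \<theta>: "\<And>b V. realizable_tuple (max E \<kappa>) b \<Longrightarrow> V \<in> Idx H \<Longrightarrow> chain_bounded n V \<Longrightarrow>
    \<exists>\<R>. controls b V \<R> \<theta>"
    using exists_controls[of "max E \<kappa>" n] by auto
  have "\<exists>z\<in>mspace X. \<forall>W\<in>Idx H. D W (pt z W) (b W) \<le> \<theta>"
    if b: "consistent \<kappa> b" and bi: "\<forall>W\<in>Idx H. b W \<in> proj_image H W (mspace X)" and ne: "Idx H \<noteq> {}" for b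
  proof -
    obtain S where S: "S \<in> Idx H" "\<And>W. W \<in> Idx H \<Longrightarrow> nest H W S" using exists_top[OF ne] by blast
    have "realizable_tuple (max E \<kappa>) b"
      using consistent_mono[OF b, of "max E \<kappa>"] bi unfolding realizable_tuple_def by simp
    from \<theta>[OF this S(1) chain_bounded_complexity] obtain \<R> where R: "controls b S \<R> \<theta>" by blast
    then have fam: "orthogonal_family \<R>" "\<R> \<noteq> {}" and RI: "\<R> \<subseteq> Idx H"
      unfolding controls_def below_def by auto
    obtain z where z: "realizes b \<R> z"
      using realizes_exists[OF fam, of b] bi RI by blast
    have "W \<in> below H S" if "W \<in> Idx H" for W using S(2)[OF that] that unfolding below_def by blast
    then show ?thesis using R z realizes_point[OF z] unfolding controls_def by blast
  qed
  then show ?thesis by blast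
qed

end

section \<open>Quasigeodesics from shortest chains\<close>

lemma mdist_self: "x \<in> mspace m \<Longrightarrow> mdist m x x = 0"
  by simp

text \<open>The infimum may not be attained, hence the 1; moving from nearly optimal points to the
  given ones costs \<xi> on either side.\<close>

lemma set_mdist_le_all:
  assumes le: "set_mdist m P R \<le> ennreal c" "0 \<le> c" and sub: "P \<subseteq> mspace m" "R \<subseteq> mspace m"
    and P: "\<And>p p'. p \<in> P \<Longrightarrow> p' \<in> P \<Longrightarrow> mdist m p p' \<le> \<xi>"
    and R: "\<And>r r'. r \<in> R \<Longrightarrow> r' \<in> R \<Longrightarrow> mdist m r r' \<le> \<xi>"
    and pr: "p \<in> P" "r \<in> R"
  shows "mdist m p r \<le> 2 * \<xi> + c + 1"
proof -
  obtain p' r' where p'r': "p' \<in> P" "r' \<in> R" "mdist m p' r' < c + 1"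
    using set_mdist_leE[OF le(1) _ le(2), of "c + 1"] by auto
  have "mdist m p r \<le> mdist m p p' + mdist m p' r" "mdist m p' r \<le> mdist m p' r' + mdist m r' r"
    by (rule mdist_triangle; use pr p'r' sub in blast)+
  then show ?thesis
    using P[OF pr(1) p'r'(1)] R[OF p'r'(2) pr(2)] p'r'(3) by linarith
qed

text \<open>Any piece of a shortest chain is a shortest chain between its ends, so the assumed bound
  on chain lengths applies to all pairs of its points and gives the lower estimate. Rounding real
  parameters down changes their differences by at most one, which \<open>q + 1\<close>
  absorbs.\<close>

lemma quasigeodesic_from_chains:
  fixes m :: "'a metric"
  defines "R \<equiv> \<lambda>q. {(u, v). u \<in> mspace m \<and> v \<in> mspace m \<and> mdist m u v \<le> q}"
  assumes q: "1 \<le> q"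
    and chain: "\<And>x y. x \<in> mspace m \<Longrightarrow> y \<in> mspace m \<Longrightarrow>
      \<exists>N. (x, y) \<in> R q ^^ N \<and> real N \<le> q * mdist m x y + q"
  shows "quasigeodesic_mspace (q + 1) m"
  unfolding quasigeodesic_mspace_def
proof (intro ballI)
  fix x y assume x: "x \<in> mspace m" and y: "y \<in> mspace m"
  define N where "N = (LEAST N. (x, y) \<in> R q ^^ N)"
  have N: "(x, y) \<in> R q ^^ N"
    unfolding N_def using chain[OF x y] by (auto intro: LeastI)
  have least: "N \<le> M" if "(x, y) \<in> R q ^^ M" for M
    unfolding N_def using that by (rule Least_le)
  obtain f where f: "f 0 = x" "f N = y" "\<And>i. i < N \<Longrightarrow> (f i, f (Suc i)) \<in> R q"
    using N by (auto simp: relpow_fun_conv)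
  have fM: "f i \<in> mspace m" if "i \<le> N" for i
  proof (cases "i < N")
    case True
    then show ?thesis using f(3)[OF True] by (simp add: R_def)
  next
    case False
    then show ?thesis using that f(2) y by simp
  qed
  have sub: "(f i, f j) \<in> R q ^^ (j - i)" if "i \<le> j" "j \<le> N" for i j
    unfolding relpow_fun_conv
    by (rule exI[of _ "\<lambda>k. f (i + k)"]) (use that f(3) in auto)
  have upper: "mdist m (f i) (f j) \<le> q * real (j - i)" if "i \<le> j" "j \<le> N" for i j
    using that
  proof (induction j rule: dec_induct)
    case base
    then show ?case using mdist_self[OF fM[of i]] by simp
  next
    case (step k)
    have "mdist m (f i) (f (Suc k)) \<le> mdist m (f i) (f k) + mdist m (f k) (f (Suc k))"
      by (rule mdist_triangle) (use fM step in auto)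
    also have "\<dots> \<le> q * real (k - i) + q"
      using step f(3)[of k] by (simp add: R_def)
    also have "\<dots> = q * real (Suc k - i)"
      using step by (simp add: Suc_diff_le algebra_simps)
    finally show ?case .
  qed
  have lower: "real (j - i) \<le> q * mdist m (f i) (f j) + q" if ij: "i \<le> j" "j \<le> N" for i j
  proof -
    obtain M where M: "(f i, f j) \<in> R q ^^ M" "real M \<le> q * mdist m (f i) (f j) + q"
      using chain fM ij by (meson le_trans)
    have "(x, f j) \<in> R q ^^ (i + M)"
      using sub[of 0 i] ij f(1) M(1) by (auto simp: relpow_add)
    then have "(x, y) \<in> R q ^^ (i + M + (N - j))"
      using relpow_trans[OF _ sub[of j N]] ij f(2) by blast
    then have "N \<le> i + M + (N - j)" by (rule least)
    then show ?thesis using M(2) ij by linarith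
  qed
  have est: "\<bar>s - t\<bar> / (q + 1) - (q + 1) \<le> mdist m (f (nat \<lfloor>s\<rfloor>)) (f (nat \<lfloor>t\<rfloor>)) \<and>
      mdist m (f (nat \<lfloor>s\<rfloor>)) (f (nat \<lfloor>t\<rfloor>)) \<le> (q + 1) * \<bar>s - t\<bar> + (q + 1)"
    if st: "0 \<le> s" "s \<le> t" "t \<le> real N" for s t
  proof -
    define i j where "i = nat \<lfloor>s\<rfloor>" and "j = nat \<lfloor>t\<rfloor>"
    have ij: "i \<le> j" "j \<le> N"
      using st nat_mono[OF floor_mono[OF st(2)]] unfolding i_def j_def
      by (auto simp: nat_le_iff floor_le_iff)
    have r: "real i = of_int \<lfloor>s\<rfloor>" "real j = of_int \<lfloor>t\<rfloor>"
      using st unfolding i_def j_def by auto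
    then have close: "t - s \<le> real (j - i) + 1" "real (j - i) \<le> t - s + 1"
      using ij by (auto simp: of_nat_diff) linarith+
    have d0: "0 \<le> mdist m (f i) (f j)" by simp
    have "t - s \<le> q * mdist m (f i) (f j) + q + 1"
      using close(1) lower[OF ij] by linarith
    also have "\<dots> \<le> (q + 1) * (mdist m (f i) (f j) + (q + 1))"
      using q d0 by (simp add: algebra_simps)
    finally have "(t - s) / (q + 1) \<le> mdist m (f i) (f j) + (q + 1)"
      using q by (simp add: divide_le_eq mult.commute)
    moreover have "mdist m (f i) (f j) \<le> (q + 1) * (t - s) + (q + 1)"
    proof -
      have "q * real (j - i) \<le> q * (t - s + 1)" using close(2) q by simp
      also have "\<dots> \<le> (q + 1) * (t - s) + (q + 1)" using st q by (simp add: algebra_simps)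
      finally show ?thesis using upper[OF ij] by linarith
    qed
    ultimately show ?thesis using st unfolding i_def j_def by simp
  qed
  show "\<exists>l\<ge>0. \<exists>\<gamma>. \<gamma> ` {0..l} \<subseteq> mspace m \<and> \<gamma> 0 = x \<and> \<gamma> l = y \<and>
      (\<forall>s\<in>{0..l}. \<forall>t\<in>{0..l}. \<bar>s - t\<bar> / (q + 1) - (q + 1) \<le> mdist m (\<gamma> s) (\<gamma> t) \<and>
         mdist m (\<gamma> s) (\<gamma> t) \<le> (q + 1) * \<bar>s - t\<bar> + (q + 1))"
  proof (intro exI conjI ballI)
    show "0 \<le> real N" by simp
    show "(\<lambda>t. f (nat \<lfloor>t\<rfloor>)) ` {0..real N} \<subseteq> mspace m"
      using fM by (auto simp: nat_le_iff floor_le_iff)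
    show "f (nat \<lfloor>0\<rfloor>) = x" "f (nat \<lfloor>real N\<rfloor>) = y" using f by auto
    fix s t assume "s \<in> {0..real N}" "t \<in> {0..real N}"
    then have "\<bar>s - t\<bar> / (q + 1) - (q + 1) \<le> mdist m (f (nat \<lfloor>s\<rfloor>)) (f (nat \<lfloor>t\<rfloor>)) \<and>
      mdist m (f (nat \<lfloor>s\<rfloor>)) (f (nat \<lfloor>t\<rfloor>)) \<le> (q + 1) * \<bar>s - t\<bar> + (q + 1)"
      using est[of s t] est[of t s] by (cases "s \<le> t") (auto simp: mdist_commute abs_minus_commute)
    then show "\<bar>s - t\<bar> / (q + 1) - (q + 1) \<le> mdist m (f (nat \<lfloor>s\<rfloor>)) (f (nat \<lfloor>t\<rfloor>))"
      "mdist m (f (nat \<lfloor>s\<rfloor>)) (f (nat \<lfloor>t\<rfloor>)) \<le> (q + 1) * \<bar>s - t\<bar> + (q + 1)" by auto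
  qed
qed

section \<open>Coarse closest points in hyperbolic spaces\<close>

text \<open>The slack 1 makes the set nonempty although the infimum may not be attained. All such
  points are kept, so that moving the \<rho> data needs no choices.\<close>

definition coarse_closest :: "'a metric \<Rightarrow> 'a set \<Rightarrow> 'a \<Rightarrow> 'a set" where
  "coarse_closest m A z = {a \<in> A. \<forall>c\<in>A. mdist m z a \<le> mdist m z c + 1}"

lemma coarse_closest_ne:
  assumes "A \<noteq> {}"
  shows "coarse_closest m A z \<noteq> {}"
proof -
  define I where "I = (INF a\<in>A. mdist m z a)"
  have bdd: "bdd_below (mdist m z ` A)" by (rule bdd_belowI[of _ 0]) auto
  obtain a where a: "a \<in> A" "mdist m z a < I + 1"
    using cInf_lessD[of "mdist m z ` A" "I + 1"] assms unfolding I_def by auto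
  have "mdist m z a \<le> mdist m z c + 1" if "c \<in> A" for c
    using a(2) cINF_lower[OF bdd that] unfolding I_def by linarith
  then show ?thesis using a(1) unfolding coarse_closest_def by blast
qed

lemma coarse_closest_in: "a \<in> coarse_closest m A z \<Longrightarrow> a \<in> A"
  unfolding coarse_closest_def by simp

lemma coarse_closest_le: "a \<in> coarse_closest m A z \<Longrightarrow> c \<in> A \<Longrightarrow> mdist m z a \<le> mdist m z c + 1"
  unfolding coarse_closest_def by blast

text \<open>The point at distance \<open>3\<delta> + 4\<close> from \<open>a\<close> on a geodesic from \<open>a\<close> to \<open>c\<close> is too far from \<open>a\<close> to be
  near \<open>[a, z]\<close>, so by slimness it is near \<open>[c, z]\<close>.\<close>
lemma coarse_closest_reverse_triangle:
  assumes hyp: "hyperbolic_geodesic_mspace \<delta> m" and qc: "mquasiconvex m \<delta> A" and \<delta>: "0 \<le> \<delta>"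
    and A: "A \<subseteq> mspace m" and z: "z \<in> mspace m" and a: "a \<in> coarse_closest m A z" and c: "c \<in> A"
  shows "mdist m z a + mdist m a c \<le> mdist m z c + (6 * \<delta> + 8)"
proof (cases "mdist m a c \<le> 3 * \<delta> + 4")
  case True
  then show ?thesis using coarse_closest_le[OF a c] \<delta> by linarith
next
  case False
  note aA = coarse_closest_in[OF a]
  have M: "a \<in> mspace m" "c \<in> mspace m" using aA c A by auto
  have geo: "\<exists>P. mgeodesic_segment m u v P" if "u \<in> mspace m" "v \<in> mspace m" for u v
    using hyp that unfolding hyperbolic_geodesic_mspace_def geodesic_mspace_def by blast
  obtain P Q R where P: "mgeodesic_segment m a c P" and Q: "mgeodesic_segment m c z Q"
      and R: "mgeodesic_segment m a z R"
    using geo M z by meson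
  have slim: "P \<subseteq> mnbhd m \<delta> (Q \<union> R)"
    using hyp P Q R unfolding hyperbolic_geodesic_mspace_def by blast
  obtain p where p: "p \<in> P" "mdist m a p = 3 * \<delta> + 4"
    using mgeodesic_segmentD(5)[OF P, of "3 * \<delta> + 4"] False \<delta> by auto
  have "p \<in> mnbhd m \<delta> A" using qc P p(1) aA c unfolding mquasiconvex_def by blast
  then obtain a' where a': "a' \<in> A" "mdist m p a' < \<delta> + 1"
    using mem_mnbhdE[of p m \<delta> A "\<delta> + 1"] \<delta> by auto
  obtain p' where p': "p' \<in> Q \<union> R" "mdist m p p' < \<delta> + 1"
    using mem_mnbhdE[of p m \<delta> "Q \<union> R" "\<delta> + 1"] slim p(1) \<delta> by auto
  have M': "p \<in> mspace m" "a' \<in> mspace m" "p' \<in> mspace m"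
    using p a' A p' mgeodesic_segmentD(3)[OF P] mgeodesic_segmentD(3)[OF Q] mgeodesic_segmentD(3)[OF R]
    by auto
  have za: "mdist m z a \<le> mdist m z a' + 1" using coarse_closest_le[OF a a'(1)] .
  note comm = mdist_commute[of m]
  \<comment> \<open>Otherwise the point \<open>a'\<close> of \<open>A\<close> competes with
    \<open>a\<close>: from d(z,a) \<le> d(z,a') + 1 follows d(a,p') < 2\<delta> + 3, so
    \<open>p\<close> would be closer to \<open>a\<close> than 3\<delta> + 4.\<close>
  have "p' \<notin> R"
  proof
    assume "p' \<in> R"
    then have "mdist m a p' + mdist m p' z = mdist m a z" by (rule mgeodesic_segmentD(4)[OF R])
    then show False
      using p(2) a'(2) p'(2) za mdist_triangle[OF M(1) M'(3,1)] mdist_triangle[OF z M'(3,2)]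
        mdist_triangle[OF M'(3,1,2)] comm[of p' p] comm[of z a] comm[of z p'] by linarith
  qed
  then have "p' \<in> Q" using p'(1) by blast
  then have "mdist m c p' + mdist m p' z = mdist m c z" by (rule mgeodesic_segmentD(4)[OF Q])
  moreover have "mdist m a p + mdist m p c = mdist m a c" by (rule mgeodesic_segmentD(4)[OF P p(1)])
  ultimately show ?thesis
    using p(2) a'(2) p'(2) za mdist_triangle[OF M'(1,3) M(2)] mdist_triangle[OF z M'(3,1)]
      mdist_triangle[OF z M'(1,2)] comm[of p' p] comm[of z c] comm[of z p'] comm[of c p']
    by linarith
qed

text \<open>The reverse triangle inequality at \<open>z\<close>, applied to \<open>b\<close>, bounds
  d(a,b) by d(z,b) - d(z,a) plus a constant. Passing to \<open>w\<close>, where \<open>b\<close> is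
  almost closest, bounds this difference by 2 d(z,w) + 1.\<close>

lemma coarse_closest_coarse_lipschitz:
  assumes hyp: "hyperbolic_geodesic_mspace \<delta> m" and qc: "mquasiconvex m \<delta> A" and \<delta>: "0 \<le> \<delta>"
    and A: "A \<subseteq> mspace m" and z: "z \<in> mspace m" "w \<in> mspace m"
    and a: "a \<in> coarse_closest m A z" and b: "b \<in> coarse_closest m A w"
  shows "mdist m a b \<le> 2 * mdist m z w + (6 * \<delta> + 9)"
proof -
  note ab = coarse_closest_in[OF a] coarse_closest_in[OF b]
  have M: "a \<in> mspace m" "b \<in> mspace m" using ab A by auto
  have "mdist m z a + mdist m a b \<le> mdist m z b + (6 * \<delta> + 8)"
    using coarse_closest_reverse_triangle[OF hyp qc \<delta> A z(1) a ab(2)] .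
  moreover have "mdist m w b \<le> mdist m w a + 1" using coarse_closest_le[OF b ab(1)] .
  ultimately show ?thesis
    using mdist_triangle[OF z M(2)] mdist_triangle[OF z(2,1) M(1)] mdist_commute[of m z w] by linarith
qed

section \<open>Uniform constants for hierarchically hyperbolic spaces\<close>

text \<open>All larger constants are allowed too, so that a constant coming from \<open>Y\<close>
  can be absorbed later.\<close>

lemma hierarchically_hyperbolic_imp_hhs:
  assumes "hierarchically_hyperbolic X H"
  shows "\<exists>E n. \<forall>E'\<ge>E. hhs X H E' n"
proof -
  obtain \<delta> \<xi> K \<kappa>0 L E1 n E2 \<alpha> where
    pos: "0 \<le> \<delta>" "0 \<le> \<xi>" "0 \<le> K" "0 \<le> \<kappa>0" "1 \<le> L" "max \<xi> \<kappa>0 \<le> E1" "0 < E2" "0 \<le> \<alpha>" and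
    hyp: "\<forall>W\<in>Idx H. hyperbolic_geodesic_mspace \<delta> (CSpace H W)" and
    pr: "hh_projections X H \<xi> K" and nst: "hh_nesting H \<xi>" and ort: "hh_orthogonality H" and
    con: "hh_consistency X H \<xi> \<kappa>0" and ll: "hh_large_links X H L E1" and
    fc: "hh_finite_complexity H n" and bgi: "hh_bounded_geodesic_image H E2" and
    prl: "hh_partial_realization X H \<alpha>"
    using assms unfolding hierarchically_hyperbolic_def by blast
  have E1: "0 \<le> E1" using pos by linarith
  \<comment> \<open>The sum covers each constant of the axioms together with the loss 2\<xi> + 1 on
    passing from infima to arbitrary points.\<close>
  define E0 where "E0 = 1 + \<delta> + 2 * \<xi> + K + \<kappa>0 + L + E1 + E2 + \<alpha>"
  have proj_props: "proj H W x \<noteq> {} \<and> proj H W x \<subseteq> mspace (CSpace H W) \<and>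
      mdiam (CSpace H W) (proj H W x) \<le> ennreal \<xi>" if "W \<in> Idx H" "x \<in> mspace X" for W x
    using pr that unfolding hh_projections_def by simp
  then have proj_ne: "proj H W x \<noteq> {}" and proj_sub: "proj H W x \<subseteq> mspace (CSpace H W)"
    and proj_diam: "\<And>p q. p \<in> proj H W x \<Longrightarrow> q \<in> proj H W x \<Longrightarrow> mdist (CSpace H W) p q \<le> \<xi>"
    if "W \<in> Idx H" "x \<in> mspace X" for W x
    using that by (simp_all add: mdiam_le_iff[OF pos(2)])
  have rho_props: "rho_set H V W \<noteq> {} \<and> rho_set H V W \<subseteq> mspace (CSpace H W) \<and>
      mdiam (CSpace H W) (rho_set H V W) \<le> ennreal \<xi>"
    if "V \<in> Idx H" "W \<in> Idx H" "pnest H V W \<or> transv H V W" for V W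
    using that(3)
  proof
    assume "pnest H V W"
    then show ?thesis using nst that(1,2) unfolding hh_nesting_def by simp
  next
    assume "transv H V W"
    then show ?thesis using con that(1,2) unfolding hh_consistency_def by simp
  qed
  then have rho_ne: "rho_set H V W \<noteq> {}" and rho_sub: "rho_set H V W \<subseteq> mspace (CSpace H W)"
    and rho_diam: "\<And>r s. r \<in> rho_set H V W \<Longrightarrow> s \<in> rho_set H V W \<Longrightarrow> mdist (CSpace H W) r s \<le> \<xi>"
    if "V \<in> Idx H" "W \<in> Idx H" "pnest H V W \<or> transv H V W" for V W
    using that by (simp_all add: mdiam_le_iff[OF pos(2)])
  have trans_sym: "transv H V W" if "V \<in> Idx H" "W \<in> Idx H" "transv H W V" for V W
    using that ort unfolding hh_orthogonality_def symp_on_def transv_def by blast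
  show ?thesis
  proof (intro exI allI impI)
    fix E assume "E0 \<le> E"
    then have E: "1 + \<delta> + 2 * \<xi> + K + \<kappa>0 + L + E1 + E2 + \<alpha> \<le> E" unfolding E0_def .
    have Epos: "0 \<le> E" using E pos E1 by linarith
    show "hhs X H E n"
    proof
      show "1 \<le> E" using E pos E1 by linarith
      show "hyperbolic_geodesic_mspace E (CSpace H W)" if "W \<in> Idx H" for W
        by (rule hyperbolic_geodesic_mspace_mono[of \<delta>]) (use that hyp E pos E1 in auto)
      show "proj H W x \<noteq> {}" "proj H W x \<subseteq> mspace (CSpace H W)" if "W \<in> Idx H" "x \<in> mspace X" for W x
        using proj_ne proj_sub that by auto
      show "mdist (CSpace H W) p q \<le> E"
        if "W \<in> Idx H" "x \<in> mspace X" "p \<in> proj H W x" "q \<in> proj H W x" for W x p q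
        using proj_diam[OF that] E pos E1 by linarith
      show "mdist (CSpace H W) p q \<le> E * mdist X x y + E"
        if W: "W \<in> Idx H" and x: "x \<in> mspace X" and y: "y \<in> mspace X"
          and p: "p \<in> proj H W x" and q: "q \<in> proj H W y" for W x y p q
      proof -
        have "idx_dist H W x y \<le> ennreal (K * mdist X x y + K)"
          using pr W x y unfolding hh_projections_def by blast
        then have "mdist (CSpace H W) p q \<le> 2 * \<xi> + (K * mdist X x y + K) + 1"
          unfolding idx_dist_def
          by (rule set_mdist_le_all) (use proj_sub proj_diam W x y p q pos in auto)
        moreover have "K * mdist X x y \<le> E * mdist X x y"
          by (rule mult_right_mono) (use E pos E1 in auto)
        ultimately show ?thesis using E pos E1 by linarith
      qed
      show "reflp_on (Idx H) (nest H)" "antisymp_on (Idx H) (nest H)" "transp_on (Idx H) (nest H)"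
        "Idx H = {} \<or> (\<exists>!W. W \<in> Idx H \<and> (\<forall>V\<in>Idx H. nest H W V \<longrightarrow> V = W))"
        using nst unfolding hh_nesting_def by simp_all
      show "rho_set H V W \<noteq> {}" "rho_set H V W \<subseteq> mspace (CSpace H W)"
        if "V \<in> Idx H" "W \<in> Idx H" "pnest H V W \<or> transv H V W" for V W
        using rho_ne rho_sub that by auto
      show "mdist (CSpace H W) r s \<le> E"
        if "V \<in> Idx H" "W \<in> Idx H" "pnest H V W \<or> transv H V W" "r \<in> rho_set H V W" "s \<in> rho_set H V W"
        for V W r s
        using rho_diam[OF that] E pos E1 by linarith
      show "rho_map H W V p \<noteq> {}" "rho_map H W V p \<subseteq> mspace (CSpace H V)"
        if "V \<in> Idx H" "W \<in> Idx H" "pnest H V W" "p \<in> mspace (CSpace H W)" for V W p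
        using nst that unfolding hh_nesting_def by blast+
      show "hh_orthogonality H" "hh_finite_complexity H n" by (fact ort fc)+
      show "mdist (CSpace H W) p r \<le> E \<or> mdist (CSpace H V) q s \<le> E"
        if V: "V \<in> Idx H" and W: "W \<in> Idx H" and t: "transv H V W" and x: "x \<in> mspace X"
          and p: "p \<in> proj H W x" and q: "q \<in> proj H V x" and r: "r \<in> rho_set H V W" and s: "s \<in> rho_set H W V"
        for V W x p q r s
      proof -
        have "min (idx_dist_set H W x (rho_set H V W)) (idx_dist_set H V x (rho_set H W V)) \<le> ennreal \<kappa>0"
          using con V W t x unfolding hh_consistency_def by blast
        then consider "set_mdist (CSpace H W) (proj H W x) (rho_set H V W) \<le> ennreal \<kappa>0"
          | "set_mdist (CSpace H V) (proj H V x) (rho_set H W V) \<le> ennreal \<kappa>0"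
          unfolding idx_dist_set_def min_le_iff_disj by blast
        then show ?thesis
        proof cases
          case 1
          then have "mdist (CSpace H W) p r \<le> 2 * \<xi> + \<kappa>0 + 1"
            by (rule set_mdist_le_all)
              (use proj_sub proj_diam W V x p pos rho_sub rho_diam t r in auto)
          then show ?thesis using E pos E1 by linarith
        next
          case 2
          then have "mdist (CSpace H V) q s \<le> 2 * \<xi> + \<kappa>0 + 1"
            by (rule set_mdist_le_all)
              (use proj_sub proj_diam W V x q pos rho_sub rho_diam trans_sym[OF W V t] s in auto)
          then show ?thesis using E pos E1 by linarith
        qed
      qed
      show "mdist (CSpace H W) p r \<le> E \<or> mdist (CSpace H V) q s \<le> E \<and> mdist (CSpace H V) s t \<le> E"
        if V: "V \<in> Idx H" and W: "W \<in> Idx H" and VW: "pnest H V W" and x: "x \<in> mspace X"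
          and p: "p \<in> proj H W x" "p' \<in> proj H W x" and q: "q \<in> proj H V x" and r: "r \<in> rho_set H V W"
          and s: "s \<in> rho_map H W V p'" and t: "t \<in> rho_map H W V p"
        for V W x p p' q r s t
      proof -
        have "min (idx_dist_set H W x (rho_set H V W))
               (mdiam (CSpace H V) (proj H V x \<union> rho_image H W V (proj H W x))) \<le> ennreal \<kappa>0"
          using con V W VW x unfolding hh_consistency_def by blast
        then consider "set_mdist (CSpace H W) (proj H W x) (rho_set H V W) \<le> ennreal \<kappa>0"
          | "mdiam (CSpace H V) (proj H V x \<union> rho_image H W V (proj H W x)) \<le> ennreal \<kappa>0"
          unfolding idx_dist_set_def min_le_iff_disj by blast
        then show ?thesis
        proof cases
          case 1
          then have "mdist (CSpace H W) p r \<le> 2 * \<xi> + \<kappa>0 + 1"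
            by (rule set_mdist_le_all)
              (use proj_sub proj_diam W V x p pos rho_sub rho_diam VW r in auto)
          then show ?thesis using E pos E1 by linarith
        next
          case 2
          have "s \<in> rho_image H W V (proj H W x)" "t \<in> rho_image H W V (proj H W x)"
            using p s t unfolding rho_image_def by auto
          then have "mdist (CSpace H V) q s \<le> \<kappa>0" "mdist (CSpace H V) s t \<le> \<kappa>0"
            using 2 q unfolding mdiam_le_iff[OF pos(4)] by blast+
          then show ?thesis using E pos E1 by linarith
        qed
      qed
      show "mdist (CSpace H W) r s \<le> E"
        if U: "U \<in> Idx H" and V: "V \<in> Idx H" and W: "W \<in> Idx H" and UV: "nest H U V"
          and c: "pnest H V W \<or> transv H V W \<and> \<not> orth H W U"
          and r: "r \<in> rho_set H U W" and s: "s \<in> rho_set H V W" for U V W r s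
      proof -
        have T: "nest H A C" if "A \<in> Idx H" "B \<in> Idx H" "C \<in> Idx H" "nest H A B" "nest H B C" for A B C
          by (rule transp_onD[OF _ that]) (use nst in \<open>simp add: hh_nesting_def\<close>)
        have As: "A = B" if "A \<in> Idx H" "B \<in> Idx H" "nest H A B" "nest H B A" for A B
          by (rule antisymp_onD[OF _ that]) (use nst in \<open>simp add: hh_nesting_def\<close>)
        have o: "orth H W U" if "orth H U W"
          using ort U W that unfolding hh_orthogonality_def symp_on_def by blast
        have UW: "pnest H U W \<or> transv H U W"
          using c
        proof
          assume VW: "pnest H V W"
          then have "nest H U W" using T[OF U V W UV] unfolding pnest_def by blast
          moreover have "U \<noteq> W" using VW As[OF V U] UV unfolding pnest_def by blast
          ultimately show ?thesis unfolding pnest_def by blast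
        next
          assume t: "transv H V W \<and> \<not> orth H W U"
          then have "\<not> nest H W U" using T[OF W U V _ UV] unfolding transv_def by blast
          moreover have "U \<noteq> W" using t UV unfolding transv_def by blast
          ultimately show ?thesis using t o unfolding transv_def pnest_def by blast
        qed
        have VW: "pnest H V W \<or> transv H V W" using c by blast
        have "set_mdist (CSpace H W) (rho_set H U W) (rho_set H V W) \<le> ennreal \<kappa>0"
          using con U V W UV c unfolding hh_consistency_def by blast
        then have "mdist (CSpace H W) r s \<le> 2 * \<xi> + \<kappa>0 + 1"
          by (rule set_mdist_le_all)
            (use rho_sub[OF U W UW] rho_diam[OF U W UW] rho_sub[OF V W VW] rho_diam[OF V W VW] r s pos in auto)
        then show ?thesis using E pos E1 by linarith
      qed
      show "\<exists>\<T>\<subseteq>below H W - {W}. finite \<T> \<and> real (card \<T>) \<le> E * mdist (CSpace H W) p p' + E \<and>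
        (\<forall>T\<in>below H W - {W}. (\<exists>T'\<in>\<T>. T \<in> below H T') \<or>
          (\<forall>q\<in>proj H T x. \<forall>q'\<in>proj H T x'. mdist (CSpace H T) q q' \<le> E)) \<and>
        (\<forall>T'\<in>\<T>. \<forall>r\<in>rho_set H T' W. mdist (CSpace H W) p r \<le> E * mdist (CSpace H W) p p' + E)"
        if W: "W \<in> Idx H" and x: "x \<in> mspace X" and x': "x' \<in> mspace X"
          and p: "p \<in> proj H W x" and p': "p' \<in> proj H W x'" for W x x' p p'
      proof -
        define N where "N = L * enn2real (idx_dist H W x x') + L"
        define d where "d = mdist (CSpace H W) p p'"
        have "idx_dist H W x x' \<le> ennreal d"
          unfolding idx_dist_def d_def by (rule set_mdist_le_dist[OF p p'])
        then have "enn2real (idx_dist H W x x') \<le> d"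
          by (simp add: enn2real_leI d_def)
        then have "L * enn2real (idx_dist H W x x') \<le> L * d"
          using pos by (simp add: mult_left_mono)
        moreover have "L * d \<le> E * d"
          by (rule mult_right_mono) (use E pos E1 in \<open>auto simp: d_def\<close>)
        ultimately have N: "N + 2 * \<xi> + 1 \<le> E * d + E"
          using E pos E1 unfolding N_def by linarith
        have N0: "0 \<le> N" using pos unfolding N_def by simp
        obtain \<T> where T: "\<T> \<subseteq> below H W - {W}" "finite \<T>" "int (card \<T>) \<le> \<lfloor>N\<rfloor>"
          "\<forall>T\<in>below H W - {W}. (\<exists>T'\<in>\<T>. T \<in> below H T') \<or> idx_dist H T x x' < ennreal E1"
          "\<forall>T'\<in>\<T>. idx_dist_set H W x (rho_set H T' W) \<le> ennreal N"
          using bspec[OF bspec[OF bspec[OF ll[unfolded hh_large_links_def Let_def] W] x] x', folded N_def]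
          by (elim exE conjE)
        have "real (card \<T>) \<le> N" using T(3) by (simp add: le_floor_iff)
        then have card: "real (card \<T>) \<le> E * d + E" using N pos by linarith
        have small: "mdist (CSpace H T) q q' \<le> E"
          if T': "T \<in> below H W - {W}" and lt: "idx_dist H T x x' < ennreal E1"
            and q: "q \<in> proj H T x" and q': "q' \<in> proj H T x'" for T q q'
        proof -
          have TI: "T \<in> Idx H" using T' unfolding below_def by blast
          have "set_mdist (CSpace H T) (proj H T x) (proj H T x') \<le> ennreal E1"
            using lt unfolding idx_dist_def by simp
          then have "mdist (CSpace H T) q q' \<le> 2 * \<xi> + E1 + 1"
            by (rule set_mdist_le_all) (use E1 proj_sub proj_diam TI x x' q q' in auto)
          then show ?thesis using E pos by linarith
        qed
        have near: "mdist (CSpace H W) p r \<le> E * d + E"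
          if T': "T' \<in> \<T>" and r: "r \<in> rho_set H T' W" for T' r
        proof -
          have TI: "T' \<in> Idx H" and TW: "pnest H T' W" using T' T(1) unfolding below_def pnest_def by auto
          have "set_mdist (CSpace H W) (proj H W x) (rho_set H T' W) \<le> ennreal N"
            using T(5) T' unfolding idx_dist_set_def by blast
          then have "mdist (CSpace H W) p r \<le> 2 * \<xi> + N + 1"
            by (rule set_mdist_le_all) (use N0 proj_sub proj_diam rho_sub rho_diam TI TW W x p r in auto)
          then show ?thesis using N by linarith
        qed
        show ?thesis
        proof (intro exI[of _ \<T>] conjI ballI T(1,2) near[unfolded d_def] card[unfolded d_def])
          show "(\<exists>T'\<in>\<T>. T \<in> below H T') \<or>
            (\<forall>q\<in>proj H T x. \<forall>q'\<in>proj H T x'. mdist (CSpace H T) q q' \<le> E)"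
            if T': "T \<in> below H W - {W}" for T
            using bspec[OF T(4) T'] small[OF T'] by blast
        qed
      qed
      show "(\<forall>u\<in>rho_image H W V (\<gamma> ` I). \<forall>v\<in>rho_image H W V (\<gamma> ` I). mdist (CSpace H V) u v \<le> E) \<or>
        (\<exists>t\<in>I. \<exists>r\<in>rho_set H V W. mdist (CSpace H W) (\<gamma> t) r \<le> E)"
        if "V \<in> Idx H" "W \<in> Idx H" "pnest H V W" "mgeodesic (CSpace H W) I \<gamma>" for V W I \<gamma>
      proof -
        have "mdiam (CSpace H V) (rho_image H W V (\<gamma> ` I)) \<le> ennreal E2 \<or>
           \<gamma> ` I \<inter> mnbhd (CSpace H W) E2 (rho_set H V W) \<noteq> {}"
          using bgi that unfolding hh_bounded_geodesic_image_def by blast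
        then show ?thesis
        proof
          assume *: "mdiam (CSpace H V) (rho_image H W V (\<gamma> ` I)) \<le> ennreal E2"
          have "E2 \<le> E" "0 \<le> E2" using E pos E1 by linarith+
          with * show ?thesis by (meson mdiam_le_iff order_trans)
        next
          assume "\<gamma> ` I \<inter> mnbhd (CSpace H W) E2 (rho_set H V W) \<noteq> {}"
          then obtain t where t: "t \<in> I" "\<gamma> t \<in> mnbhd (CSpace H W) E2 (rho_set H V W)" by blast
          obtain r where r: "r \<in> rho_set H V W" "mdist (CSpace H W) (\<gamma> t) r < E2 + 1"
            using mem_mnbhdE[OF t(2), of "E2 + 1"] pos by auto
          have "E2 + 1 \<le> E" using E pos E1 by linarith
          then show ?thesis using t(1) r by (meson less_imp_le order_trans)
        qed
      qed
      show "\<exists>x\<in>mspace X. (\<forall>V\<in>\<V>. \<forall>p\<in>proj H V x. mdist (CSpace H V) p (b V) \<le> E) \<and>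
        (\<forall>V\<in>\<V>. \<forall>W\<in>Idx H. pnest H V W \<or> transv H W V \<longrightarrow>
          (\<forall>p\<in>proj H W x. \<forall>r\<in>rho_set H V W. mdist (CSpace H W) p r \<le> E))"
        if sub: "\<V> \<subseteq> Idx H" and ne: "\<V> \<noteq> {}"
          and o: "\<And>V W. V \<in> \<V> \<Longrightarrow> W \<in> \<V> \<Longrightarrow> V \<noteq> W \<Longrightarrow> orth H V W"
          and b: "\<And>V. V \<in> \<V> \<Longrightarrow> b V \<in> proj_image H V (mspace X)" for \<V> b
      proof -
        obtain x where x: "x \<in> mspace X" "\<forall>V\<in>\<V>. idx_dist_set H V x {b V} \<le> ennreal \<alpha>"
          "\<forall>V\<in>\<V>. \<forall>W\<in>Idx H. pnest H V W \<or> transv H W V \<longrightarrow>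
              idx_dist_set H W x (rho_set H V W) \<le> ennreal \<alpha>"
          using prl[unfolded hh_partial_realization_def, rule_format, OF sub, of b] ne o b by blast
        have bC: "b V \<in> mspace (CSpace H V)" if "V \<in> \<V>" for V
          using b[OF that] proj_sub that sub unfolding proj_image_def by blast
        have "mdist (CSpace H V) p (b V) \<le> E" if V: "V \<in> \<V>" and p: "p \<in> proj H V x" for V p
        proof -
          have VI: "V \<in> Idx H" using V sub by blast
          have bb: "mdist (CSpace H V) (b V) (b V) \<le> \<xi>"
            using mdist_self[OF bC[OF V]] pos by linarith
          have "set_mdist (CSpace H V) (proj H V x) {b V} \<le> ennreal \<alpha>"
            using x(2) V unfolding idx_dist_set_def by blast
          then have "mdist (CSpace H V) p (b V) \<le> 2 * \<xi> + \<alpha> + 1"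
            by (rule set_mdist_le_all)
              (use pos proj_sub[OF VI x(1)] proj_diam[OF VI x(1)] bb bC[OF V] p in auto)
          then show ?thesis using E pos E1 by linarith
        qed
        moreover have "mdist (CSpace H W) p r \<le> E"
          if V: "V \<in> \<V>" and W: "W \<in> Idx H" and VW: "pnest H V W \<or> transv H W V"
            and p: "p \<in> proj H W x" and r: "r \<in> rho_set H V W" for V W p r
        proof -
          have VI: "V \<in> Idx H" using V sub by blast
          have VW': "pnest H V W \<or> transv H V W" using VW trans_sym[OF VI W] by blast
          have "set_mdist (CSpace H W) (proj H W x) (rho_set H V W) \<le> ennreal \<alpha>"
            using x(3) V W VW unfolding idx_dist_set_def by blast
          then have "mdist (CSpace H W) p r \<le> 2 * \<xi> + \<alpha> + 1"
            by (rule set_mdist_le_all)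
              (use pos proj_sub[OF W x(1)] proj_diam[OF W x(1)] rho_sub[OF VI W VW'] rho_diam[OF VI W VW']
                p r in auto)
          then show ?thesis using E pos E1 by linarith
        qed
        ultimately show ?thesis using x(1) by blast
      qed
    qed
  qed
qed

context hhs
begin

text \<open>Ensures that in the last consistency axiom the \<rho> set of the smaller domain is one
  to which the axioms on \<rho> sets apply.\<close>

lemma nested_rho_defined:
  assumes U: "U \<in> Idx H" and V: "V \<in> Idx H" and W: "W \<in> Idx H" and UV: "nest H U V"
    and VW: "pnest H V W \<or> transv H V W \<and> \<not> orth H W U"
  shows "pnest H U W \<or> transv H U W"
proof (cases "pnest H V W")
  case True
  then have "nest H U W" "U \<noteq> W"
    using nestT[OF U V W UV] nestA[OF U V UV] unfolding pnest_def by auto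
  then show ?thesis unfolding pnest_def by blast
next
  case False
  then have t: "transv H V W" "\<not> orth H W U" using VW by auto
  then have "\<not> nest H W U" using nestT[OF W U V _ UV] unfolding transv_def by blast
  then show ?thesis
    using t UV orth_sym[OF U W] unfolding transv_def pnest_def by blast
qed

text \<open>The way back from points to infima. What \<open>hhs\<close> leaves out, namely
  quasigeodesics, quasiconvex images and uniqueness, has to be supplied.\<close>

lemma hierarchically_hyperbolicI:
  assumes q: "1 \<le> q" "quasigeodesic_mspace q X"
    and qc: "\<And>W. W \<in> Idx H \<Longrightarrow> mquasiconvex (CSpace H W) E (proj_image H W (mspace X))"
    and uniq: "hh_uniqueness X H"
  shows "hierarchically_hyperbolic X H"
proof -
  have E0: "0 \<le> E" using E_ge_1 by simp
  have "hh_projections X H E E"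
    unfolding hh_projections_def
  proof (intro ballI conjI)
    fix W x assume W: "W \<in> Idx H" and x: "x \<in> mspace X"
    show "proj H W x \<noteq> {}" "proj H W x \<subseteq> C W" using proj_ne proj_sub W x by auto
    show "mdiam (CSpace H W) (proj H W x) \<le> ennreal E"
      using proj_diam[OF W x] by (simp add: mdiam_le_iff[OF E0])
    show "idx_dist H W x y \<le> ennreal (E * mdist X x y + E)" if y: "y \<in> mspace X" for y
      unfolding idx_dist_def
      by (rule set_mdist_leI[OF pt_in[OF W x] pt_in[OF W y] proj_lip[OF W x y pt_in[OF W x] pt_in[OF W y]]])
  qed (rule qc)
  moreover have "hh_nesting H E"
    unfolding hh_nesting_def
  proof (intro conjI ballI impI nest_refl nest_antisym nest_trans nest_max)
    fix V W assume V: "V \<in> Idx H" and W: "W \<in> Idx H" and VW: "pnest H V W"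
    show "rho_set H V W \<noteq> {}" "rho_set H V W \<subseteq> C W"
      using rho_ne[OF V W] rho_sub[OF V W] VW by auto
    show "mdiam (CSpace H W) (rho_set H V W) \<le> ennreal E"
      using rho_diam[OF V W] VW by (simp add: mdiam_le_iff[OF E0])
    show "rho_map H W V p \<noteq> {}" "rho_map H W V p \<subseteq> C V" if "p \<in> C W" for p
      using rho_map_ne[OF V W VW that] rho_map_sub[OF V W VW that] by auto
  qed
  moreover have "hh_consistency X H E E"
    unfolding hh_consistency_def
  proof (intro conjI ballI impI)
    fix V W assume V: "V \<in> Idx H" and W: "W \<in> Idx H" and VW: "transv H V W"
    note WV = transv_sym[OF V W VW]
    show "rho_set H V W \<noteq> {}" "rho_set H V W \<subseteq> C W" "rho_set H W V \<noteq> {}" "rho_set H W V \<subseteq> C V"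
      using rho_ne[OF V W] rho_sub[OF V W] VW rho_ne[OF W V] rho_sub[OF W V] WV by auto
    show "mdiam (CSpace H W) (rho_set H V W) \<le> ennreal E" "mdiam (CSpace H V) (rho_set H W V) \<le> ennreal E"
      using rho_diam[OF V W] VW rho_diam[OF W V] WV by (simp_all add: mdiam_le_iff[OF E0])
    fix x assume x: "x \<in> mspace X"
    obtain r s where r: "r \<in> rho_set H V W" and s: "s \<in> rho_set H W V"
      using rho_ne[OF V W] rho_ne[OF W V] VW WV by blast
    from consist_transv[OF V W VW x pt_in[OF W x] pt_in[OF V x] r s]
    show "min (idx_dist_set H W x (rho_set H V W)) (idx_dist_set H V x (rho_set H W V)) \<le> ennreal E"
      using set_mdist_leI[OF pt_in[OF W x] r] set_mdist_leI[OF pt_in[OF V x] s]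
      unfolding idx_dist_set_def min_le_iff_disj by blast
  next
    fix V W x assume V: "V \<in> Idx H" and W: "W \<in> Idx H" and VW: "pnest H V W" and x: "x \<in> mspace X"
    show "min (idx_dist_set H W x (rho_set H V W))
               (mdiam (CSpace H V) (proj H V x \<union> rho_image H W V (proj H W x))) \<le> ennreal E"
    proof (cases "\<exists>p\<in>proj H W x. \<exists>r\<in>rho_set H V W. D W p r \<le> E")
      case True
      then obtain p r where "p \<in> proj H W x" "r \<in> rho_set H V W" "D W p r \<le> E" by blast
      then have "set_mdist (CSpace H W) (proj H W x) (rho_set H V W) \<le> ennreal E"
        by (rule set_mdist_leI)
      then show ?thesis unfolding idx_dist_set_def min_le_iff_disj by simp
    next
      case False
      obtain r where r: "r \<in> rho_set H V W" using rho_ne[OF V W] VW by blast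
      have st: "D V q s \<le> E \<and> D V s t \<le> E"
        if "q \<in> proj H V x" "p \<in> proj H W x" "p' \<in> proj H W x" "s \<in> rho_map H W V p" "t \<in> rho_map H W V p'"
        for q s t p p'
        using consist_nest[OF V W VW x that(3,2,1) r that(4,5)] False that r by blast
      have "mdiam (CSpace H V) (proj H V x \<union> rho_image H W V (proj H W x)) \<le> ennreal E"
        unfolding mdiam_le_iff[OF E0]
      proof (intro ballI)
        fix u v assume "u \<in> proj H V x \<union> rho_image H W V (proj H W x)"
          "v \<in> proj H V x \<union> rho_image H W V (proj H W x)"
        then show "D V u v \<le> E"
          using proj_diam[OF V x, of u v] st[of _ _ _ u v] st[of u _ _ v v] st[of v _ _ u u]
            pt_in[OF V x] mdist_commute[of "CSpace H V" u v]
          unfolding rho_image_def Un_iff UN_iff by auto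
      qed
      then show ?thesis unfolding min_le_iff_disj by blast
    qed
  next
    fix U V W assume U: "U \<in> Idx H" and V: "V \<in> Idx H" and W: "W \<in> Idx H"
      and *: "nest H U V \<and> (pnest H V W \<or> transv H V W \<and> \<not> orth H W U)"
    have UW: "pnest H U W \<or> transv H U W" using nested_rho_defined[OF U V W] * by blast
    obtain r s where r: "r \<in> rho_set H U W" and s: "s \<in> rho_set H V W"
      using rho_ne[OF U W UW] rho_ne[OF V W] * by blast
    show "set_mdist (CSpace H W) (rho_set H U W) (rho_set H V W) \<le> ennreal E"
      by (rule set_mdist_leI[OF r s]) (use consist_rho[OF U V W _ _ r s] * in blast)
  qed
  \<comment> \<open>The distance d of two projections is an infimum, so chosen points may be at
    distance d + 2E + 1; inserting this in E times the distance plus E gives the first constant. The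
    1 in \<open>E + 1\<close> makes the inequality strict.\<close>
  moreover have "hh_large_links X H (2 * E * E + 2 * E) (E + 1)"
    unfolding hh_large_links_def Let_def
  proof (intro ballI)
    fix W x x' assume W: "W \<in> Idx H" and x: "x \<in> mspace X" and x': "x' \<in> mspace X"
    define d where "d = enn2real (idx_dist H W x x')"
    define N where "N = (2 * E * E + 2 * E) * d + (2 * E * E + 2 * E)"
    have fin: "idx_dist H W x x' \<le> ennreal (D W (pt x W) (pt x' W))"
      unfolding idx_dist_def by (rule set_mdist_le_dist[OF pt_in[OF W x] pt_in[OF W x']])
    then have "idx_dist H W x x' \<le> ennreal d"
      unfolding d_def by (metis ennreal_enn2real_if ennreal_neq_top neq_top_trans order_refl)
    moreover have d0: "0 \<le> d" unfolding d_def by simp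
    ultimately have Dd: "D W (pt x W) (pt x' W) \<le> 2 * E + d + 1"
      unfolding idx_dist_def
      by (rule set_mdist_le_all)
        (use proj_sub[OF W x] proj_sub[OF W x'] proj_diam[OF W x] proj_diam[OF W x']
          pt_in[OF W x] pt_in[OF W x'] in auto)
    have "E * D W (pt x W) (pt x' W) + E \<le> E * (2 * E + d + 1) + E"
      using Dd E0 by (simp add: mult_left_mono)
    also have "\<dots> = 2 * E * E + 2 * E + E * d" by (simp add: algebra_simps)
    also have "\<dots> \<le> N"
      using mult_right_mono[OF _ d0, of E "2 * E * E + 2 * E"] E0 unfolding N_def by simp
    finally have N: "E * D W (pt x W) (pt x' W) + E \<le> N" .
    from large_links[OF W x x' pt_in[OF W x] pt_in[OF W x']] obtain \<T> where
      T: "\<T> \<subseteq> below H W - {W}" "finite \<T>" "real (card \<T>) \<le> E * D W (pt x W) (pt x' W) + E"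
        "\<forall>T\<in>below H W - {W}. (\<exists>T'\<in>\<T>. T \<in> below H T') \<or>
          (\<forall>q\<in>proj H T x. \<forall>q'\<in>proj H T x'. D T q q' \<le> E)"
        "\<forall>T'\<in>\<T>. \<forall>r\<in>rho_set H T' W. D W (pt x W) r \<le> E * D W (pt x W) (pt x' W) + E"
      by (elim exE conjE)
    show "\<exists>\<T>\<subseteq>below H W - {W}. finite \<T> \<and>
        int (card \<T>) \<le> \<lfloor>(2 * E * E + 2 * E) * enn2real (idx_dist H W x x') + (2 * E * E + 2 * E)\<rfloor> \<and>
          (\<forall>T\<in>below H W - {W}. (\<exists>T'\<in>\<T>. T \<in> below H T') \<or> idx_dist H T x x' < ennreal (E + 1)) \<and>
          (\<forall>T'\<in>\<T>. idx_dist_set H W x (rho_set H T' W)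
             \<le> ennreal ((2 * E * E + 2 * E) * enn2real (idx_dist H W x x') + (2 * E * E + 2 * E)))"
      unfolding d_def[symmetric] N_def[symmetric]
    proof (intro exI[of _ \<T>] conjI ballI T(1,2))
      show "int (card \<T>) \<le> \<lfloor>N\<rfloor>" using T(3) N by (simp add: le_floor_iff)
      show "(\<exists>T'\<in>\<T>. T \<in> below H T') \<or> idx_dist H T x x' < ennreal (E + 1)"
        if T': "T \<in> below H W - {W}" for T
      proof -
        have TI: "T \<in> Idx H" using T' unfolding below_def by blast
        have "ennreal E < ennreal (E + 1)" using E0 by (simp add: ennreal_less_iff)
        moreover have "idx_dist H T x x' \<le> ennreal E" if "D T (pt x T) (pt x' T) \<le> E"
          unfolding idx_dist_def by (rule set_mdist_leI[OF pt_in[OF TI x] pt_in[OF TI x'] that])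
        ultimately show ?thesis
          using bspec[OF T(4) T'] pt_in[OF TI x] pt_in[OF TI x'] by (meson order.strict_trans1)
      qed
      show "idx_dist_set H W x (rho_set H T' W) \<le> ennreal N" if T': "T' \<in> \<T>" for T'
      proof -
        have TI: "T' \<in> Idx H" and TW: "pnest H T' W" using T' T(1) unfolding below_def pnest_def by auto
        obtain r where r: "r \<in> rho_set H T' W" using rho_ne[OF TI W] TW by blast
        show ?thesis
          unfolding idx_dist_set_def
          by (rule set_mdist_leI[OF pt_in[OF W x] r]) (use bspec[OF bspec[OF T(5) T'] r] N in linarith)
      qed
    qed
  qed
  moreover have "hh_bounded_geodesic_image H E"
    unfolding hh_bounded_geodesic_image_def
  proof (intro ballI allI impI)
    fix V W I \<gamma> assume V: "V \<in> Idx H" and W: "W \<in> Idx H" and VW: "pnest H V W"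
      and g: "mgeodesic (CSpace H W) I \<gamma>"
    from bounded_image[OF V W VW g]
    show "mdiam (CSpace H V) (rho_image H W V (\<gamma> ` I)) \<le> ennreal E \<or>
           \<gamma> ` I \<inter> mnbhd (CSpace H W) E (rho_set H V W) \<noteq> {}"
    proof
      assume "\<exists>t\<in>I. \<exists>r\<in>rho_set H V W. D W (\<gamma> t) r \<le> E"
      then obtain t r where t: "t \<in> I" "r \<in> rho_set H V W" "D W (\<gamma> t) r \<le> E" by blast
      have "\<gamma> t \<in> C W" using g t(1) unfolding mgeodesic_def by blast
      then have "\<gamma> t \<in> mnbhd (CSpace H W) E (rho_set H V W)" by (rule mem_mnbhdI[OF _ t(2,3)])
      then show ?thesis using t(1) by blast
    qed (simp add: mdiam_le_iff[OF E0])
  qed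
  moreover have "hh_partial_realization X H E"
    unfolding hh_partial_realization_def
  proof (intro allI impI, elim conjE)
    fix \<V> p assume sub: "\<V> \<subseteq> Idx H" and ne: "\<V> \<noteq> {}"
      and o: "\<forall>V\<in>\<V>. \<forall>W\<in>\<V>. V \<noteq> W \<longrightarrow> orth H V W"
      and p: "\<forall>V\<in>\<V>. p V \<in> proj_image H V (mspace X)"
    have "orthogonal_family \<V>" using sub o unfolding orthogonal_family_def by simp
    then obtain x where x: "realizes p \<V> x"
      using realizes_exists[OF _ ne, of p] p by blast
    note xX = realizes_point[OF x]
    show "\<exists>x\<in>mspace X. (\<forall>V\<in>\<V>. idx_dist_set H V x {p V} \<le> ennreal E) \<and>
           (\<forall>V\<in>\<V>. \<forall>W\<in>Idx H. pnest H V W \<or> transv H W V \<longrightarrow>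
              idx_dist_set H W x (rho_set H V W) \<le> ennreal E)"
    proof (intro bexI[OF _ xX] conjI ballI impI)
      show "idx_dist_set H V x {p V} \<le> ennreal E" if V: "V \<in> \<V>" for V
        unfolding idx_dist_set_def
        by (rule set_mdist_leI[OF pt_in[OF subsetD[OF sub V] xX] singletonI realizes_coord[OF x V]])
      fix V W assume V: "V \<in> \<V>" and W: "W \<in> Idx H" and VW: "pnest H V W \<or> transv H W V"
      have VI: "V \<in> Idx H" using V sub by blast
      have VW': "pnest H V W \<or> transv H V W" using VW transv_sym[OF W VI] by blast
      obtain r where r: "r \<in> rho_set H V W" using rho_ne[OF VI W VW'] by blast
      show "idx_dist_set H W x (rho_set H V W) \<le> ennreal E"
        unfolding idx_dist_set_def
        by (rule set_mdist_leI[OF pt_in[OF W xX] r realizes_rho[OF x V W VW' r]])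
    qed
  qed
  moreover have "1 \<le> 2 * E * E + 2 * E" "max E E \<le> E + 1" "0 < E"
    using E_ge_1 zero_le_square[of E] by (auto intro: order_trans[of 1 "2 * E"])
  moreover have "\<exists>\<delta>\<ge>0. \<forall>W\<in>Idx H. hyperbolic_geodesic_mspace \<delta> (CSpace H W)"
    using hyp E0 by blast
  ultimately show ?thesis
    unfolding hierarchically_hyperbolic_def
    using q E0 uniq orthogonality finite_complexity by blast
qed

end

section \<open>Gates\<close>

locale hhs_subspace = hhs X H E n
  for X :: "'a metric" and H :: "('a, 'i, 'c) hh_structure" and E :: real and n :: nat +
  fixes Y :: "'a set" and h :: "real \<Rightarrow> real"
  assumes Y_sub: "Y \<subseteq> mspace X" and Y_ne: "Y \<noteq> {}"
    and Y_qc: "W \<in> Idx H \<Longrightarrow> mquasiconvex (CSpace H W) E (proj_image H W Y)"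
    and Y_hull: "x \<in> mspace X \<Longrightarrow>
      (\<And>W. W \<in> Idx H \<Longrightarrow> \<exists>p\<in>proj H W x. \<exists>a\<in>proj_image H W Y. mdist (CSpace H W) p a \<le> \<kappa>) \<Longrightarrow>
      \<exists>y\<in>Y. mdist X x y \<le> h \<kappa>"
    and uniqueness: "hh_uniqueness X H"
begin

section \<open>Closest points in the projections of the subspace\<close>

abbreviation "A W \<equiv> proj_image H W Y"
abbreviation "cp W \<equiv> coarse_closest (CSpace H W) (A W)"

lemma YX: "y \<in> Y \<Longrightarrow> y \<in> mspace X"
  using Y_sub by blast

lemma A_I: "y \<in> Y \<Longrightarrow> p \<in> proj H W y \<Longrightarrow> p \<in> A W"
  unfolding proj_image_def by blast

lemma A_E:
  assumes "p \<in> A W"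
  obtains y where "y \<in> Y" "p \<in> proj H W y"
  using assms unfolding proj_image_def by blast

lemma A_C: "W \<in> Idx H \<Longrightarrow> A W \<subseteq> C W"
  using proj_sub YX unfolding proj_image_def by blast

lemma A_ne: "W \<in> Idx H \<Longrightarrow> A W \<noteq> {}"
  using Y_ne proj_ne YX unfolding proj_image_def by blast

lemma cp_ne: "W \<in> Idx H \<Longrightarrow> cp W p \<noteq> {}"
  by (rule coarse_closest_ne[OF A_ne])

lemma cp_A: "c \<in> cp W p \<Longrightarrow> c \<in> A W"
  by (rule coarse_closest_in)

lemma cp_C: "W \<in> Idx H \<Longrightarrow> c \<in> cp W p \<Longrightarrow> c \<in> C W"
  by (rule subsetD[OF A_C cp_A])

lemma cp_le: "c \<in> cp W p \<Longrightarrow> a \<in> A W \<Longrightarrow> D W p c \<le> D W p a + 1"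
  by (rule coarse_closest_le)

lemma cp_lipschitz:
  assumes "W \<in> Idx H" "p \<in> C W" "q \<in> C W" "a \<in> cp W p" "b \<in> cp W q"
  shows "D W a b \<le> 2 * D W p q + 15 * E"
proof -
  have "D W a b \<le> 2 * D W p q + (6 * E + 9)"
    by (rule coarse_closest_coarse_lipschitz[OF hyp[OF assms(1)] Y_qc[OF assms(1)] _
          A_C[OF assms(1)] assms(2-5)])
      (use E_ge_1 in simp)
  then show ?thesis using E_ge_1 by linarith
qed

text \<open>Geodesics between points of \<open>A W\<close> stay near \<open>A W\<close>, so they
  stay more than \<open>E\<close> away from the \<rho> set and \<open>rho_map\<close> varies by at
  most \<open>E\<close> on \<open>A W\<close>. By consistency every point of \<open>A V\<close> is
  close to one of its values. The threshold 4E covers the loss E + 1 from quasiconvexity and E for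
  each of the two steps on to \<open>r\<close>.\<close>

lemma subspace_far_from_rho:
  assumes V: "V \<in> Idx H" and W: "W \<in> Idx H" and VW: "pnest H V W" and r: "r \<in> rho_set H V W"
    and far: "\<And>a. a \<in> A W \<Longrightarrow> 4 * E < D W a r"
    and p: "p \<in> A W" and s: "s \<in> rho_map H W V p" and c: "c \<in> A V"
  shows "D V c s \<le> 2 * E"
proof -
  obtain y where y: "y \<in> Y" "c \<in> proj H V y" using A_E[OF c] .
  note yX = YX[OF y(1)]
  define q where "q = pt y W"
  have q: "q \<in> proj H W y" "q \<in> A W" using pt_in[OF W yX] A_I[OF y(1)] unfolding q_def by auto
  have C: "p \<in> C W" "q \<in> C W" "c \<in> C V" using p q(2) c A_C V W by blast+
  obtain t where t: "t \<in> rho_map H W V q" using rho_map_ne[OF V W VW C(2)] by blast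
  have tC: "t \<in> C V" "s \<in> C V"
    using rho_map_sub[OF V W VW C(2)] t rho_map_sub[OF V W VW C(1)] s by auto
  have "\<not> D W q r \<le> E" using far[OF q(2)] E_ge_1 by linarith
  then have ct: "D V c t \<le> E"
    using consist_nest[OF V W VW yX q(1) q(1) y(2) r t t] by blast
  have "D V t s \<le> E"
  proof (rule ccontr)
    assume "\<not> ?thesis"
    then obtain P m r' where P: "mgeodesic_segment (CSpace H W) q p P" "m \<in> P"
        and r': "r' \<in> rho_set H V W" "D W m r' \<le> E"
      using bounded_image_segment[OF V W VW C(2,1)] t s by blast
    have "m \<in> mnbhd (CSpace H W) E (A W)"
      using Y_qc[OF W] P p q(2) unfolding mquasiconvex_def by blast
    then obtain a where a: "a \<in> A W" "D W m a < E + 1"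
      using mem_mnbhdE[of m "CSpace H W" E "A W" "E + 1"] E_ge_1 by auto
    have M: "m \<in> C W" "a \<in> C W" "r' \<in> C W" "r \<in> C W"
      using mgeodesic_segmentD(3)[OF P(1)] P(2) a(1) A_C[OF W] rho_sub[OF V W] VW r r'(1) by auto
    have "D W r' r \<le> E" using rho_diam[OF V W _ r'(1) r] VW by blast
    then show False
      using far[OF a(1)] a(2) r'(2) mdist_triangle[OF M(2,1,4)] mdist_triangle[OF M(1,3,4)]
        mdist_commute[of "CSpace H W" a m] E_ge_1 by linarith
  qed
  then show ?thesis using mdist_triangle[OF C(3) tC] ct by linarith
qed

text \<open>Either \<open>A W\<close> comes near \<open>r\<close>, and then a point of
  \<open>A W\<close> closest to the nearby \<open>pt x W\<close> is near \<open>r\<close> too, or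
  consistency of the points of \<open>Y\<close> puts all of \<open>A V\<close> near
  \<open>s\<close>.\<close>

lemma gate_tuple_transv_aux:
  assumes V: "V \<in> Idx H" and W: "W \<in> Idx H" and VW: "transv H V W" and x: "x \<in> mspace X"
    and r: "r \<in> rho_set H V W" and s: "s \<in> rho_set H W V" and near: "D W (pt x W) r \<le> E"
    and b: "b \<in> cp W (pt x W)" "c \<in> A V"
  shows "D W b r \<le> 4 * E \<or> D V c s \<le> E"
proof (cases "\<exists>p\<in>A W. D W p r \<le> E")
  case True
  then obtain p where p: "p \<in> A W" "D W p r \<le> E" by blast
  have M: "p \<in> C W" "b \<in> C W" "r \<in> C W" "pt x W \<in> C W"
    using p A_C[OF W] cp_C[OF W b(1)] rho_sub[OF V W] VW r pt_C[OF W x] by auto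
  show ?thesis
    using cp_le[OF b(1) p(1)] mdist_triangle[OF M(2,4,3)] mdist_triangle[OF M(4,3,1)] near p(2) E_ge_1
      mdist_commute[of "CSpace H W" b "pt x W"] mdist_commute[of "CSpace H W" r p] by linarith
next
  case False
  obtain y where y: "y \<in> Y" "c \<in> proj H V y" using A_E[OF b(2)] .
  note yX = YX[OF y(1)]
  have "\<not> D W (pt y W) r \<le> E" using False A_I[OF y(1) pt_in[OF W yX]] by blast
  then show ?thesis using consist_transv[OF V W VW yX pt_in[OF W yX] y(2) r s] by blast
qed

text \<open>If \<open>A W\<close> avoids the \<rho> set, \<open>subspace_far_from_rho\<close>
  applies. Otherwise, if \<open>b\<close> is far from \<open>r\<close> while almost closest to
  \<open>pt x W\<close>, a geodesic between them stays away from the \<rho> set, so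
  \<open>rho_map\<close> at \<open>b\<close> is close to the coordinate of \<open>x\<close> at
  \<open>V\<close>. A point of \<open>Y\<close> that projects to \<open>b\<close> also has its
  coordinate at \<open>V\<close> close to \<open>s\<close>, so a point of \<open>A V\<close> closest
  to \<open>pt x V\<close> cannot be far from \<open>s\<close>.\<close>

lemma gate_tuple_nest:
  assumes V: "V \<in> Idx H" and W: "W \<in> Idx H" and VW: "pnest H V W" and x: "x \<in> mspace X"
    and b: "b \<in> cp W (pt x W)" and c: "c \<in> cp V (pt x V)"
    and r: "r \<in> rho_set H V W" and s: "s \<in> rho_map H W V b"
  shows "D W b r \<le> 9 * E \<or> D V c s \<le> 9 * E"
proof (rule disjCI)
  assume nc: "\<not> D V c s \<le> 9 * E"
  show "D W b r \<le> 9 * E"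
  proof (rule ccontr)
    assume nb: "\<not> D W b r \<le> 9 * E"
    have "\<not> (\<forall>a\<in>A W. 4 * E < D W a r)"
    proof
      assume "\<forall>a\<in>A W. 4 * E < D W a r"
      then have "D V c s \<le> 2 * E"
        using subspace_far_from_rho[OF V W VW r _ cp_A[OF b] s cp_A[OF c]] by blast
      then show False using nc E_ge_1 by linarith
    qed
    then obtain p where p: "p \<in> A W" "D W p r \<le> 4 * E" by (auto simp: not_less)
    have M: "p \<in> C W" "b \<in> C W" "r \<in> C W" "pt x W \<in> C W" "c \<in> C V" "pt x V \<in> C V"
      using p A_C[OF W] cp_C[OF W b] cp_C[OF V c] rho_sub[OF V W] VW r pt_C[OF W x] pt_C[OF V x] by auto
    have xb: "D W (pt x W) b \<le> D W (pt x W) p + 1" using cp_le[OF b p(1)] .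
    have xr: "\<not> D W (pt x W) r \<le> E"
      using xb nb p(2) mdist_triangle[OF M(2,4,3)] mdist_triangle[OF M(4,3,1)] E_ge_1
        mdist_commute[of "CSpace H W" b "pt x W"] mdist_commute[of "CSpace H W" r p] by linarith
    obtain t where t: "t \<in> rho_map H W V (pt x W)" using rho_map_ne[OF V W VW M(4)] by blast
    have tC: "t \<in> C V" "s \<in> C V"
      using rho_map_sub[OF V W VW M(4)] t rho_map_sub[OF V W VW M(2)] s by auto
    have xt: "D V (pt x V) t \<le> E"
      using consist_nest[OF V W VW x pt_in[OF W x] pt_in[OF W x] pt_in[OF V x] r t t] xr by blast
    have "D V t s \<le> E"
    proof (rule ccontr)
      assume "\<not> ?thesis"
      then obtain P m r' where P: "mgeodesic_segment (CSpace H W) (pt x W) b P" "m \<in> P"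
          and r': "r' \<in> rho_set H V W" "D W m r' \<le> E"
        using bounded_image_segment[OF V W VW M(4,2)] t s by blast
      have M': "m \<in> C W" "r' \<in> C W"
        using mgeodesic_segmentD(3)[OF P(1)] P(2) rho_sub[OF V W] VW r'(1) by auto
      have rr: "D W r' r \<le> E" using rho_diam[OF V W _ r'(1) r] VW by blast
      have split: "D W (pt x W) m + D W m b = D W (pt x W) b" using mgeodesic_segmentD(4)[OF P] .
      have mr: "D W m r \<le> 2 * E" using mdist_triangle[OF M' M(3)] rr r'(2) by linarith
      \<comment> \<open>As \<open>m\<close> lies between \<open>pt x W\<close> and \<open>b\<close>,
        the point \<open>b\<close> is almost closest to \<open>m\<close> too, so its distance to
        \<open>m\<close> is at most that of \<open>p\<close> plus 1. Then \<open>b\<close> is within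
        2E + 6E + 1 of \<open>r\<close>, against the assumed 9E.\<close>
      have "D W m b \<le> 6 * E + 1"
        using split xb mr p(2) mdist_triangle[OF M(4) M'(1) M(1)] mdist_triangle[OF M'(1) M(3,1)]
          mdist_commute[of "CSpace H W" r p] by linarith
      then show False
        using mr nb mdist_triangle[OF M(2) M'(1) M(3)] mdist_commute[of "CSpace H W" b m] E_ge_1
        by linarith
    qed
    then have xs: "D V (pt x V) s \<le> 2 * E" using mdist_triangle[OF M(6) tC] xt by linarith
    obtain y where y: "y \<in> Y" "b \<in> proj H W y" using A_E[OF cp_A[OF b]] .
    note yX = YX[OF y(1)]
    define c' where "c' = pt y V"
    have c': "c' \<in> A V" "c' \<in> C V" using A_I[OF y(1) pt_in[OF V yX]] pt_C[OF V yX] unfolding c'_def by auto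
    have "\<not> D W b r \<le> E" using nb E_ge_1 by linarith
    then have "D V c' s \<le> E"
      using consist_nest[OF V W VW yX y(2) y(2) pt_in[OF V yX] r s s] unfolding c'_def by blast
    then show False
      using nc xs cp_le[OF c c'(1)] mdist_triangle[OF M(6) tC(2) c'(2)] mdist_triangle[OF M(5,6) tC(2)]
        mdist_commute[of "CSpace H V" s c'] mdist_commute[of "CSpace H V" c "pt x V"] E_ge_1 by linarith
  qed
qed

lemma gate_tuple_consistent:
  assumes x: "x \<in> mspace X" and b: "\<And>W. W \<in> Idx H \<Longrightarrow> b W \<in> cp W (pt x W)"
  shows "consistent (9 * E) b"
  unfolding consistent_def
proof (intro conjI ballI impI)
  show "b W \<in> C W" if "W \<in> Idx H" for W using cp_C b that by blast
  show "D W (b W) r \<le> 9 * E \<or> D V (b V) s \<le> 9 * E"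
    if V: "V \<in> Idx H" and W: "W \<in> Idx H" and VW: "transv H V W"
      and r: "r \<in> rho_set H V W" and s: "s \<in> rho_set H W V" for V W r s
  proof -
    have "D W (b W) r \<le> 4 * E \<or> D V (b V) s \<le> 4 * E"
      using consist_transv[OF V W VW x pt_in[OF W x] pt_in[OF V x] r s]
    proof
      assume "D W (pt x W) r \<le> E"
      from gate_tuple_transv_aux[OF V W VW x r s this b[OF W] cp_A[OF b[OF V]]] E_ge_1
      show ?thesis by linarith
    next
      assume "D V (pt x V) s \<le> E"
      from gate_tuple_transv_aux[OF W V transv_sym[OF V W VW] x s r this b[OF V] cp_A[OF b[OF W]]] E_ge_1
      show ?thesis by linarith
    qed
    then show ?thesis using E_ge_1 by linarith
  qed
  show "D W (b W) r \<le> 9 * E \<or> D V (b V) s \<le> 9 * E"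
    if "V \<in> Idx H" "W \<in> Idx H" "pnest H V W" "r \<in> rho_set H V W" "s \<in> rho_map H W V (b W)" for V W r s
    using gate_tuple_nest[OF that(1-3) x b[OF that(2)] b[OF that(1)] that(4,5)] .
qed

section \<open>The coarse gate map\<close>

definition gated :: "real \<Rightarrow> 'a \<Rightarrow> 'a \<Rightarrow> bool" where
  "gated G x y \<longleftrightarrow> y \<in> Y \<and> (\<forall>W\<in>Idx H. \<forall>p\<in>proj H W y. \<forall>c\<in>cp W (pt x W). D W p c \<le> G)"

lemma exists_gate: "\<exists>G\<ge>0. \<forall>x\<in>mspace X. \<exists>y. gated G x y"
proof (cases "Idx H = {}")
  case True
  then show ?thesis using Y_ne unfolding gated_def by auto
next
  case False
  obtain \<theta> where \<theta>: "\<And>b. consistent (9 * E) b \<Longrightarrow> \<forall>W\<in>Idx H. b W \<in> proj_image H W (mspace X) \<Longrightarrow>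
    \<exists>z\<in>mspace X. \<forall>W\<in>Idx H. D W (pt z W) (b W) \<le> \<theta>"
    using realization[of "9 * E"] False by blast
  \<comment> \<open>The summands come from moving the realization point \<open>z\<close> into
    \<open>Y\<close>, from the realization itself, and from the choice among coarse closest points.
    The absolute value is there because neither \<theta> nor \<open>h\<close> is known to be
    nonnegative.\<close>
  define G where "G = \<bar>E * h \<theta> + E + \<theta> + 15 * E\<bar>"
  have "\<exists>y. gated G x y" if x: "x \<in> mspace X" for x
  proof -
    define b where "b = (\<lambda>W. SOME c. c \<in> cp W (pt x W))"
    have b: "b W \<in> cp W (pt x W)" if "W \<in> Idx H" for W
      unfolding b_def using cp_ne[OF that] by (simp add: some_in_eq)
    have "proj_image H W Y \<subseteq> proj_image H W (mspace X)" for W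
      using Y_sub unfolding proj_image_def by blast
    then have "\<forall>W\<in>Idx H. b W \<in> proj_image H W (mspace X)" using b cp_A by blast
    then obtain z where z: "z \<in> mspace X" "\<And>W. W \<in> Idx H \<Longrightarrow> D W (pt z W) (b W) \<le> \<theta>"
      using \<theta>[OF gate_tuple_consistent[OF x b]] by blast
    have "\<exists>p\<in>proj H W z. \<exists>a\<in>A W. D W p a \<le> \<theta>" if "W \<in> Idx H" for W
      using pt_in[OF that z(1)] cp_A[OF b[OF that]] z(2)[OF that] by blast
    then obtain y where y: "y \<in> Y" "mdist X z y \<le> h \<theta>" using Y_hull[OF z(1), of \<theta>] by blast
    note yX = YX[OF y(1)]
    have "D W p c \<le> G" if W: "W \<in> Idx H" and p: "p \<in> proj H W y" and c: "c \<in> cp W (pt x W)" for W p c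
    proof -
      have M: "p \<in> C W" "pt z W \<in> C W" "b W \<in> C W" "c \<in> C W" "pt x W \<in> C W"
        using proj_sub[OF W yX] p pt_C[OF W] z(1) x cp_C[OF W] b[OF W] c by auto
      have "D W (pt z W) p \<le> E * mdist X z y + E"
        using proj_lip[OF W z(1) yX pt_in[OF W z(1)] p] .
      moreover have "E * mdist X z y \<le> E * h \<theta>" using y(2) E_ge_1 by simp
      moreover have "D W (b W) c \<le> 15 * E"
        using cp_lipschitz[OF W M(5,5) b[OF W] c] mdist_self[OF M(5)] by simp
      ultimately show ?thesis
        using z(2)[OF W] mdist_triangle[OF M(1,2,4)] mdist_triangle[OF M(2,3,4)]
          mdist_commute[of "CSpace H W" p "pt z W"] unfolding G_def by linarith
    qed
    then show ?thesis using y(1) unfolding gated_def by blast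
  qed
  then show ?thesis unfolding G_def by (meson abs_ge_zero)
qed

lemma close_if_coords_close:
  "\<exists>\<theta>\<ge>0. \<forall>x\<in>mspace X. \<forall>y\<in>mspace X.
    (\<forall>W\<in>Idx H. \<exists>p\<in>proj H W x. \<exists>q\<in>proj H W y. D W p q \<le> \<kappa>) \<longrightarrow> mdist X x y \<le> \<theta>"
proof -
  \<comment> \<open>The axiom takes a nonnegative threshold, and adding 1 makes it exceed \<kappa>
    strictly.\<close>
  obtain \<theta> :: real where \<theta>: "\<And>x y. x \<in> mspace X \<Longrightarrow> y \<in> mspace X \<Longrightarrow> \<theta> \<le> mdist X x y \<Longrightarrow>
     \<exists>V\<in>Idx H. ennreal (max 0 \<kappa> + 1) \<le> idx_dist H V x y"
    using uniqueness[unfolded hh_uniqueness_def, rule_format, of "max 0 \<kappa> + 1"] by auto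
  have "mdist X x y \<le> max 0 \<theta>"
    if x: "x \<in> mspace X" and y: "y \<in> mspace X"
      and close: "\<forall>W\<in>Idx H. \<exists>p\<in>proj H W x. \<exists>q\<in>proj H W y. D W p q \<le> \<kappa>" for x y
  proof (rule ccontr)
    assume "\<not> ?thesis"
    then obtain V where V: "V \<in> Idx H" "ennreal (max 0 \<kappa> + 1) \<le> idx_dist H V x y"
      using \<theta>[OF x y] by (meson max.coboundedI2 nle_le)
    then obtain p q where "p \<in> proj H V x" "q \<in> proj H V y" "D V p q \<le> \<kappa>" using close by blast
    then show False using V(2) unfolding idx_dist_def set_mdist_ge_iff by fastforce
  qed
  then show ?thesis by (intro exI[of _ "max 0 \<theta>"]) simp
qed

text \<open>In every domain closest points are coarsely Lipschitz, and uniqueness turns bounds on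
  coordinates into a bound in \<open>X\<close>. Steps of bounded length are all that the gates of a
  quasigeodesic need.\<close>

lemma gate_coarse_lipschitz:
  "\<exists>\<Delta>\<ge>0. \<forall>x x' y y'. x \<in> mspace X \<longrightarrow> x' \<in> mspace X \<longrightarrow> mdist X x x' \<le> R \<longrightarrow> gated G x y \<longrightarrow> gated G x' y' \<longrightarrow>
     mdist X y y' \<le> \<Delta>"
proof -
  obtain \<theta> where \<theta>: "0 \<le> \<theta>" "\<And>x y. x \<in> mspace X \<Longrightarrow> y \<in> mspace X \<Longrightarrow>
    \<forall>W\<in>Idx H. \<exists>p\<in>proj H W x. \<exists>q\<in>proj H W y. D W p q \<le> 2 * G + 2 * (E * R + E) + 15 * E \<Longrightarrow> mdist X x y \<le> \<theta>"
    using close_if_coords_close by blast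
  have "mdist X y y' \<le> \<theta>"
    if x: "x \<in> mspace X" "x' \<in> mspace X" and R: "mdist X x x' \<le> R" and g: "gated G x y" "gated G x' y'"
    for x x' y y'
  proof (rule \<theta>(2))
    show yX: "y \<in> mspace X" "y' \<in> mspace X" using g YX unfolding gated_def by auto
    show "\<forall>W\<in>Idx H. \<exists>p\<in>proj H W y. \<exists>q\<in>proj H W y'. D W p q \<le> 2 * G + 2 * (E * R + E) + 15 * E"
    proof
      fix W assume W: "W \<in> Idx H"
      obtain c c' where c: "c \<in> cp W (pt x W)" "c' \<in> cp W (pt x' W)" using cp_ne[OF W] by blast
      have M: "pt y W \<in> C W" "pt y' W \<in> C W" "c \<in> C W" "c' \<in> C W" "pt x W \<in> C W" "pt x' W \<in> C W"
        using pt_C[OF W] yX x cp_C[OF W] c by auto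
      have 1: "D W (pt y W) c \<le> G" "D W (pt y' W) c' \<le> G"
        using g W pt_in[OF W] yX c unfolding gated_def by blast+
      have "D W (pt x W) (pt x' W) \<le> E * mdist X x x' + E"
        using proj_lip[OF W x pt_in[OF W x(1)] pt_in[OF W x(2)]] .
      moreover have "E * mdist X x x' \<le> E * R" using R E_ge_1 by simp
      ultimately have "D W (pt x W) (pt x' W) \<le> E * R + E" by linarith
      then have "D W c c' \<le> 2 * (E * R + E) + 15 * E"
        using cp_lipschitz[OF W M(5,6) c] by argo
      then have "D W (pt y W) (pt y' W) \<le> 2 * G + 2 * (E * R + E) + 15 * E"
        using 1 mdist_triangle[OF M(1,3,2)] mdist_triangle[OF M(3,4,2)]
          mdist_commute[of "CSpace H W" c' "pt y' W"] by linarith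
      then show "\<exists>p\<in>proj H W y. \<exists>q\<in>proj H W y'. D W p q \<le> 2 * G + 2 * (E * R + E) + 15 * E"
        using pt_in[OF W] yX by blast
    qed
  qed
  then show ?thesis using \<theta>(1) by blast
qed

text \<open>A coordinate of a point of \<open>Y\<close> is its own closest point up to 1.\<close>

lemma gate_of_subspace:
  "\<exists>\<Delta>\<ge>0. \<forall>y y'. y \<in> Y \<longrightarrow> gated G y y' \<longrightarrow> mdist X y y' \<le> \<Delta>"
proof -
  obtain \<theta> where \<theta>: "0 \<le> \<theta>" "\<And>x y. x \<in> mspace X \<Longrightarrow> y \<in> mspace X \<Longrightarrow>
    \<forall>W\<in>Idx H. \<exists>p\<in>proj H W x. \<exists>q\<in>proj H W y. D W p q \<le> G + 1 \<Longrightarrow> mdist X x y \<le> \<theta>"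
    using close_if_coords_close by blast
  have "mdist X y y' \<le> \<theta>" if y: "y \<in> Y" and g: "gated G y y'" for y y'
  proof (rule \<theta>(2))
    show yX: "y \<in> mspace X" "y' \<in> mspace X" using y g YX unfolding gated_def by auto
    show "\<forall>W\<in>Idx H. \<exists>p\<in>proj H W y. \<exists>q\<in>proj H W y'. D W p q \<le> G + 1"
    proof
      fix W assume W: "W \<in> Idx H"
      obtain c where c: "c \<in> cp W (pt y W)" using cp_ne[OF W] by blast
      have M: "pt y W \<in> C W" "pt y' W \<in> C W" "c \<in> C W" using pt_C[OF W] yX cp_C[OF W c] by auto
      have "D W (pt y W) c \<le> 1"
        using cp_le[OF c A_I[OF y pt_in[OF W yX(1)]]] mdist_self[OF M(1)] by simp
      moreover have "D W (pt y' W) c \<le> G" using g W pt_in[OF W yX(2)] c unfolding gated_def by blast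
      ultimately have "D W (pt y W) (pt y' W) \<le> G + 1"
        using mdist_triangle[OF M(1,3,2)] mdist_commute[of "CSpace H W" c "pt y' W"] by linarith
      then show "\<exists>p\<in>proj H W y. \<exists>q\<in>proj H W y'. D W p q \<le> G + 1" using pt_in[OF W] yX by blast
    qed
  qed
  then show ?thesis using \<theta>(1) by blast
qed

text \<open>The gate map sends a quasigeodesic of the ambient space to a chain in the subspace with
  steps of bounded length and with number of steps linear in the distance of the endpoints.\<close>
lemma subspace_quasigeodesic:
  assumes q: "1 \<le> q" and qg: "quasigeodesic_mspace q X"
  shows "\<exists>q'\<ge>1. quasigeodesic_mspace q' (submetric X Y)"
proof -
  obtain G where G: "\<And>x. x \<in> mspace X \<Longrightarrow> \<exists>y. gated G x y" using exists_gate by blast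
  obtain \<Delta>1 where \<Delta>1: "0 \<le> \<Delta>1" "\<And>x x' y y'. x \<in> mspace X \<Longrightarrow> x' \<in> mspace X \<Longrightarrow> mdist X x x' \<le> 2 * q \<Longrightarrow>
      gated G x y \<Longrightarrow> gated G x' y' \<Longrightarrow> mdist X y y' \<le> \<Delta>1"
    using gate_coarse_lipschitz by blast
  obtain \<Delta>2 where \<Delta>2: "0 \<le> \<Delta>2" "\<And>y y'. y \<in> Y \<Longrightarrow> gated G y y' \<Longrightarrow> mdist X y y' \<le> \<Delta>2"
    using gate_of_subspace by blast
  \<comment> \<open>The number of steps costs q*q + 3: for end points at distance d the parameter
    interval has length at most q d + q*q, rounding up costs one step, and joining the end points to
    the gates costs two. The summand \<open>q\<close> covers the factor of d, and the two \<Delta>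
    bound the lengths of steps.\<close>
  define Q where "Q = q * q + q + 3 + \<Delta>1 + \<Delta>2"
  have qq: "0 \<le> q * q" by simp
  have Q: "1 \<le> Q" "q \<le> Q" "q * q + 3 \<le> Q" "\<Delta>1 \<le> Q" "\<Delta>2 \<le> Q"
    using q \<Delta>1(1) \<Delta>2(1) qq unfolding Q_def by linarith+
  define R where "R = {(u, v). u \<in> mspace (submetric X Y) \<and> v \<in> mspace (submetric X Y) \<and>
    mdist (submetric X Y) u v \<le> Q}"
  have R_I: "(u, v) \<in> R" if "u \<in> Y" "v \<in> Y" "mdist X u v \<le> Q" for u v
    using that YX unfolding R_def by simp
  have "\<exists>N. (y, y') \<in> R ^^ N \<and> real N \<le> Q * mdist (submetric X Y) y y' + Q"
    if "y \<in> mspace (submetric X Y)" "y' \<in> mspace (submetric X Y)" for y y'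
  proof -
    have y: "y \<in> Y" "y' \<in> Y" using that by auto
    note yX = YX[OF y(1)] YX[OF y(2)]
    obtain l \<gamma> where l: "0 \<le> l" and \<gamma>: "\<gamma> ` {0..l} \<subseteq> mspace X" "\<gamma> 0 = y" "\<gamma> l = y'"
      "\<forall>s\<in>{0..l}. \<forall>t\<in>{0..l}. \<bar>s - t\<bar> / q - q \<le> mdist X (\<gamma> s) (\<gamma> t) \<and> mdist X (\<gamma> s) (\<gamma> t) \<le> q * \<bar>s - t\<bar> + q"
      using qg yX unfolding quasigeodesic_mspace_def by blast
    define N where "N = nat \<lceil>l\<rceil>"
    \<comment> \<open>Integer sampling times cut off at \<open>l\<close>: consecutive times differ
      by at most 1, and the last sample is the end point.\<close>
    define x where "x = (\<lambda>i. \<gamma> (min (real i) l))"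
    have xX: "x i \<in> mspace X" for i
      unfolding x_def using \<gamma>(1) l by (auto simp: image_subset_iff)
    have x0: "x 0 = y" "x N = y'"
    proof -
      have "min (real N) l = l" using l unfolding N_def by linarith
      then show "x 0 = y" "x N = y'" using l \<gamma>(2,3) unfolding x_def by auto
    qed
    have step: "mdist X (x i) (x (Suc i)) \<le> 2 * q" for i
    proof -
      have "mdist X (x i) (x (Suc i)) \<le> q * \<bar>min (real i) l - min (real (Suc i)) l\<bar> + q"
        unfolding x_def
        by (rule conjunct2[OF bspec[OF bspec[OF \<gamma>(4)]]]) (use l in auto)
      also have "\<dots> \<le> q * 1 + q"
        using q by (intro add_right_mono mult_left_mono) auto
      finally show ?thesis by simp
    qed
    define g where "g = (\<lambda>i. SOME v. gated G (x i) v)"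
    have g: "gated G (x i) (g i)" for i unfolding g_def using someI_ex[OF G[OF xX]] .
    have gY: "g i \<in> Y" for i using g unfolding gated_def by blast
    have "(g i, g (Suc i)) \<in> R" for i
      by (rule R_I[OF gY gY]) (use \<Delta>1(2)[OF xX xX step[of i] g g] Q(4) in linarith)
    then have "(g 0, g N) \<in> R ^^ N" by (auto simp: relpow_fun_conv)
    moreover have "(y, g 0) \<in> R"
      by (rule R_I[OF y(1) gY]) (use \<Delta>2(2)[OF y(1), of "g 0"] g[of 0] x0 Q(5) in simp)
    moreover have "(g N, y') \<in> R"
      by (rule R_I[OF gY y(2)])
        (use \<Delta>2(2)[OF y(2), of "g N"] g[of N] x0 Q(5) mdist_commute[of X "g N" y'] in simp)
    ultimately have "(y, y') \<in> R ^^ (Suc (Suc N))"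
      using relpow_Suc_I2[of y "g 0" R "g N" N] relpow_Suc_I[of y "g N" "Suc N" R y'] by blast
    moreover have "real (Suc (Suc N)) \<le> Q * mdist X y y' + Q"
    proof -
      have "\<bar>0 - l\<bar> / q - q \<le> mdist X y y'" using bspec[OF bspec[OF \<gamma>(4), of 0], of l] l \<gamma>(2,3) by simp
      then have "l / q \<le> mdist X y y' + q" using l by simp
      then have "l \<le> q * mdist X y y' + q * q"
        using q by (simp add: pos_divide_le_eq algebra_simps)
      moreover have "q * mdist X y y' \<le> Q * mdist X y y'" using Q(2) by (intro mult_right_mono) auto
      moreover have "real N \<le> l + 1" using l unfolding N_def by linarith
      ultimately show ?thesis using Q(3) by simp
    qed
    ultimately show ?thesis unfolding mdist_submetric by blast
  qed
  then have "quasigeodesic_mspace (Q + 1) (submetric X Y)"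
    unfolding R_def by (rule quasigeodesic_from_chains[OF Q(1)])
  moreover have "1 \<le> Q + 1" using Q(1) by simp
  ultimately show ?thesis by blast
qed

end

section \<open>The induced structure\<close>

context hhs_subspace
begin

definition induced :: "('a, 'i, 'c) hh_structure" where
  "induced = H\<lparr>rho_set := \<lambda>V W. \<Union>r\<in>rho_set H V W. cp W r,
     rho_map := \<lambda>W V p. \<Union>s\<in>rho_map H W V p. cp V s\<rparr>"

lemma induced_simps [simp]:
  "Idx induced = Idx H" "CSpace induced = CSpace H" "proj induced = proj H"
  "nest induced = nest H" "orth induced = orth H"
  "rho_set induced V W = (\<Union>r\<in>rho_set H V W. cp W r)"
  "rho_map induced W V p = (\<Union>s\<in>rho_map H W V p. cp V s)"
  "pnest induced V W = pnest H V W" "transv induced V W = transv H V W"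
  "below induced W = below H W" "proj_image induced W B = proj_image H W B"
  by (simp_all add: induced_def pnest_def transv_def below_def proj_image_def)

lemma induced_orthogonality_complexity:
  "hh_orthogonality induced = hh_orthogonality H"
  "hh_finite_complexity induced m = hh_finite_complexity H m"
  unfolding hh_orthogonality_def hh_finite_complexity_def induced_simps by (rule refl)+

lemma subspace_points: "mspace (submetric X Y) = Y"
  using Y_sub by auto

lemma cp_near:
  assumes W: "W \<in> Idx H" and p: "p \<in> C W" and a: "a \<in> A W" and c: "c \<in> cp W p" and near: "D W a p \<le> \<epsilon>"
  shows "D W a c \<le> 2 * \<epsilon> + 1"
proof -
  have M: "a \<in> C W" "c \<in> C W" using a A_C[OF W] cp_C[OF W c] by auto
  show ?thesis
    using cp_le[OF c a] mdist_triangle[OF M(1) p M(2)] mdist_commute[of "CSpace H W" a p] near by linarith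
qed

text \<open>The constant 17E is what \<open>cp_lipschitz\<close> gives for closest points to points
  within \<open>E\<close>; the gate error \<open>G\<close> is lost only in partial
  realization.\<close>

lemma induced_hhs:
  assumes G: "0 \<le> G" "\<And>x. x \<in> mspace X \<Longrightarrow> \<exists>y. gated G x y"
  shows "hhs (submetric X Y) induced (G + 17 * E) n"
proof (unfold_locales, unfold induced_simps mdist_submetric subspace_points)
  have E: "1 \<le> E" "17 * E \<le> G + 17 * E" using E_ge_1 G by auto
  have rho_C: "r \<in> C W" if "V \<in> Idx H" "W \<in> Idx H" "pnest H V W \<or> transv H V W" "r \<in> rho_set H V W"
    for V W r using rho_sub[OF that(1-3)] that(4) by blast
  have map_C: "s \<in> C V"
    if "V \<in> Idx H" "W \<in> Idx H" "pnest H V W" "p \<in> C W" "s \<in> rho_map H W V p" for V W p s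
    using rho_map_sub[OF that(1-4)] that(5) by blast
  have cp17: "D W a b \<le> G + 17 * E"
    if "W \<in> Idx H" "p \<in> C W" "q \<in> C W" "a \<in> cp W p" "b \<in> cp W q" "D W p q \<le> E" for W p q a b
    using cp_lipschitz[OF that(1-5)] that(6) E by linarith
  show "1 \<le> G + 17 * E" using E by linarith
  show "hyperbolic_geodesic_mspace (G + 17 * E) (CSpace H W)" if "W \<in> Idx H" for W
    by (rule hyperbolic_geodesic_mspace_mono[OF hyp[OF that]]) (use E in linarith)
  show "proj H W x \<noteq> {}" "proj H W x \<subseteq> C W" if "W \<in> Idx H" "x \<in> Y" for W x
    using proj_ne[OF that(1) YX[OF that(2)]] proj_sub[OF that(1) YX[OF that(2)]] by auto
  show "D W p q \<le> G + 17 * E" if "W \<in> Idx H" "x \<in> Y" "p \<in> proj H W x" "q \<in> proj H W x" for W x p q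
    using proj_diam[OF that(1) YX[OF that(2)] that(3,4)] E by linarith
  show "D W p q \<le> (G + 17 * E) * mdist X x y + (G + 17 * E)"
    if "W \<in> Idx H" "x \<in> Y" "y \<in> Y" "p \<in> proj H W x" "q \<in> proj H W y" for W x y p q
  proof -
    have "D W p q \<le> E * mdist X x y + E"
      using proj_lip[OF that(1) YX[OF that(2)] YX[OF that(3)] that(4,5)] .
    moreover have "E * mdist X x y \<le> (G + 17 * E) * mdist X x y"
      by (rule mult_right_mono) (use E in auto)
    ultimately show ?thesis using E by linarith
  qed
  show "reflp_on (Idx H) (nest H)" "antisymp_on (Idx H) (nest H)" "transp_on (Idx H) (nest H)"
    "Idx H = {} \<or> (\<exists>!W. W \<in> Idx H \<and> (\<forall>V\<in>Idx H. nest H W V \<longrightarrow> V = W))"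
    by (fact nest_refl nest_antisym nest_trans nest_max)+
  show "(\<Union>r\<in>rho_set H V W. cp W r) \<noteq> {}" "(\<Union>r\<in>rho_set H V W. cp W r) \<subseteq> C W"
    if "V \<in> Idx H" "W \<in> Idx H" "pnest H V W \<or> transv H V W" for V W
    using rho_ne[OF that] cp_ne[OF that(2)] cp_C[OF that(2)] by auto
  show "D W r s \<le> G + 17 * E"
    if "V \<in> Idx H" "W \<in> Idx H" "pnest H V W \<or> transv H V W"
      and rs: "r \<in> (\<Union>r\<in>rho_set H V W. cp W r)" "s \<in> (\<Union>r\<in>rho_set H V W. cp W r)" for V W r s
  proof -
    obtain r0 s0 where r: "r0 \<in> rho_set H V W" "r \<in> cp W r0" "s0 \<in> rho_set H V W" "s \<in> cp W s0"
      using rs by blast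
    show ?thesis
      by (rule cp17[OF that(2) rho_C[OF that(1-3) r(1)] rho_C[OF that(1-3) r(3)] r(2,4)
            rho_diam[OF that(1-3) r(1,3)]])
  qed
  show "(\<Union>s\<in>rho_map H W V p. cp V s) \<noteq> {}" "(\<Union>s\<in>rho_map H W V p. cp V s) \<subseteq> C V"
    if "V \<in> Idx H" "W \<in> Idx H" "pnest H V W" "p \<in> C W" for V W p
    by (simp add: rho_map_ne[OF that] cp_ne[OF that(1)])
      (rule UN_least, rule subsetI, rule cp_C[OF that(1)])
  show "hh_orthogonality induced" "hh_finite_complexity induced n"
    unfolding induced_orthogonality_complexity by (fact orthogonality finite_complexity)+
  show "D W p r \<le> G + 17 * E \<or> D V q s \<le> G + 17 * E"
    if V: "V \<in> Idx H" and W: "W \<in> Idx H" and VW: "transv H V W" and x: "x \<in> Y"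
      and p: "p \<in> proj H W x" and q: "q \<in> proj H V x"
      and r: "r \<in> (\<Union>r\<in>rho_set H V W. cp W r)" and s: "s \<in> (\<Union>r\<in>rho_set H W V. cp V r)"
    for V W x p q r s
  proof -
    obtain r0 s0 where r0: "r0 \<in> rho_set H V W" "r \<in> cp W r0" and s0: "s0 \<in> rho_set H W V" "s \<in> cp V s0"
      using r s by blast
    have C: "r0 \<in> C W" "s0 \<in> C V"
      using rho_C[OF V W _ r0(1)] rho_C[OF W V _ s0(1)] VW transv_sym[OF V W VW] by auto
    from consist_transv[OF V W VW YX[OF x] p q r0(1) s0(1)] show ?thesis
    proof
      assume "D W p r0 \<le> E"
      from cp_near[OF W C(1) A_I[OF x p] r0(2) this] E show ?thesis by linarith
    next
      assume "D V q s0 \<le> E"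
      from cp_near[OF V C(2) A_I[OF x q] s0(2) this] E show ?thesis by linarith
    qed
  qed
  show "D W p r \<le> G + 17 * E \<or> D V q s \<le> G + 17 * E \<and> D V s t \<le> G + 17 * E"
    if V: "V \<in> Idx H" and W: "W \<in> Idx H" and VW: "pnest H V W" and x: "x \<in> Y"
      and p: "p \<in> proj H W x" and p': "p' \<in> proj H W x" and q: "q \<in> proj H V x"
      and r: "r \<in> (\<Union>r\<in>rho_set H V W. cp W r)" and s: "s \<in> (\<Union>s\<in>rho_map H W V p'. cp V s)"
      and t: "t \<in> (\<Union>s\<in>rho_map H W V p. cp V s)"
    for V W x p p' q r s t
  proof -
    obtain r0 s0 t0 where r0: "r0 \<in> rho_set H V W" "r \<in> cp W r0"
      and s0: "s0 \<in> rho_map H W V p'" "s \<in> cp V s0" and t0: "t0 \<in> rho_map H W V p" "t \<in> cp V t0"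
      using r s t by blast
    have pC: "p \<in> C W" "p' \<in> C W" using proj_sub[OF W YX[OF x]] p p' by auto
    have C: "r0 \<in> C W" "s0 \<in> C V" "t0 \<in> C V"
      using rho_C[OF V W _ r0(1)] map_C[OF V W VW pC(2) s0(1)] map_C[OF V W VW pC(1) t0(1)] VW by auto
    from consist_nest[OF V W VW YX[OF x] p p' q r0(1) s0(1) t0(1)] show ?thesis
    proof
      assume "D W p r0 \<le> E"
      from cp_near[OF W C(1) A_I[OF x p] r0(2) this] E show ?thesis by linarith
    next
      assume *: "D V q s0 \<le> E \<and> D V s0 t0 \<le> E"
      have "D V q s \<le> 2 * E + 1" using cp_near[OF V C(2) A_I[OF x q] s0(2)] * by blast
      moreover have "D V s t \<le> G + 17 * E" using cp17[OF V C(2,3) s0(2) t0(2)] * by blast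
      ultimately show ?thesis using E by auto
    qed
  qed
  show "D W r s \<le> G + 17 * E"
    if U: "U \<in> Idx H" and V: "V \<in> Idx H" and W: "W \<in> Idx H" and UV: "nest H U V"
      and c: "pnest H V W \<or> transv H V W \<and> \<not> orth H W U"
      and r: "r \<in> (\<Union>r\<in>rho_set H U W. cp W r)" and s: "s \<in> (\<Union>r\<in>rho_set H V W. cp W r)" for U V W r s
  proof -
    have VW: "pnest H V W \<or> transv H V W" using c by blast
    have UW: "pnest H U W \<or> transv H U W" using nested_rho_defined[OF U V W UV c] .
    obtain r0 s0 where r0: "r0 \<in> rho_set H U W" "r \<in> cp W r0" and s0: "s0 \<in> rho_set H V W" "s \<in> cp W s0"
      using r s by blast
    show ?thesis
      by (rule cp17[OF W rho_C[OF U W UW r0(1)] rho_C[OF V W VW s0(1)] r0(2) s0(2)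
            consist_rho[OF U V W UV c r0(1) s0(1)]])
  qed
  show "\<exists>\<T>\<subseteq>below H W - {W}. finite \<T> \<and>
        real (card \<T>) \<le> (G + 17 * E) * D W p p' + (G + 17 * E) \<and>
        (\<forall>T\<in>below H W - {W}. (\<exists>T'\<in>\<T>. T \<in> below H T') \<or>
          (\<forall>q\<in>proj H T x. \<forall>q'\<in>proj H T x'. D T q q' \<le> G + 17 * E)) \<and>
        (\<forall>T'\<in>\<T>. \<forall>r\<in>\<Union>r\<in>rho_set H T' W. cp W r. D W p r \<le> (G + 17 * E) * D W p p' + (G + 17 * E))"
    if W: "W \<in> Idx H" and x: "x \<in> Y" and x': "x' \<in> Y"
      and p: "p \<in> proj H W x" and p': "p' \<in> proj H W x'" for W x x' p p'
  proof -
    define N where "N = E * D W p p' + E"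
    have "3 * E * D W p p' \<le> (G + 17 * E) * D W p p'"
      by (rule mult_right_mono) (use E in auto)
    then have "3 * (E * D W p p') \<le> (G + 17 * E) * D W p p'" by (simp only: mult.assoc)
    moreover have "0 \<le> E * D W p p'" using E by simp
    ultimately have N: "N \<le> (G + 17 * E) * D W p p' + (G + 17 * E)"
      "2 * N + 1 \<le> (G + 17 * E) * D W p p' + (G + 17 * E)"
      using E unfolding N_def by argo+
    from large_links[OF W YX[OF x] YX[OF x'] p p', folded N_def] obtain \<T> where
      T: "\<T> \<subseteq> below H W - {W}" "finite \<T>" "real (card \<T>) \<le> N"
        "\<forall>T\<in>below H W - {W}. (\<exists>T'\<in>\<T>. T \<in> below H T') \<or>
          (\<forall>q\<in>proj H T x. \<forall>q'\<in>proj H T x'. D T q q' \<le> E)"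
        "\<forall>T'\<in>\<T>. \<forall>r\<in>rho_set H T' W. D W p r \<le> N"
      by (elim exE conjE)
    show ?thesis
    proof (intro exI[of _ \<T>] conjI ballI T(1,2))
      show "real (card \<T>) \<le> (G + 17 * E) * D W p p' + (G + 17 * E)" using T(3) N(1) by linarith
      show "(\<exists>T'\<in>\<T>. T \<in> below H T') \<or> (\<forall>q\<in>proj H T x. \<forall>q'\<in>proj H T x'. D T q q' \<le> G + 17 * E)"
        if "T \<in> below H W - {W}" for T
      proof -
        have "E \<le> G + 17 * E" using E by linarith
        then show ?thesis using bspec[OF T(4) that] by (meson order_trans)
      qed
      show "D W p r \<le> (G + 17 * E) * D W p p' + (G + 17 * E)"
        if T': "T' \<in> \<T>" and r: "r \<in> (\<Union>r\<in>rho_set H T' W. cp W r)" for T' r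
      proof -
        obtain r0 where r0: "r0 \<in> rho_set H T' W" "r \<in> cp W r0" using r by blast
        have TI: "T' \<in> Idx H" "pnest H T' W" using T(1) T' unfolding below_def pnest_def by auto
        have "r0 \<in> C W" using rho_C[OF TI(1) W _ r0(1)] TI(2) by blast
        from cp_near[OF W this A_I[OF x p] r0(2) bspec[OF bspec[OF T(5) T'] r0(1)]] N(2)
        show ?thesis by linarith
      qed
    qed
  qed
  show "(\<forall>u\<in>rho_image induced W V (\<gamma> ` I). \<forall>v\<in>rho_image induced W V (\<gamma> ` I). D V u v \<le> G + 17 * E) \<or>
      (\<exists>t\<in>I. \<exists>r\<in>\<Union>r\<in>rho_set H V W. cp W r. D W (\<gamma> t) r \<le> G + 17 * E)"
    if V: "V \<in> Idx H" and W: "W \<in> Idx H" and VW: "pnest H V W" and g: "mgeodesic (CSpace H W) I \<gamma>"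
    for V W I \<gamma>
  proof -
    have \<gamma>C: "\<gamma> t \<in> C W" if "t \<in> I" for t using g that unfolding mgeodesic_def by blast
    have img: "\<exists>u0. u0 \<in> C V \<and> u0 \<in> rho_image H W V (\<gamma> ` I) \<and> u \<in> cp V u0"
      if "u \<in> rho_image induced W V (\<gamma> ` I)" for u
      using that map_C[OF V W VW \<gamma>C] unfolding rho_image_def by auto
    show ?thesis
    proof (cases "\<forall>u\<in>rho_image H W V (\<gamma> ` I). \<forall>v\<in>rho_image H W V (\<gamma> ` I). D V u v \<le> E")
      case True
      have "D V u v \<le> G + 17 * E"
        if uv: "u \<in> rho_image induced W V (\<gamma> ` I)" "v \<in> rho_image induced W V (\<gamma> ` I)" for u v
      proof -
        obtain u0 v0 where u0: "u0 \<in> C V" "u0 \<in> rho_image H W V (\<gamma> ` I)" "u \<in> cp V u0"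
          and v0: "v0 \<in> C V" "v0 \<in> rho_image H W V (\<gamma> ` I)" "v \<in> cp V v0"
          using img[OF uv(1)] img[OF uv(2)] by blast
        show ?thesis
          by (rule cp17[OF V u0(1) v0(1) u0(3) v0(3) bspec[OF bspec[OF True u0(2)] v0(2)]])
      qed
      then show ?thesis by blast
    next
      case False
      then obtain t r where t: "t \<in> I" and r: "r \<in> rho_set H V W" "D W (\<gamma> t) r \<le> E"
        using bounded_image[OF V W VW g] by blast
      have rC: "r \<in> C W" using rho_C[OF V W _ r(1)] VW by blast
      \<comment> \<open>If the old \<rho> set is within reach of \<open>A W\<close>, closest points
        to it are near it and the geodesic comes near the new one too. Otherwise \<open>A V\<close>
        is bounded, and it contains all values of the new \<open>rho_map\<close>.\<close>
      show ?thesis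
      proof (cases "\<exists>a\<in>A W. D W a r \<le> 4 * E")
        case True
        then obtain a where a: "a \<in> A W" "D W a r \<le> 4 * E" by blast
        obtain c where c: "c \<in> cp W r" using cp_ne[OF W] by blast
        have "D W r c \<le> 4 * E + 1" using cp_le[OF c a(1)] a(2) mdist_commute[of "CSpace H W" a r] by linarith
        then have "D W (\<gamma> t) c \<le> G + 17 * E"
          using mdist_triangle[OF \<gamma>C[OF t] rC cp_C[OF W c]] r(2) E by linarith
        then show ?thesis using t r(1) c by blast
      next
        case False
        then have far: "\<And>a. a \<in> A W \<Longrightarrow> 4 * E < D W a r" by (simp add: not_le)
        obtain p where p: "p \<in> A W" using A_ne[OF W] by blast
        have pC: "p \<in> C W" using p A_C[OF W] by blast
        obtain s where s: "s \<in> rho_map H W V p" using rho_map_ne[OF V W VW pC] by blast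
        have sC: "s \<in> C V" using map_C[OF V W VW pC s] .
        have small: "D V u v \<le> G + 17 * E" if u: "u \<in> A V" and v: "v \<in> A V" for u v
        proof -
          have C: "u \<in> C V" "v \<in> C V" using u v A_C[OF V] by auto
          show ?thesis
            using subspace_far_from_rho[OF V W VW r(1) far p s u] subspace_far_from_rho[OF V W VW r(1) far p s v]
              mdist_triangle[OF C(1) sC C(2)] mdist_commute[of "CSpace H V" v s] E by linarith
        qed
        have "u \<in> A V" if "u \<in> rho_image induced W V (\<gamma> ` I)" for u
          using img[OF that] cp_A by blast
        then show ?thesis using small by blast
      qed
    qed
  qed
  show "\<exists>x\<in>Y. (\<forall>V\<in>\<V>. \<forall>p\<in>proj H V x. D V p (b V) \<le> G + 17 * E) \<and>
      (\<forall>V\<in>\<V>. \<forall>W\<in>Idx H. pnest H V W \<or> transv H W V \<longrightarrow>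
        (\<forall>p\<in>proj H W x. \<forall>r\<in>\<Union>r\<in>rho_set H V W. cp W r. D W p r \<le> G + 17 * E))"
    if sub: "\<V> \<subseteq> Idx H" and ne: "\<V> \<noteq> {}"
      and o: "\<And>V W. V \<in> \<V> \<Longrightarrow> W \<in> \<V> \<Longrightarrow> V \<noteq> W \<Longrightarrow> orth H V W"
      and b: "\<And>V. V \<in> \<V> \<Longrightarrow> b V \<in> A V" for \<V> b
  proof -
    have "orthogonal_family \<V>" using sub o unfolding orthogonal_family_def by simp
    moreover have "b V \<in> proj_image H V (mspace X)" if "V \<in> \<V>" for V
      using b[OF that] Y_sub unfolding proj_image_def by blast
    ultimately obtain x where x: "realizes b \<V> x" using realizes_exists[OF _ ne, of b] by blast
    note xX = realizes_point[OF x]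
    \<comment> \<open>The gate has coordinates near the closest points of those of \<open>x\<close>.
      Where \<open>x\<close> is near a prescribed point of \<open>A V\<close>, these are near that
      point; where \<open>x\<close> is near an old \<rho> set, the Lipschitz estimate puts them near
      the new one.\<close>
    obtain y where y: "gated G x y" using G(2)[OF xX] by blast
    have yY: "y \<in> Y" and gate: "\<And>W p c. W \<in> Idx H \<Longrightarrow> p \<in> proj H W y \<Longrightarrow> c \<in> cp W (pt x W) \<Longrightarrow> D W p c \<le> G"
      using y unfolding gated_def by auto
    note yX = YX[OF yY]
    have "D V p (b V) \<le> G + 17 * E" if V: "V \<in> \<V>" and p: "p \<in> proj H V y" for V p
    proof -
      have VI: "V \<in> Idx H" using V sub by blast
      obtain c where c: "c \<in> cp V (pt x V)" using cp_ne[OF VI] by blast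
      have M: "p \<in> C V" "c \<in> C V" "b V \<in> C V" "pt x V \<in> C V"
        using proj_sub[OF VI yX] p cp_C[OF VI c] b[OF V] A_C[OF VI] pt_C[OF VI xX] by auto
      have "D V (b V) (pt x V) \<le> E"
        using realizes_coord[OF x V] mdist_commute[of "CSpace H V" "b V" "pt x V"] by linarith
      from cp_near[OF VI M(4) b[OF V] c this] show ?thesis
        using gate[OF VI p c] mdist_triangle[OF M(1-3)] mdist_commute[of "CSpace H V" "b V" c] E by linarith
    qed
    moreover have "D W p r \<le> G + 17 * E"
      if V: "V \<in> \<V>" and W: "W \<in> Idx H" and VW: "pnest H V W \<or> transv H W V"
        and p: "p \<in> proj H W y" and r: "r \<in> (\<Union>r\<in>rho_set H V W. cp W r)" for V W p r
    proof -
      have VI: "V \<in> Idx H" using V sub by blast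
      have VW': "pnest H V W \<or> transv H V W" using VW transv_sym[OF W VI] by blast
      obtain r0 where r0: "r0 \<in> rho_set H V W" "r \<in> cp W r0" using r by blast
      obtain c where c: "c \<in> cp W (pt x W)" using cp_ne[OF W] by blast
      have r0C: "r0 \<in> C W" using rho_C[OF VI W VW' r0(1)] .
      have M: "p \<in> C W" "c \<in> C W" "r \<in> C W"
        using proj_sub[OF W yX] p cp_C[OF W c] cp_C[OF W r0(2)] by auto
      have "D W c r \<le> 2 * E + 15 * E"
        using cp_lipschitz[OF W pt_C[OF W xX] r0C c r0(2)] realizes_rho[OF x V W VW' r0(1)] by linarith
      then show ?thesis using gate[OF W p c] mdist_triangle[OF M] by linarith
    qed
    ultimately show ?thesis using yY by blast
  qed
qed

theorem subspace_hierarchically_hyperbolic: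
  assumes "1 \<le> q" "quasigeodesic_mspace q X"
  shows "hierarchically_hyperbolic (submetric X Y) induced"
proof -
  obtain G where G: "0 \<le> G" "\<And>x. x \<in> mspace X \<Longrightarrow> \<exists>y. gated G x y" using exists_gate by blast
  obtain q' where q': "1 \<le> q'" "quasigeodesic_mspace q' (submetric X Y)"
    using subspace_quasigeodesic[OF assms] by blast
  have uniq: "hh_uniqueness (submetric X Y) induced"
    unfolding hh_uniqueness_def
  proof (intro allI impI)
    fix \<kappa> :: real assume "0 \<le> \<kappa>"
    then obtain \<theta> where "\<forall>x\<in>mspace X. \<forall>y\<in>mspace X. \<theta> \<le> mdist X x y \<longrightarrow> (\<exists>V\<in>Idx H. ennreal \<kappa> \<le> idx_dist H V x y)"
      using uniqueness unfolding hh_uniqueness_def by blast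
    then show "\<exists>\<theta>. \<forall>x\<in>mspace (submetric X Y). \<forall>y\<in>mspace (submetric X Y).
      \<theta> \<le> mdist (submetric X Y) x y \<longrightarrow> (\<exists>V\<in>Idx induced. ennreal \<kappa> \<le> idx_dist induced V x y)"
      using YX by (intro exI[of _ \<theta>]) (simp add: idx_dist_def)
  qed
  have qc: "mquasiconvex (CSpace induced W) (G + 17 * E) (proj_image induced W (mspace (submetric X Y)))"
    if "W \<in> Idx induced" for W
    using mquasiconvex_mono[OF Y_qc[of W], of "G + 17 * E"] that E_ge_1 G(1)
    unfolding subspace_points by simp
  show ?thesis
    by (rule hhs.hierarchically_hyperbolicI[OF induced_hhs[OF G] q' qc uniq])
qed

end

text \<open>For empty \<open>Y\<close> there are no closest points, so the moved \<rho> sets would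
  be empty; over an empty space the structure without indices serves instead.\<close>

lemma empty_hierarchically_hyperbolic:
  assumes "mspace X = {}"
  shows "\<exists>H :: ('a, 'i, 'c) hh_structure. hierarchically_hyperbolic (X :: 'a metric) H"
proof -
  define H :: "('a, 'i, 'c) hh_structure" where
    "H = \<lparr>Idx = {}, CSpace = undefined, proj = undefined, nest = undefined, orth = undefined,
       rho_set = undefined, rho_map = undefined\<rparr>"
  have I: "Idx H = {}" by (simp add: H_def)
  have "quasigeodesic_mspace 1 X" using assms by (simp add: quasigeodesic_mspace_def)
  moreover have "hh_projections X H 0 0" "hh_nesting H 0" "hh_orthogonality H" "hh_consistency X H 0 0"
    "hh_large_links X H 1 0" "hh_finite_complexity H 0" "hh_bounded_geodesic_image H 1"
    "hh_partial_realization X H 0" "hh_uniqueness X H"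
    unfolding hh_projections_def hh_nesting_def hh_orthogonality_def hh_consistency_def
      hh_large_links_def hh_finite_complexity_def hh_bounded_geodesic_image_def
      hh_partial_realization_def hh_uniqueness_def
    by (auto simp: I assms reflp_on_def antisymp_on_def transp_on_def symp_on_def irreflp_on_def)
  ultimately show ?thesis
    unfolding hierarchically_hyperbolic_def I
    by (intro exI[of _ H] conjI exI[of _ 0] exI[of _ 1]) (simp_all add: I)
qed

theorem proposition5p6:
  fixes X :: "'a metric" and H :: "('a, 'i, 'c) hh_structure"
    and k :: "real \<Rightarrow> real" and Y :: "'a set"
  assumes "hierarchically_hyperbolic X H"
    and "\<forall>t\<ge>0. k t \<ge> 0"
    and "hierarchically_quasiconvex X H k Y"
  shows "\<exists>H' :: ('a, 'i, 'c) hh_structure. hierarchically_hyperbolic (submetric X Y) H'"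
proof (cases "Y = {}")
  case True
  then show ?thesis by (intro empty_hierarchically_hyperbolic) simp
next
  case False
  obtain E0 n where E0: "\<And>E'. E0 \<le> E' \<Longrightarrow> hhs X H E' n"
    using hierarchically_hyperbolic_imp_hhs[OF assms(1)] by blast
  \<comment> \<open>Large enough for the projections of \<open>Y\<close> to be
    \<open>E\<close>-quasiconvex as well.\<close>
  define E where "E = max E0 (k 0)"
  interpret hhs X H E n by (rule E0) (simp add: E_def)
  have Y: "Y \<subseteq> mspace X" and qc: "\<And>W. W \<in> Idx H \<Longrightarrow> mquasiconvex (CSpace H W) (k 0) (proj_image H W Y)"
    and hull: "\<And>\<kappa> x. 0 < \<kappa> \<Longrightarrow> x \<in> mspace X \<Longrightarrow>
      \<forall>U\<in>Idx H. idx_dist_set H U x (proj_image H U Y) \<le> ennreal \<kappa> \<Longrightarrow> set_mdist X {x} Y \<le> ennreal (k \<kappa>)"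
    using assms(3) unfolding hierarchically_quasiconvex_def by auto
  \<comment> \<open>Hierarchical quasiconvexity speaks of positive \<kappa> only, hence the maximum
    with 1; the added 1 replaces an infimum by a point of \<open>Y\<close>.\<close>
  have "hhs_subspace X H E n Y (\<lambda>\<kappa>. k (max \<kappa> 1) + 1)"
  proof unfold_locales
    show "mquasiconvex (CSpace H W) E (proj_image H W Y)" if "W \<in> Idx H" for W
      by (rule mquasiconvex_mono[OF qc[OF that]]) (simp add: E_def)
    show "\<exists>y\<in>Y. mdist X x y \<le> k (max \<kappa> 1) + 1"
      if x: "x \<in> mspace X"
        and near: "\<And>W. W \<in> Idx H \<Longrightarrow> \<exists>p\<in>proj H W x. \<exists>a\<in>proj_image H W Y. D W p a \<le> \<kappa>" for x \<kappa>
    proof -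
      have "idx_dist_set H W x (proj_image H W Y) \<le> ennreal (max \<kappa> 1)" if W: "W \<in> Idx H" for W
      proof -
        obtain p a where "p \<in> proj H W x" "a \<in> proj_image H W Y" "D W p a \<le> max \<kappa> 1"
          using near[OF W] by (meson max.coboundedI1)
        then show ?thesis unfolding idx_dist_set_def by (rule set_mdist_leI)
      qed
      then have "set_mdist X {x} Y \<le> ennreal (k (max \<kappa> 1))" by (intro hull x) auto
      then obtain a y where "a \<in> {x}" "y \<in> Y" "mdist X a y < k (max \<kappa> 1) + 1"
        by (rule set_mdist_leE) (use assms(2) in auto)
      then show ?thesis by (intro bexI[of _ y]) auto
    qed
    show "hh_uniqueness X H" using assms(1) unfolding hierarchically_hyperbolic_def by simp
  qed (use Y False in auto)
  moreover obtain q where "1 \<le> q" "quasigeodesic_mspace q X"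
    using assms(1) unfolding hierarchically_hyperbolic_def by blast
  ultimately show ?thesis using hhs_subspace.subspace_hierarchically_hyperbolic by blast
qed

end
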